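(* Let $\Omega\subset\mathbb{R}^n$ be a bounded, open, connected set of class $C^2$, let $m\geq 1$ be an integer and $c\in\mathbb{R}$. For $i=1,\dots,m$, let $u_i\in C^2(\overline{\Omega})$, with $u_i>0$ in $\Omega$, be solutions to $$ \begin{cases} -\Delta u_i=f_i(u_i) & \text{in } \Omega,\\ u_i=0 & \text{on } \partial\Omega,\\ F\left(\frac{\partial u_1}{\partial \nu},\dots,\frac{\partial u_m}{\partial \nu}\right)=c & \text{on } \partial\Omega, \end{cases} $$ where $\nu$ is the inner unit normal to $\partial\Omega$. Assume that the functions $f_i:\mathbb{R}\to\mathbb{R}$ and $F$ satisfy the following: (i) for each $i\in\{1,\dots,m\}$, $f_i=g_i+h_i$ with $g_i:\mathbb{R}\to\mathbb{R}$ locally Lipschitz and $h_i:\mathbb{R}\to\mathbb{R}$ non-decreasing; (ii) $F:[0,+\infty)^m\to\mathbb{R}$ and $F\in C^1\left((0,+\infty)^m\right)$; (iii) for all $i\in\{1,\dots,m\}$, all $(x_1,\dots,x_m)\in[0,+\infty)^m$ and all $h>0$, $$F(x_1,\dots,x_i,\dots,x_m)\leq F(x_1,\dots,x_i+h,\dots,x_m);$$ (iv) there exists $j\in\{1,\dots,m\}$ such that $\frac{\partial F}{\partial x_j}>0$ in $(0,+\infty)^m$. Then $\Omega$ is a ball, of some radius $R>0$, and the solutions $u_i$ are radially symmetric (about the center of the ball). Moreover, $$\frac{\partial u_i}{\partial r}<0\quad\text{for } 0<r<R,\qquad \forall\, i\in\{1,\dots,m\},$$ where $r$ denotes the distance from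 the center of the ball. *)

theory Defs
  imports "HOL-Analysis.Analysis"
begin

definition partial_deriv :: "(real^'n \<Rightarrow> real) \<Rightarrow> 'n \<Rightarrow> real^'n \<Rightarrow> real" where
  "partial_deriv f i x = deriv (\<lambda>t. f (x + t *\<^sub>R axis i 1)) 0"

definition laplacian :: "(real^'n \<Rightarrow> real) \<Rightarrow> real^'n \<Rightarrow> real" where
  "laplacian f x = (\<Sum>i\<in>UNIV. partial_deriv (partial_deriv f i) i x)"

(* C1_on and C2_on are meant for open sets S. *)

definition C1_on :: "(real^'n) set \<Rightarrow> (real^'n \<Rightarrow> real) \<Rightarrow> bool" where
  "C1_on S f \<longleftrightarrow> f differentiable_on S \<and> (\<forall>i. continuous_on S (partial_deriv f i))"

definition C2_on :: "(real^'n) set \<Rightarrow> (real^'n \<Rightarrow> real) \<Rightarrow> bool" where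
  "C2_on S f \<longleftrightarrow> C1_on S f \<and> (\<forall>i. C1_on S (partial_deriv f i))"

definition extends_continuously :: "(real^'n) set \<Rightarrow> (real^'n \<Rightarrow> real) \<Rightarrow> bool" where
  "extends_continuously S f \<longleftrightarrow>
     (\<exists>g. continuous_on (closure S) g \<and> (\<forall>x\<in>S. g x = f x))"

(* The space C^2 of the closure of an open set S: all derivatives of order at most two exist in S
   and extend continuously to the closure. The boundary values of f itself are those of its
   extension; the values of f outside the closure of S play no role. *)

definition C2_closure :: "(real^'n) set \<Rightarrow> (real^'n \<Rightarrow> real) \<Rightarrow> bool" where
  "C2_closure S f \<longleftrightarrow>
     C2_on S f \<and> continuous_on (closure S) f \<and>
     (\<forall>i. extends_continuously S (partial_deriv f i)) \<and>
     (\<forall>i j. extends_continuously S (partial_deriv (partial_deriv f i) j))"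

(* Near each boundary point, after a rotation of the coordinates taking e to the last coordinate
   direction, S is the part of a ball lying strictly above the graph of a C^2 function of the
   remaining coordinates. That function is represented by \<gamma> on the whole space, of which only the
   values on the hyperplane orthogonal to e are used. *)

definition C2_domain :: "(real^'n) set \<Rightarrow> bool" where
  "C2_domain S \<longleftrightarrow>
     (\<forall>p\<in>frontier S. \<exists>r>0. \<exists>e \<gamma>. norm e = 1 \<and> C2_on UNIV \<gamma> \<and>
        S \<inter> ball p r = {x \<in> ball p r. \<gamma> (x - (x \<bullet> e) *\<^sub>R e) < x \<bullet> e})"

(* v is a unit vector, orthogonal to the velocity of every curve in the boundary through p,
   and pointing into S. *)

definition inner_unit_normal :: "(real^'n) set \<Rightarrow> real^'n \<Rightarrow> real^'n \<Rightarrow> bool" where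
  "inner_unit_normal S p v \<longleftrightarrow>
     norm v = 1 \<and>
     (\<forall>c w. (\<forall>t::real. c t \<in> frontier S) \<longrightarrow> c 0 = p \<longrightarrow>
        (c has_vector_derivative w) (at 0) \<longrightarrow> v \<bullet> w = 0) \<and>
     (\<exists>\<epsilon>>0. \<forall>t. 0 < t \<and> t < \<epsilon> \<longrightarrow> p + t *\<^sub>R v \<in> S)"

(* The derivative at a boundary point p in an inward direction v is one-sided, since f is only
   relevant on the closure of the domain. *)

definition inward_deriv :: "(real^'n \<Rightarrow> real) \<Rightarrow> real^'n \<Rightarrow> real^'n \<Rightarrow> real" where
  "inward_deriv f v p = vector_derivative (\<lambda>t. f (p + t *\<^sub>R v)) (at 0 within {0..})"

(* The library notion is for parametrised families; here the family is constant. *)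

definition locally_lipschitz :: "(real \<Rightarrow> real) \<Rightarrow> bool" where
  "locally_lipschitz g \<longleftrightarrow> local_lipschitz (UNIV :: real set) UNIV (\<lambda>_. g)"

end

theory Submission
  imports Defs
begin

text \<open>Moving planes. Extend every \<open>u\<^sub>i\<close> by zero and, for a unit vector \<open>e\<close>, lower \<open>l\<close> to the last value for
  which no \<open>u\<^sub>i\<close> exceeds its reflection in a hyperplane \<open>x \<bullet> e = \<mu>\<close>, \<open>\<mu> \<ge> l\<close>, on the far side of it. If for
  some \<open>i\<close> the difference \<open>w\<close> of the reflection and \<open>u\<^sub>i\<close> vanishes inside the cap cut off by the critical
  hyperplane, the strong maximum principle makes \<open>\<Omega>\<close> symmetric. Otherwise pairs of points violating the
  inequality for smaller \<open>l\<close> accumulate in one of the following ways. At a boundary point whose mirror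
  image lies on the boundary, Hopf's lemma makes all normal derivatives at the image strictly larger,
  against the monotonicity of \<open>F\<close>. At a point of the hyperplane inside \<open>\<Omega>\<close>, or on the boundary where the
  hyperplane is not orthogonal to it, every \<open>u\<^sub>i\<close> decreases strictly in the direction \<open>e\<close>. At a boundary
  point where it is orthogonal, Serrin's corner lemma makes the tangential derivative of every
  normal derivative negative, against the equation obtained by differentiating the condition on \<open>F\<close>.

  All these steps use the differential inequality for \<open>w\<close> only where \<open>w \<ge> 0\<close>, so \<open>h\<^sub>i\<close> need only be monotone.
  Symmetry of \<open>\<Omega>\<close> in the critical hyperplane for one \<open>i\<close> does not give that of the other \<open>u\<^sub>k\<close>; for this the
  planes are also moved from the opposite side, where they stop at the same hyperplane.\<close>

section \<open>Maximum principles\<close>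

text \<open>Difference quotients of \<open>h i\<close> have no upper bound, so subtracting the
  equations gives a linear equation for \<open>w\<close> whose zero order coefficient is controlled
  on one side only. Hence all planes beyond \<open>l\<close> are part of the property
  \<open>mp\<close>: nonnegativity of \<open>w\<close> is then given, the start is trivial once the
  plane has left \<Omega>, and continuation is a compactness argument on failing pairs of points. A
  second obstacle is that normal derivatives may vanish on the frontier, where \<open>F\<close> is
  not assumed differentiable. At transversal points second derivatives then provide the decrease; at
  orthogonal points a nonnegative normal derivative with nonzero tangential derivative must be
  positive, so the chain rule for \<open>F\<close> applies after all. Comparing values of
  \<open>F\<close> needs strict inequality in every component. It is available because a zero of the
  difference inside the cap for any single index already makes \<Omega> symmetric.\<close>

definition second_dir :: "('a::real_normed_vector \<Rightarrow> real) \<Rightarrow> 'a \<Rightarrow> 'a \<Rightarrow> real \<Rightarrow> bool" where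
  "second_dir w x d D \<longleftrightarrow>
     (\<exists>w'. (\<forall>\<^sub>F t in nhds 0. ((\<lambda>t. w (x + t *\<^sub>R d)) has_real_derivative w' t) (at t)) \<and>
           (w' has_real_derivative D) (at 0))"

lemma second_dir_diff:
  assumes "second_dir v x d A" "second_dir w x d B"
  shows "second_dir (\<lambda>y. v y - w y) x d (A - B)"
proof -
  obtain v' where v: "\<forall>\<^sub>F t in nhds 0. ((\<lambda>t. v (x + t *\<^sub>R d)) has_real_derivative v' t) (at t)"
      "(v' has_real_derivative A) (at 0)"
    using assms(1) unfolding second_dir_def by blast
  obtain w' where w: "\<forall>\<^sub>F t in nhds 0. ((\<lambda>t. w (x + t *\<^sub>R d)) has_real_derivative w' t) (at t)"
      "(w' has_real_derivative B) (at 0)"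
    using assms(2) unfolding second_dir_def by blast
  have "\<forall>\<^sub>F t in nhds 0. ((\<lambda>t. v (x + t *\<^sub>R d) - w (x + t *\<^sub>R d)) has_real_derivative v' t - w' t) (at t)"
    using v(1) w(1) by eventually_elim (auto intro!: derivative_intros)
  moreover have "((\<lambda>t. v' t - w' t) has_real_derivative A - B) (at 0)"
    using v(2) w(2) by (auto intro!: derivative_intros)
  ultimately show ?thesis unfolding second_dir_def by (intro exI[of _ "\<lambda>t. v' t - w' t"] conjI)
qed

lemma second_dir_cmult:
  assumes "second_dir v x d A"
  shows "second_dir (\<lambda>y. k * v y) x d (k * A)"
proof -
  obtain v' where v: "\<forall>\<^sub>F t in nhds 0. ((\<lambda>t. v (x + t *\<^sub>R d)) has_real_derivative v' t) (at t)"
      "(v' has_real_derivative A) (at 0)"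
    using assms(1) unfolding second_dir_def by blast
  have "\<forall>\<^sub>F t in nhds 0. ((\<lambda>t. k * v (x + t *\<^sub>R d)) has_real_derivative k * v' t) (at t)"
    using v(1) by eventually_elim (auto intro!: DERIV_cmult)
  moreover have "((\<lambda>t. k * v' t) has_real_derivative k * A) (at 0)"
    using v(2) by (auto intro!: DERIV_cmult)
  ultimately show ?thesis unfolding second_dir_def by (intro exI[of _ "\<lambda>t. k * v' t"] conjI)
qed

text \<open>By minimality \<open>w'\<close> vanishes at 0; if \<open>D < 0\<close> it is negative
  just to the right of 0, and the mean value theorem pushes \<open>w\<close> below its
  minimum.\<close>

lemma second_dir_local_min:
  assumes "second_dir w x d D" and min: "\<forall>\<^sub>F t in nhds 0. w x \<le> w (x + t *\<^sub>R d)"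
  shows "D \<ge> 0"
proof (rule ccontr)
  assume "\<not> D \<ge> 0"
  then have D: "D < 0" by simp
  obtain w' where w: "\<forall>\<^sub>F t in nhds 0. ((\<lambda>t. w (x + t *\<^sub>R d)) has_real_derivative w' t) (at t)"
      "(w' has_real_derivative D) (at 0)"
    using assms(1) unfolding second_dir_def by blast
  have "\<forall>\<^sub>F t in nhds 0. ((\<lambda>t. w (x + t *\<^sub>R d)) has_real_derivative w' t) (at t) \<and> w x \<le> w (x + t *\<^sub>R d)"
    using w(1) min by eventually_elim auto
  then obtain \<epsilon> where \<epsilon>: "\<epsilon> > 0"
      "\<And>t. \<bar>t\<bar> < \<epsilon> \<Longrightarrow> ((\<lambda>t. w (x + t *\<^sub>R d)) has_real_derivative w' t) (at t)"
      "\<And>t. \<bar>t\<bar> < \<epsilon> \<Longrightarrow> w x \<le> w (x + t *\<^sub>R d)"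
    unfolding eventually_nhds_metric by (auto simp: dist_real_def)
  have z: "w' 0 = 0"
    by (rule DERIV_local_min[OF \<epsilon>(2)[of 0] \<epsilon>(1)]) (use \<epsilon> in auto)
  obtain d' where d': "d' > 0" "\<And>h. 0 < h \<Longrightarrow> h < d' \<Longrightarrow> w' (0 + h) < w' 0"
    using DERIV_neg_dec_right[OF w(2) D] by auto
  define h where "h = min \<epsilon> d' / 2"
  have h: "0 < h" "h < \<epsilon>" "h < d'" using \<epsilon>(1) d'(1) by (auto simp: h_def)
  have "\<exists>\<xi>>0. \<xi> < h \<and> w (x + h *\<^sub>R d) - w (x + 0 *\<^sub>R d) = (h - 0) * w' \<xi>"
    by (rule MVT2) (use h \<epsilon>(2) in auto)
  then obtain \<xi> where \<xi>: "0 < \<xi>" "\<xi> < h" "w (x + h *\<^sub>R d) - w x = h * w' \<xi>" by auto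
  have "w' \<xi> < 0" using d'(2)[of \<xi>] \<xi> h z by auto
  then have "w (x + h *\<^sub>R d) < w x" using \<xi> h(1) by (smt (verit) mult_pos_neg)
  with \<epsilon>(3)[of h] h show False by auto
qed

text \<open>Strictness in \<open>sub\<close> lets a plain minimum argument work: at an interior
  point where \<open>w - z\<close> has a negative minimum, L w >= (sum for w) >= (sum for z) > L z
  >= L w.\<close>

lemma comparison:
  fixes w z :: "'a::euclidean_space \<Rightarrow> real"
  assumes A: "open A" "bounded A"
    and cw: "continuous_on (closure A) w" and cz: "continuous_on (closure A) z"
    and L: "L \<ge> 0"
    and sup: "\<And>x. x \<in> A \<Longrightarrow> \<exists>D2. (\<forall>b\<in>Basis. second_dir w x b (D2 b)) \<and> (\<Sum>b\<in>Basis. D2 b) \<le> L * w x"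
    and sub: "\<And>x. x \<in> A \<Longrightarrow> \<exists>D2. (\<forall>b\<in>Basis. second_dir z x b (D2 b)) \<and> (\<Sum>b\<in>Basis. D2 b) > L * z x"
    and bd: "\<And>x. x \<in> closure A \<Longrightarrow> x \<notin> A \<Longrightarrow> z x \<le> w x"
    and x: "x \<in> A"
  shows "z x \<le> w x"
proof (rule ccontr)
  assume neg: "\<not> z x \<le> w x"
  have "compact (closure A)" using A(2) by (simp add: compact_closure)
  moreover have "continuous_on (closure A) (\<lambda>x. w x - z x)" by (intro continuous_on_diff cw cz)
  moreover have "closure A \<noteq> {}" using x by auto
  ultimately have "\<exists>y\<in>closure A. \<forall>v\<in>closure A. w y - z y \<le> w v - z v"
    by (intro continuous_attains_inf)
  then obtain y where y: "y \<in> closure A" "\<And>v. v \<in> closure A \<Longrightarrow> w y - z y \<le> w v - z v"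
    by blast
  have neg': "w y < z y" using y(2)[of x] neg x closure_subset by fastforce
  then have yA: "y \<in> A" using bd[OF y(1)] by auto
  obtain D1 where D1: "\<forall>b\<in>Basis. second_dir w y b (D1 b)" "(\<Sum>b\<in>Basis. D1 b) \<le> L * w y"
    using sup[OF yA] by blast
  obtain D2 where D2: "\<forall>b\<in>Basis. second_dir z y b (D2 b)" "(\<Sum>b\<in>Basis. D2 b) > L * z y"
    using sub[OF yA] by blast
  have "D1 b - D2 b \<ge> 0" if b: "b \<in> Basis" for b
  proof (rule second_dir_local_min)
    show "second_dir (\<lambda>v. w v - z v) y b (D1 b - D2 b)"
      using second_dir_diff D1 D2 b by blast
    have "((\<lambda>t::real. y + t *\<^sub>R b) \<longlongrightarrow> y + 0 *\<^sub>R b) (nhds 0)"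
      by (intro tendsto_intros filterlim_ident)
    then have "\<forall>\<^sub>F t in nhds 0. y + t *\<^sub>R b \<in> A"
      using A(1) yA by (simp add: topological_tendstoD)
    then show "\<forall>\<^sub>F t in nhds 0. w y - z y \<le> w (y + t *\<^sub>R b) - z (y + t *\<^sub>R b)"
      by eventually_elim (use y(2) closure_subset in blast)
  qed
  then have "(\<Sum>b\<in>Basis. D1 b - D2 b) \<ge> 0" by (intro sum_nonneg) auto
  then have "L * z y < L * w y" using D1(2) D2(2) by (simp add: sum_subtractf)
  moreover have "L * w y \<le> L * z y" using neg' L by (intro mult_left_mono) auto
  ultimately show False by simp
qed

section \<open>Exponential barriers\<close>

lemma barrier_second_dir:
  fixes c b0 d x :: "'a::euclidean_space" and \<alpha> :: real
  defines "E \<equiv> exp (- \<alpha> * ((x - c) \<bullet> (x - c)))"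
  shows "second_dir (\<lambda>x. (a + (x - c) \<bullet> b0) * (exp (- \<alpha> * ((x - c) \<bullet> (x - c))) - K)) x d
    (- 4 * \<alpha> * E * ((b0 \<bullet> d) * ((x - c) \<bullet> d)) + (a + (x - c) \<bullet> b0) * E * (4 * \<alpha>\<^sup>2 * ((x - c) \<bullet> d)\<^sup>2 - 2 * \<alpha> * (d \<bullet> d)))"
proof -
  define p where "p = (x - c) \<bullet> d"
  define Q where "Q = (x - c) \<bullet> (x - c)"
  define l where "l = a + (x - c) \<bullet> b0"
  define s where "s = b0 \<bullet> d"
  define n where "n = d \<bullet> d"
  \<comment> \<open>On a line the barrier is an affine function times the exponential of a quadratic
    polynomial shifted by \<open>K\<close>, so one variable calculus suffices.\<close>
  have e1: "(a + (x + t *\<^sub>R d - c) \<bullet> b0) * (exp (- \<alpha> * ((x + t *\<^sub>R d - c) \<bullet> (x + t *\<^sub>R d - c))) - K)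
      = (l + t * s) * (exp (- \<alpha> * (Q + 2 * t * p + t\<^sup>2 * n)) - K)" for t
  proof -
    have "x + t *\<^sub>R d - c = (x - c) + t *\<^sub>R d" by simp
    then have "(x + t *\<^sub>R d - c) \<bullet> (x + t *\<^sub>R d - c) = Q + 2 * t * p + t\<^sup>2 * n"
      unfolding Q_def p_def n_def
      by (simp only: inner_add_left inner_add_right inner_scaleR_left inner_scaleR_right)
         (simp add: inner_commute power2_eq_square algebra_simps)
    moreover have "a + (x + t *\<^sub>R d - c) \<bullet> b0 = l + t * s"
      unfolding l_def s_def by (simp add: inner_commute[of _ b0] inner_add_right inner_diff_right)
    ultimately show ?thesis by simp
  qed
  define w' where "w' t = s * (exp (- \<alpha> * (Q + 2 * t * p + t\<^sup>2 * n)) - K)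
      + (l + t * s) * (exp (- \<alpha> * (Q + 2 * t * p + t\<^sup>2 * n)) * (- \<alpha> * (2 * p + 2 * t * n)))" for t
  have "((\<lambda>t. (l + t * s) * (exp (- \<alpha> * (Q + 2 * t * p + t\<^sup>2 * n)) - K)) has_real_derivative w' t) (at t)" for t
    unfolding w'_def by (auto intro!: derivative_eq_intros simp: algebra_simps)
  moreover have "(w' has_real_derivative
      (- 4 * \<alpha> * E * (s * p) + l * E * (4 * \<alpha>\<^sup>2 * p\<^sup>2 - 2 * \<alpha> * n))) (at 0)"
    unfolding w'_def E_def Q_def[symmetric]
    by (auto intro!: derivative_eq_intros simp: algebra_simps power2_eq_square)
  ultimately show ?thesis
    unfolding second_dir_def e1 p_def[symmetric] s_def[symmetric] l_def[symmetric] n_def[symmetric]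
    by (intro exI[of _ w']) auto
qed

text \<open>The choice \<open>a = 1\<close>, \<open>b0 = 0\<close> gives the barrier of Hopf's lemma. With \<open>a = 0\<close> and \<open>b0\<close> normal to a
  hyperplane through the centre \<open>c\<close> it is the barrier of Serrin's corner lemma.\<close>

lemma barrier:
  fixes c :: "'a::euclidean_space"
  assumes \<rho>: "0 < \<rho>" and L: "0 \<le> L"
  obtains \<alpha> :: real where "\<alpha> > 0"
    "\<And>x a b0 K. 0 \<le> a \<Longrightarrow> 0 < a + (x - c) \<bullet> b0 \<Longrightarrow> \<rho> \<le> norm (x - c) \<Longrightarrow> 0 \<le> K \<Longrightarrow>
      \<exists>D2. (\<forall>b\<in>Basis. second_dir (\<lambda>x. (a + (x - c) \<bullet> b0) * (exp (- \<alpha> * ((x - c) \<bullet> (x - c))) - K)) x b (D2 b)) \<and>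
        (\<Sum>b\<in>Basis. D2 b) > L * ((a + (x - c) \<bullet> b0) * (exp (- \<alpha> * ((x - c) \<bullet> (x - c))) - K))"
proof
  define N where "N = real DIM('a)"
  \<comment> \<open>The sum of second derivatives is at least E l \<alpha> (4 \<alpha> \<rho>^2 - 2
    N - 4); the 4 comes from the affine factor. This \<alpha> makes the bracket equal to L + 4
    \<rho>^2, and \<alpha> >= 1 takes care of the factor in front.\<close>
  define \<alpha> where "\<alpha> = 1 + (2 * N + 4 + L) / (4 * \<rho>\<^sup>2)"
  have N: "N \<ge> 0" by (simp add: N_def)
  have \<alpha>1: "\<alpha> \<ge> 1" using N L by (simp add: \<alpha>_def)
  then show "\<alpha> > 0" by simp
  have "4 * \<alpha> * \<rho>\<^sup>2 = 4 * \<rho>\<^sup>2 + (2 * N + 4 + L)"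
    using \<rho> by (simp add: \<alpha>_def field_simps)
  then have \<alpha>2: "4 * \<alpha> * \<rho>\<^sup>2 - 2 * N - 4 - L > 0" using \<rho> by simp
  fix x a b0 K
  assume a: "0 \<le> (a::real)" and l0: "0 < a + (x - c) \<bullet> b0" and xr: "\<rho> \<le> norm (x - c)" and K: "0 \<le> (K::real)"
  define E where "E = exp (- \<alpha> * ((x - c) \<bullet> (x - c)))"
  define l where "l = a + (x - c) \<bullet> b0"
  define Q where "Q = (x - c) \<bullet> (x - c)"
  define D2 where "D2 d = - 4 * \<alpha> * E * ((b0 \<bullet> d) * ((x - c) \<bullet> d)) + l * E * (4 * \<alpha>\<^sup>2 * ((x - c) \<bullet> d)\<^sup>2 - 2 * \<alpha> * (d \<bullet> d))" for d
  have s1: "(\<Sum>b\<in>Basis. (b0 \<bullet> b) * ((x - c) \<bullet> b)) = l - a"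
    unfolding l_def using euclidean_inner[of b0 "x - c"] inner_commute[of b0 "x - c"] by linarith
  have s2: "(\<Sum>b\<in>Basis. ((x - c) \<bullet> b)\<^sup>2) = Q"
    unfolding Q_def power2_eq_square by (rule euclidean_inner[symmetric])
  have s3: "(\<Sum>b\<in>(Basis::'a set). b \<bullet> b) = N"
    unfolding N_def by (simp add: inner_Basis)
  have sum: "(\<Sum>b\<in>Basis. D2 b) = - 4 * \<alpha> * E * (l - a) + l * E * (4 * \<alpha>\<^sup>2 * Q - 2 * \<alpha> * N)"
    unfolding D2_def sum.distrib sum_subtractf sum_distrib_left[symmetric] s1 s2 s3 by simp
  have E: "E > 0" by (simp add: E_def)
  have l: "l > 0" using l0 by (simp add: l_def)
  have Q: "Q \<ge> \<rho>\<^sup>2" unfolding Q_def using xr \<rho> by (simp add: power2_norm_eq_inner[symmetric])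
  have "E * l * L < E * l * (\<alpha> * (4 * \<alpha> * \<rho>\<^sup>2 - 2 * N - 4))"
  proof (rule mult_strict_left_mono)
    have "L < 4 * \<alpha> * \<rho>\<^sup>2 - 2 * N - 4" using \<alpha>2 by simp
    also have "\<dots> \<le> \<alpha> * (4 * \<alpha> * \<rho>\<^sup>2 - 2 * N - 4)"
      using \<alpha>1 \<alpha>2 L mult_right_mono[of 1 \<alpha> "4 * \<alpha> * \<rho>\<^sup>2 - 2 * N - 4"] by auto
    finally show "L < \<alpha> * (4 * \<alpha> * \<rho>\<^sup>2 - 2 * N - 4)" .
  qed (use E l in simp)
  also have "\<dots> \<le> (\<Sum>b\<in>Basis. D2 b)"
  proof -
    have "E * l * (4 * \<alpha>\<^sup>2 * \<rho>\<^sup>2) \<le> E * l * (4 * \<alpha>\<^sup>2 * Q)"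
      using Q E l by (intro mult_left_mono) auto
    moreover have "4 * \<alpha> * E * a \<ge> 0" using a E \<alpha>1 by simp
    ultimately show ?thesis unfolding sum by (simp add: algebra_simps power2_eq_square)
  qed
  finally have "(\<Sum>b\<in>Basis. D2 b) > E * l * L" .
  moreover have "E * l * L \<ge> L * (l * (E - K))"
  proof -
    have "L * (l * K) \<ge> 0" using L l K by simp
    then show ?thesis by (simp add: algebra_simps)
  qed
  ultimately have 2: "(\<Sum>b\<in>Basis. D2 b) > L * (l * (E - K))" by simp
  show "\<exists>D2. (\<forall>b\<in>Basis. second_dir (\<lambda>x. (a + (x - c) \<bullet> b0) * (exp (- \<alpha> * ((x - c) \<bullet> (x - c))) - K)) x b (D2 b)) \<and>
        (\<Sum>b\<in>Basis. D2 b) > L * ((a + (x - c) \<bullet> b0) * (exp (- \<alpha> * ((x - c) \<bullet> (x - c))) - K))"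
  proof (intro exI[of _ D2] conjI ballI)
    fix b :: 'a
    show "second_dir (\<lambda>x. (a + (x - c) \<bullet> b0) * (exp (- \<alpha> * ((x - c) \<bullet> (x - c))) - K)) x b (D2 b)"
      unfolding D2_def l_def E_def by (rule barrier_second_dir)
  qed (use 2 in \<open>simp add: l_def E_def\<close>)
qed

text \<open>The tangent inequality for exp. It turns the vanishing of a barrier on the sphere into a
  linear lower bound inside.\<close>

lemma exp_diff_lower:
  fixes \<alpha> s S :: real
  shows "exp (- \<alpha> * S) * (\<alpha> * (S - s)) \<le> exp (- \<alpha> * s) - exp (- \<alpha> * S)"
proof -
  have "exp (- \<alpha> * s) = exp (- \<alpha> * S) * exp (\<alpha> * (S - s))"
    by (simp add: exp_add[symmetric] algebra_simps)
  moreover have "1 + \<alpha> * (S - s) \<le> exp (\<alpha> * (S - s))" by (rule exp_ge_add_one_self)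
  then have "exp (- \<alpha> * S) * (1 + \<alpha> * (S - s)) \<le> exp (- \<alpha> * S) * exp (\<alpha> * (S - s))"
    by (intro mult_left_mono) auto
  ultimately show ?thesis by (simp add: algebra_simps)
qed

section \<open>Nonnegative supersolutions: Hopf's lemma, the corner lemma, the strong maximum
  principle\<close>

definition supersol :: "'a::euclidean_space set \<Rightarrow> real \<Rightarrow> ('a \<Rightarrow> real) \<Rightarrow> bool" where
  "supersol D L w \<longleftrightarrow> (\<forall>x\<in>D. w differentiable (at x) \<and> 0 \<le> w x \<and>
     (\<exists>D2. (\<forall>b\<in>Basis. second_dir w x b (D2 b)) \<and> (\<Sum>b\<in>Basis. D2 b) \<le> L * w x))"

lemma supersol_subset: "supersol D L w \<Longrightarrow> D' \<subseteq> D \<Longrightarrow> supersol D' L w"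
  unfolding supersol_def by blast

lemma supersol_continuous: "supersol D L w \<Longrightarrow> open D \<Longrightarrow> continuous_on D w"
  unfolding supersol_def
  by (meson continuous_at_imp_continuous_on differentiable_imp_continuous_within)

text \<open>On the annulus between the radii R/2 and R, \<open>w\<close> lies above the barrier that
  vanishes on the outer sphere, scaled by the minimum of \<open>w\<close> on the inner ball. The
  conclusion is a linear bound rather than a derivative because \<open>w\<close> will be built from
  functions extended by zero, which need not be differentiable at \<open>p\<close>.\<close>

lemma hopf_ball:
  fixes p n :: "'a::euclidean_space"
  assumes n: "norm n = 1" and R: "0 < R" and L: "0 \<le> L"
    and sup: "supersol (ball (p + R *\<^sub>R n) R) L w"
    and pos: "\<And>x. x \<in> ball (p + R *\<^sub>R n) R \<Longrightarrow> 0 < w x"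
    and nn: "\<And>x. x \<in> cball (p + R *\<^sub>R n) R \<Longrightarrow> 0 \<le> w x"
    and cont: "continuous_on (cball (p + R *\<^sub>R n) R) w"
  shows "\<exists>k>0. \<forall>t. 0 < t \<and> t < R / 2 \<longrightarrow> k * t \<le> w (p + t *\<^sub>R n)"
proof -
  define c where "c = p + R *\<^sub>R n"
  obtain \<alpha> :: real where \<alpha>: "\<alpha> > 0" and bar:
    "\<And>x a b0 K. 0 \<le> a \<Longrightarrow> 0 < a + (x - c) \<bullet> b0 \<Longrightarrow> R/2 \<le> norm (x - c) \<Longrightarrow> 0 \<le> K \<Longrightarrow>
      \<exists>D2. (\<forall>b\<in>Basis. second_dir (\<lambda>x. (a + (x - c) \<bullet> b0) * (exp (- \<alpha> * ((x - c) \<bullet> (x - c))) - K)) x b (D2 b)) \<and>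
        (\<Sum>b\<in>Basis. D2 b) > L * ((a + (x - c) \<bullet> b0) * (exp (- \<alpha> * ((x - c) \<bullet> (x - c))) - K))"
    using barrier[of "R/2" L c] R L by auto
  define K where "K = exp (- \<alpha> * R\<^sup>2)"
  define z0 where "z0 x = (1 + (x - c) \<bullet> 0) * (exp (- \<alpha> * ((x - c) \<bullet> (x - c))) - K)" for x
  have K: "K > 0" by (simp add: K_def)
  have sub: "cball c (R/2) \<subseteq> ball c R" using R by auto
  have "\<exists>y\<in>cball c (R/2). \<forall>x\<in>cball c (R/2). w y \<le> w x"
  proof (rule continuous_attains_inf)
    show "cball c (R/2) \<noteq> {}" using R by simp
    show "continuous_on (cball c (R/2)) w"
      by (rule continuous_on_subset[OF cont]) (use sub in \<open>auto simp: c_def\<close>)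
  qed simp
  then obtain y where y: "y \<in> cball c (R/2)" "\<And>x. x \<in> cball c (R/2) \<Longrightarrow> w y \<le> w x"
    by blast
  define m where "m = w y"
  have m: "m > 0" unfolding m_def using pos y(1) sub by (auto simp: c_def)
  define A where "A = ball c R - cball c (R/2)"
  have clA: "closure A \<subseteq> {x. R/2 \<le> dist c x \<and> dist c x \<le> R}"
  proof (rule closure_minimal)
    show "A \<subseteq> {x. R/2 \<le> dist c x \<and> dist c x \<le> R}" by (auto simp: A_def)
    show "closed {x. R/2 \<le> dist c x \<and> dist c x \<le> R}"
      by (intro closed_Collect_conj closed_Collect_le continuous_intros)
  qed
  have comp: "m * z0 x \<le> w x" if "x \<in> A" for x
  proof (rule comparison[where L = L and A = A and z = "\<lambda>x. m * z0 x" and w = w])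
    show "open A" unfolding A_def by auto
    show "bounded A" unfolding A_def by (meson bounded_ball bounded_diff)
    show "continuous_on (closure A) w"
      by (rule continuous_on_subset[OF cont]) (use clA in \<open>auto simp: c_def\<close>)
    show "continuous_on (closure A) (\<lambda>x. m * z0 x)"
      unfolding z0_def by (intro continuous_intros)
    fix x assume x: "x \<in> A"
    then show "\<exists>D2. (\<forall>b\<in>Basis. second_dir w x b (D2 b)) \<and> (\<Sum>b\<in>Basis. D2 b) \<le> L * w x"
      using sup unfolding supersol_def A_def c_def by blast
    have "R/2 \<le> norm (x - c)" using x by (auto simp: A_def dist_norm norm_minus_commute)
    then obtain D2 where D2: "\<forall>b\<in>Basis. second_dir z0 x b (D2 b)" "(\<Sum>b\<in>Basis. D2 b) > L * z0 x"
      using bar[of 1 x 0 K] K unfolding z0_def by auto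
    show "\<exists>D2. (\<forall>b\<in>Basis. second_dir (\<lambda>x. m * z0 x) x b (D2 b)) \<and> (\<Sum>b\<in>Basis. D2 b) > L * (m * z0 x)"
    proof (intro exI[of _ "\<lambda>b. m * D2 b"] conjI ballI)
      show "L * (m * z0 x) < (\<Sum>b\<in>Basis. m * D2 b)"
        using mult_strict_left_mono[OF D2(2) m] by (simp add: sum_distrib_left algebra_simps)
    qed (use D2 in \<open>auto intro: second_dir_cmult\<close>)
  next
    fix x assume x: "x \<in> closure A" "x \<notin> A"
    then consider "dist c x = R" | "dist c x = R/2" using clA by (force simp: A_def)
    then show "m * z0 x \<le> w x"
    proof cases
      case 1
      then have "(x - c) \<bullet> (x - c) = R\<^sup>2"
        by (metis dist_norm norm_minus_commute power2_norm_eq_inner)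
      then have "z0 x = 0" by (simp add: z0_def K_def)
      then show ?thesis using nn[of x] 1 by (simp add: c_def)
    next
      case 2
      have "exp (- \<alpha> * ((x - c) \<bullet> (x - c))) \<le> 1" using \<alpha> by simp
      then have "exp (- \<alpha> * ((x - c) \<bullet> (x - c))) - K \<le> 1" using K by linarith
      then have "z0 x \<le> 1" by (simp add: z0_def)
      then have "m * z0 x \<le> m" using m by simp
      also have "m \<le> w x" using y(2)[of x] 2 by (simp add: m_def)
      finally show ?thesis .
    qed
  qed (use L that in auto)
  show ?thesis
  proof (intro exI[of _ "m * K * \<alpha> * R"] conjI allI impI)
    show "m * K * \<alpha> * R > 0" using m K \<alpha> R by simp
    fix t assume t: "0 < t \<and> t < R / 2"
    have e: "p + t *\<^sub>R n - c = (t - R) *\<^sub>R n" by (simp add: c_def algebra_simps)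
    have nrm: "norm (p + t *\<^sub>R n - c) = R - t" unfolding e using n t by simp
    then have "p + t *\<^sub>R n \<in> A" using t by (auto simp: A_def dist_norm norm_minus_commute)
    from comp[OF this] have 1: "m * z0 (p + t *\<^sub>R n) \<le> w (p + t *\<^sub>R n)" .
    have "(p + t *\<^sub>R n - c) \<bullet> (p + t *\<^sub>R n - c) = (R - t)\<^sup>2"
      using nrm by (metis power2_norm_eq_inner)
    then have z: "z0 (p + t *\<^sub>R n) = exp (- \<alpha> * (R - t)\<^sup>2) - exp (- \<alpha> * R\<^sup>2)" by (simp add: z0_def K_def)
    have "R * t \<le> R\<^sup>2 - (R - t)\<^sup>2" using t mult_mono[of t R t t] by (simp add: power2_eq_square algebra_simps)
    then have "K * (\<alpha> * (R * t)) \<le> K * (\<alpha> * (R\<^sup>2 - (R - t)\<^sup>2))"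
      using K \<alpha> by (intro mult_left_mono) auto
    also have "\<dots> \<le> z0 (p + t *\<^sub>R n)" unfolding z K_def by (rule exp_diff_lower)
    finally have "m * (K * (\<alpha> * (R * t))) \<le> m * z0 (p + t *\<^sub>R n)" using m by (intro mult_left_mono) auto
    with 1 show "m * K * \<alpha> * R * t \<le> w (p + t *\<^sub>R n)" by (simp add: algebra_simps)
  qed
qed

text \<open>The barrier carries the factor (x - c) \<bullet> e and thus vanishes both on the sphere
  and on the hyperplane. On the remaining piece of the boundary, at distance \<open>r1\<close> from
  \<open>q\<close>, it is dominated through \<open>low\<close>, which must be linear in the distance
  to the hyperplane because that piece reaches it. Since \<open>r1\<close> is at most R/2, the
  region avoids the ball about \<open>c\<close> where the barrier fails. Along \<open>n + e\<close>
  both factors vanish to first order at \<open>q\<close>, hence the quadratic bound.\<close>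

lemma corner:
  fixes q n e :: "'a::euclidean_space"
  assumes n: "norm n = 1" and e: "norm e = 1" and ne: "n \<bullet> e = 0" and R: "0 < R" and L: "0 \<le> L"
    and r1: "0 < r1" "r1 \<le> R / 2"
    and sup: "supersol {x \<in> ball (q + R *\<^sub>R n) R. 0 < (x - q) \<bullet> e} L w"
    and nn: "\<And>x. x \<in> cball (q + R *\<^sub>R n) R \<Longrightarrow> 0 \<le> (x - q) \<bullet> e \<Longrightarrow> 0 \<le> w x"
    and cont: "continuous_on {x \<in> cball (q + R *\<^sub>R n) R. 0 \<le> (x - q) \<bullet> e} w"
    and m: "0 < m" and low: "\<And>x. x \<in> cball (q + R *\<^sub>R n) R \<Longrightarrow> 0 \<le> (x - q) \<bullet> e \<Longrightarrow> dist q x = r1 \<Longrightarrow>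
          m * ((x - q) \<bullet> e) \<le> w x"
  shows "\<exists>k>0. \<exists>\<delta>>0. \<forall>t. 0 < t \<and> t < \<delta> \<longrightarrow> k * t\<^sup>2 \<le> w (q + t *\<^sub>R (n + e))"
proof -
  define c where "c = q + R *\<^sub>R n"
  have xce: "(x - c) \<bullet> e = (x - q) \<bullet> e" for x
    using ne by (simp add: c_def algebra_simps)
  obtain \<alpha> :: real where \<alpha>: "\<alpha> > 0" and bar:
    "\<And>x a b0 K. 0 \<le> a \<Longrightarrow> 0 < a + (x - c) \<bullet> b0 \<Longrightarrow> R/2 \<le> norm (x - c) \<Longrightarrow> 0 \<le> K \<Longrightarrow>
      \<exists>D2. (\<forall>b\<in>Basis. second_dir (\<lambda>x. (a + (x - c) \<bullet> b0) * (exp (- \<alpha> * ((x - c) \<bullet> (x - c))) - K)) x b (D2 b)) \<and>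
        (\<Sum>b\<in>Basis. D2 b) > L * ((a + (x - c) \<bullet> b0) * (exp (- \<alpha> * ((x - c) \<bullet> (x - c))) - K))"
    using barrier[of "R/2" L c] R L by auto
  define K where "K = exp (- \<alpha> * R\<^sup>2)"
  define z0 where "z0 x = (0 + (x - c) \<bullet> e) * (exp (- \<alpha> * ((x - c) \<bullet> (x - c))) - K)" for x
  have K: "K > 0" by (simp add: K_def)
  define A where "A = ball c R \<inter> {x. 0 < (x - c) \<bullet> e} \<inter> ball q r1"
  have clA: "closure A \<subseteq> cball c R \<inter> {x. 0 \<le> (x - c) \<bullet> e} \<inter> cball q r1"
  proof (rule closure_minimal)
    show "A \<subseteq> cball c R \<inter> {x. 0 \<le> (x - c) \<bullet> e} \<inter> cball q r1" by (auto simp: A_def)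
    show "closed (cball c R \<inter> {x. 0 \<le> (x - c) \<bullet> e} \<inter> cball q r1)"
      by (intro closed_Int closed_cball closed_Collect_le continuous_intros)
  qed
  have comp: "m * z0 x \<le> w x" if "x \<in> A" for x
  proof (rule comparison[where L = L and A = A and z = "\<lambda>x. m * z0 x" and w = w])
    show "open A" unfolding A_def
      by (intro open_Int open_ball open_Collect_less continuous_intros)
    show "bounded A" unfolding A_def by (meson bounded_ball bounded_Int)
    show "continuous_on (closure A) w"
      by (rule continuous_on_subset[OF cont]) (use clA in \<open>auto simp: c_def[symmetric] xce\<close>)
    show "continuous_on (closure A) (\<lambda>x. m * z0 x)"
      unfolding z0_def by (intro continuous_intros)
    fix x assume x: "x \<in> A"
    then show "\<exists>D2. (\<forall>b\<in>Basis. second_dir w x b (D2 b)) \<and> (\<Sum>b\<in>Basis. D2 b) \<le> L * w x"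
      using sup unfolding supersol_def A_def c_def[symmetric] xce by blast
    have "R \<le> norm (x - c) + dist q x"
    proof -
      have "R = norm (c - q)" using n R by (simp add: c_def)
      also have "\<dots> \<le> norm (x - c) + dist q x"
        by (metis add.commute dist_commute dist_norm dist_triangle2)
      finally show ?thesis .
    qed
    then have "R/2 \<le> norm (x - c)" using x r1 by (auto simp: A_def)
    then obtain D2 where D2: "\<forall>b\<in>Basis. second_dir z0 x b (D2 b)" "(\<Sum>b\<in>Basis. D2 b) > L * z0 x"
      using bar[of 0 x e K] K x unfolding z0_def A_def by auto
    show "\<exists>D2. (\<forall>b\<in>Basis. second_dir (\<lambda>x. m * z0 x) x b (D2 b)) \<and> (\<Sum>b\<in>Basis. D2 b) > L * (m * z0 x)"
    proof (intro exI[of _ "\<lambda>b. m * D2 b"] conjI ballI)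
      show "L * (m * z0 x) < (\<Sum>b\<in>Basis. m * D2 b)"
        using mult_strict_left_mono[OF D2(2) m] by (simp add: sum_distrib_left algebra_simps)
    qed (use D2 in \<open>auto intro: second_dir_cmult\<close>)
  next
    fix x assume x: "x \<in> closure A" "x \<notin> A"
    have xin: "x \<in> cball c R" "0 \<le> (x - c) \<bullet> e" "dist q x \<le> r1" using x clA by auto
    have w0: "0 \<le> w x" using nn[of x] xin by (simp add: c_def[symmetric] xce)
    consider "dist c x = R" | "(x - c) \<bullet> e = 0" | "dist q x = r1"
      using x(2) xin by (force simp: A_def)
    then show "m * z0 x \<le> w x"
    proof cases
      case 1
      then have "(x - c) \<bullet> (x - c) = R\<^sup>2"
        by (metis dist_norm norm_minus_commute power2_norm_eq_inner)
      then have "z0 x = 0" by (simp add: z0_def K_def)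
      then show ?thesis using w0 by simp
    next
      case 2
      then show ?thesis using w0 by (simp add: z0_def)
    next
      case 3
      have "exp (- \<alpha> * ((x - c) \<bullet> (x - c))) \<le> 1" using \<alpha> by simp
      then have "exp (- \<alpha> * ((x - c) \<bullet> (x - c))) - K \<le> 1" using K by linarith
      then have "z0 x \<le> ((x - c) \<bullet> e) * 1"
        unfolding z0_def add_0_left using xin(2) by (rule mult_left_mono)
      then have "m * z0 x \<le> m * ((x - c) \<bullet> e)" using m by simp
      also have "\<dots> \<le> w x" using low[of x] 3 xin by (simp add: xce c_def[symmetric])
      finally show ?thesis .
    qed
  qed (use L that in auto)
  show ?thesis
  proof (rule exI[of _ "m * K * \<alpha> * R"], rule conjI[OF _ exI[of _ "min (R/2) (r1/2)"]], goal_cases)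
    case 1
    show "m * K * \<alpha> * R > 0" using m K \<alpha> R by simp
  next
    case 2
    show ?case
    proof (intro conjI allI impI)
    show "min (R/2) (r1/2) > 0" using R r1 by simp
    fix t assume t: "0 < t \<and> t < min (R/2) (r1/2)"
    define x where "x = q + t *\<^sub>R (n + e)"
    have e0: "x - c = (t - R) *\<^sub>R n + t *\<^sub>R e" by (simp add: c_def x_def algebra_simps)
    have nn1: "n \<bullet> n = 1" "e \<bullet> e = 1" using n e by (simp_all add: norm_eq_1)
    have q1: "(x - c) \<bullet> (x - c) = R\<^sup>2 - 2 * R * t + 2 * t\<^sup>2"
      unfolding e0 using ne nn1 by (simp add: inner_add_left inner_add_right inner_commute power2_eq_square algebra_simps)
    have q2: "(x - c) \<bullet> e = t" unfolding e0 using ne nn1 by (simp add: inner_add_left)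
    have q3: "2 * t\<^sup>2 \<le> R * t" using t by (simp add: power2_eq_square)
    have "R * t > 0" using t R by simp
    then have "(norm (x - c))\<^sup>2 < R\<^sup>2" unfolding power2_norm_eq_inner q1 using q3 by linarith
    then have d1: "norm (x - c) < R" using R by (simp add: power2_less_imp_less)
    have "norm (x - q) \<le> t * (norm n + norm e)" unfolding x_def using t norm_triangle_ineq[of n e] by simp
    then have d2: "norm (x - q) < r1" using t n e by simp
    have "x \<in> A" unfolding A_def using d1 d2 q2 t by (auto simp: dist_norm norm_minus_commute)
    from comp[OF this] have 1: "m * z0 x \<le> w x" .
    have z: "z0 x = t * (exp (- \<alpha> * (R\<^sup>2 - 2 * R * t + 2 * t\<^sup>2)) - exp (- \<alpha> * R\<^sup>2))"
      by (simp add: z0_def K_def q1 q2)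
    have "K * (\<alpha> * (R * t)) \<le> K * (\<alpha> * (R\<^sup>2 - (R\<^sup>2 - 2 * R * t + 2 * t\<^sup>2)))"
      using K \<alpha> q3 by (intro mult_left_mono) auto
    also have "\<dots> \<le> exp (- \<alpha> * (R\<^sup>2 - 2 * R * t + 2 * t\<^sup>2)) - exp (- \<alpha> * R\<^sup>2)"
      unfolding K_def by (rule exp_diff_lower)
    finally have "t * (K * (\<alpha> * (R * t))) \<le> z0 x" unfolding z using t by (intro mult_left_mono) auto
    then have "m * (t * (K * (\<alpha> * (R * t)))) \<le> m * z0 x" using m by (intro mult_left_mono) auto
    with 1 show "m * K * \<alpha> * R * t\<^sup>2 \<le> w (q + t *\<^sub>R (n + e))"
      by (simp add: algebra_simps power2_eq_square x_def)
    qed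
  qed
qed

text \<open>If \<open>w\<close> is nonzero at \<open>y\<close>, the largest ball about
  \<open>y\<close> free of zeros touches a zero \<open>p\<close>. Hopf's lemma gives
  \<open>w\<close> a positive slope at \<open>p\<close>, an interior minimum. The half radius keeps
  this ball inside the domain.\<close>

lemma strong_max_local:
  fixes w :: "'a::euclidean_space \<Rightarrow> real"
  assumes D: "open D" and L: "0 \<le> L" and sup: "supersol D L w" and x1: "x1 \<in> D" "w x1 = 0"
  shows "\<exists>r>0. \<forall>x\<in>ball x1 r. w x = 0"
proof -
  obtain r where r: "r > 0" "cball x1 r \<subseteq> D" using D x1 open_contains_cball by blast
  have cont: "continuous_on D w" using supersol_continuous[OF sup D] .
  show ?thesis
  proof (intro exI[of _ "r/2"] conjI ballI)
    show "r/2 > 0" using r by simp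
    fix y assume y: "y \<in> ball x1 (r/2)"
    show "w y = 0"
    proof (rule ccontr)
      assume ny: "w y \<noteq> 0"
      define Z where "Z = {z \<in> cball x1 r. w z = 0}"
      have cr: "continuous_on (cball x1 r) w" using cont r continuous_on_subset by blast
      have "closed Z" unfolding Z_def
        using continuous_closed_preimage_constant[OF cr closed_cball] by simp
      moreover have x1Z: "x1 \<in> Z" using x1 r by (simp add: Z_def)
      ultimately obtain p where p: "p \<in> Z" "\<And>z. z \<in> Z \<Longrightarrow> dist y p \<le> dist y z"
        using distance_attains_inf[of Z y] by blast
      define R where "R = dist y p"
      have R: "R > 0" using ny p(1) by (auto simp: R_def Z_def)
      have Rr: "R < r/2" using p(2)[OF x1Z] y by (simp add: R_def dist_commute)
      define n where "n = (1/R) *\<^sub>R (y - p)"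
      have n: "norm n = 1" using R by (simp add: n_def R_def dist_norm)
      have yc: "p + R *\<^sub>R n = y" using R by (simp add: n_def)
      have sub: "cball y R \<subseteq> cball x1 r"
      proof
        fix v assume "v \<in> cball y R"
        then have "dist x1 v \<le> dist x1 y + R"
          by (smt (verit) dist_triangle mem_cball)
        then show "v \<in> cball x1 r" using Rr y by simp
      qed
      have pos: "w x > 0" if "x \<in> ball y R" for x
      proof -
        have xin: "x \<in> cball x1 r" using that sub ball_subset_cball by blast
        then have "x \<notin> Z" using p(2)[of x] that by (auto simp: R_def)
        then have "w x \<noteq> 0" using xin by (simp add: Z_def)
        moreover have "w x \<ge> 0" using sup xin r unfolding supersol_def by blast
        ultimately show ?thesis by simp
      qed
      have "\<exists>k>0. \<forall>t. 0 < t \<and> t < R / 2 \<longrightarrow> k * t \<le> w (p + t *\<^sub>R n)"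
      proof (rule hopf_ball[OF n R L])
        show "supersol (ball (p + R *\<^sub>R n) R) L w"
          unfolding yc by (rule supersol_subset[OF sup]) (use sub r ball_subset_cball in blast)
        show "continuous_on (cball (p + R *\<^sub>R n) R) w"
          unfolding yc by (rule continuous_on_subset[OF cr sub])
        show "0 < w x" if "x \<in> ball (p + R *\<^sub>R n) R" for x using that pos unfolding yc by blast
        show "0 \<le> w x" if "x \<in> cball (p + R *\<^sub>R n) R" for x
          using that sub r sup unfolding supersol_def yc by blast
      qed
      then obtain k where k: "k > 0" "\<And>t. 0 < t \<Longrightarrow> t < R / 2 \<Longrightarrow> k * t \<le> w (p + t *\<^sub>R n)" by auto
      have pD: "p \<in> D" "w p = 0" using p(1) r by (auto simp: Z_def)
      then obtain w' where w': "(w has_derivative w') (at p)"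
        using sup unfolding supersol_def differentiable_def by blast
      \<comment> \<open>The differentiability built into \<open>supersol\<close> enters here: a zero
        gradient contradicts the slope \<open>k\<close>.\<close>
      have w0: "w' = (\<lambda>v. 0)"
        by (rule differential_zero_maxmin[OF pD(1) D w']) (use pD sup in \<open>auto simp: supersol_def\<close>)
      obtain \<delta> where \<delta>: "\<delta> > 0" "\<And>x. norm (x - p) < \<delta> \<Longrightarrow> norm (w x - w p - w' (x - p)) \<le> k/2 * norm (x - p)"
        using conjunct2[OF w'[unfolded has_derivative_at_alt], rule_format, of "k/2"] k(1) by auto
      define t where "t = min (R/2) \<delta> / 2"
      have t: "0 < t" "t < R/2" "t < \<delta>" using R \<delta>(1) by (auto simp: t_def)
      have "norm (w (p + t *\<^sub>R n)) \<le> k/2 * t" using \<delta>(2)[of "p + t *\<^sub>R n"] t n w0 pD by simp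
      moreover have "k * t > 0" using k t by simp
      ultimately show False using k(2)[of t] t by simp
    qed
  qed
qed

lemma strong_max:
  fixes w :: "'a::euclidean_space \<Rightarrow> real"
  assumes D: "open D" "connected D" and L: "0 \<le> L" and sup: "supersol D L w"
    and x1: "x1 \<in> D" "w x1 = 0" and x: "x \<in> D"
  shows "w x = 0"
proof (rule ccontr)
  assume nx: "w x \<noteq> 0"
  define A where "A = {x \<in> D. w x = 0}"
  define B where "B = {x \<in> D. w x \<noteq> 0}"
  have "open A"
    unfolding open_contains_ball
  proof
    fix y assume y: "y \<in> A"
    then obtain r where r: "r > 0" "\<forall>x\<in>ball y r. w x = 0"
      using strong_max_local[OF D(1) L sup] by (auto simp: A_def)
    obtain s where s: "s > 0" "ball y s \<subseteq> D" using D(1) y by (auto simp: A_def open_contains_ball)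
    show "\<exists>e>0. ball y e \<subseteq> A"
      using r s by (intro exI[of _ "min r s"]) (auto simp: A_def)
  qed
  moreover have "open B"
  proof -
    have "open (D \<inter> w -` (- {0}))"
      by (rule continuous_open_preimage[OF supersol_continuous[OF sup D(1)] D(1)]) auto
    moreover have "D \<inter> w -` (- {0}) = B" by (auto simp: B_def)
    ultimately show ?thesis by simp
  qed
  moreover have "D \<subseteq> A \<union> B" "A \<inter> B \<inter> D = {}" by (auto simp: A_def B_def)
  moreover have "A \<inter> D \<noteq> {}" "B \<inter> D \<noteq> {}" using x1 x nx by (auto simp: A_def B_def)
  ultimately show False using D(2) unfolding connected_def by blast
qed

section \<open>Domains of class $C^2$\<close>

lemma isCont_tendsto_nhds: "isCont f x \<Longrightarrow> (f \<longlongrightarrow> f x) (nhds x)"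
  by (simp add: continuous_within tendsto_at_iff_tendsto_nhds)

text \<open>Only the open segment needs a derivative, because its ends will often lie on the
  frontier.\<close>

lemma segment_mvt:
  fixes k :: "'a::real_normed_vector \<Rightarrow> real"
  assumes cont: "continuous_on (closed_segment a b) k"
    and der: "\<And>t. 0 < t \<Longrightarrow> t < 1 \<Longrightarrow> (k has_derivative K (a + t *\<^sub>R (b - a))) (at (a + t *\<^sub>R (b - a)))"
  obtains t where "0 < t" "t < 1" "k b - k a = K (a + t *\<^sub>R (b - a)) (b - a)"
proof -
  let ?\<phi> = "\<lambda>t. k (a + t *\<^sub>R (b - a))"
  have seg: "a + t *\<^sub>R (b - a) \<in> closed_segment a b" if "t \<in> {0..1}" for t
    unfolding in_segment using that by (intro exI[of _ t]) (auto simp: algebra_simps)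
  have "continuous_on {0..1} ?\<phi>"
    by (rule continuous_on_compose2[OF cont]) (use seg in \<open>auto intro!: continuous_intros\<close>)
  moreover have "(?\<phi> has_derivative (\<lambda>s. K (a + t *\<^sub>R (b - a)) (s *\<^sub>R (b - a)))) (at t)"
    if "0 < t" "t < 1" for t
  proof -
    have "((\<lambda>t. a + t *\<^sub>R (b - a)) has_derivative (\<lambda>s. s *\<^sub>R (b - a))) (at t)"
      by (auto intro!: derivative_eq_intros)
    from has_derivative_compose[OF this der[OF that]] show ?thesis .
  qed
  ultimately obtain t where t: "0 < t" "t < 1" "?\<phi> 1 - ?\<phi> 0 = K (a + t *\<^sub>R (b - a)) ((1 - 0) *\<^sub>R (b - a))"
    using mvt[of 0 1 ?\<phi> "\<lambda>t s. K (a + t *\<^sub>R (b - a)) (s *\<^sub>R (b - a))"] by auto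
  then show ?thesis using that[of t] by simp
qed

lemma has_derivative_line:
  fixes k :: "'a::real_normed_vector \<Rightarrow> real"
  assumes "(k has_derivative K) (at (z + t *\<^sub>R v))"
  shows "((\<lambda>t. k (z + t *\<^sub>R v)) has_real_derivative K v) (at t)"
proof -
  have "((\<lambda>t. z + t *\<^sub>R v) has_derivative (\<lambda>s. s *\<^sub>R v)) (at t)"
    by (auto intro!: derivative_eq_intros)
  from has_derivative_compose[OF this assms]
  have 1: "((\<lambda>t. k (z + t *\<^sub>R v)) has_derivative (\<lambda>s. K (s *\<^sub>R v))) (at t)" .
  have 2: "K (s *\<^sub>R v) = s * K v" for s
    using has_derivative_bounded_linear[OF assms] by (simp add: linear_simps)
  show ?thesis by (rule has_derivative_imp_has_field_derivative[OF 1]) (simp add: 2)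
qed

text \<open>A defining function \<Phi> with gradient \<Psi>, and affine of slope 1 in the direction
  \<open>E\<close>, as x \<bullet> E - \<gamma> is for a graph. This normalisation replaces the
  implicit function theorem; differentiability of \<Psi> records the second order
  regularity.\<close>

definition chart :: "'a::euclidean_space set \<Rightarrow> 'a \<Rightarrow> real \<Rightarrow> 'a \<Rightarrow> ('a \<Rightarrow> real) \<Rightarrow> ('a \<Rightarrow> 'a) \<Rightarrow> bool" where
  "chart \<Omega> p r E \<Phi> \<Psi> \<longleftrightarrow> 0 < r \<and> (\<forall>x. (\<Phi> has_derivative (\<lambda>h. \<Psi> x \<bullet> h)) (at x)) \<and>
     (\<forall>x. \<Psi> differentiable (at x)) \<and> (\<forall>x s. \<Phi> (x + s *\<^sub>R E) = \<Phi> x + s) \<and>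
     \<Omega> \<inter> ball p r = {x \<in> ball p r. 0 < \<Phi> x}"

context
  fixes \<Omega> :: "'a::euclidean_space set" and p r E \<Phi> \<Psi>
  assumes chart: "chart \<Omega> p r E \<Phi> \<Psi>"
begin

lemma chart_r: "0 < r"
  using chart by (simp add: chart_def)

lemma chart_deriv: "(\<Phi> has_derivative (\<lambda>h. \<Psi> x \<bullet> h)) (at x)"
  using chart by (simp add: chart_def)

lemma chart_add: "\<Phi> (x + s *\<^sub>R E) = \<Phi> x + s"
  using chart by (simp add: chart_def)

lemma chart_cont: "continuous_on S \<Phi>"
  using chart_deriv has_derivative_continuous continuous_at_imp_continuous_on by blast

lemma chart_grad_diff: "\<Psi> differentiable (at x)"
  using chart by (simp add: chart_def)

lemma chart_mem: "x \<in> ball p r \<Longrightarrow> x \<in> \<Omega> \<longleftrightarrow> 0 < \<Phi> x"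
  using chart unfolding chart_def by blast

lemma chart_mvt:
  obtains t where "0 < t" "t < 1" "\<Phi> y - \<Phi> x = \<Psi> (x + t *\<^sub>R (y - x)) \<bullet> (y - x)"
  using segment_mvt[where k = \<Phi> and K = "\<lambda>x h. \<Psi> x \<bullet> h" and a = x and b = y] chart_cont chart_deriv by blast

lemma chart_grad_E: "\<Psi> x \<bullet> E = 1"
proof -
  have "((\<lambda>t. \<Phi> (x + t *\<^sub>R E)) has_real_derivative \<Psi> x \<bullet> E) (at 0)"
    by (rule has_derivative_line) (simp add: chart_deriv)
  moreover have "((\<lambda>t. \<Phi> (x + t *\<^sub>R E)) has_real_derivative 1) (at 0)"
    unfolding chart_add by (auto intro!: derivative_eq_intros)
  ultimately show ?thesis by (rule DERIV_unique)
qed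

lemma chart_grad_nz: "\<Psi> x \<noteq> 0"
  using chart_grad_E[of x] by auto

text \<open>A step s along \<open>E\<close> raises \<Phi> by exactly s, so every zero of \<Phi> in
  the ball is a limit of points of \<Omega>; negativity of \<Phi> is an open condition.\<close>

lemma chart_closure:
  assumes z: "z \<in> ball p r"
  shows "z \<in> closure \<Omega> \<longleftrightarrow> 0 \<le> \<Phi> z"
proof
  assume cl: "z \<in> closure \<Omega>"
  show "0 \<le> \<Phi> z"
  proof (rule ccontr)
    assume "\<not> 0 \<le> \<Phi> z"
    then have "z \<in> ball p r \<inter> {x. \<Phi> x < 0}" using z by auto
    moreover have "open (ball p r \<inter> {x. \<Phi> x < 0})"
      by (intro open_Int open_ball open_Collect_less chart_cont continuous_intros)
    moreover have "ball p r \<inter> {x. \<Phi> x < 0} \<inter> \<Omega> = {}" using chart_mem by force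
    ultimately show False using cl open_Int_closure_eq_empty by blast
  qed
next
  assume ge: "0 \<le> \<Phi> z"
  have "((\<lambda>s::real. z + s *\<^sub>R E) \<longlongrightarrow> z + 0 *\<^sub>R E) (at_right 0)" by (intro tendsto_intros)
  then have lim: "((\<lambda>s. z + s *\<^sub>R E) \<longlongrightarrow> z) (at_right 0)" by simp
  have "\<forall>\<^sub>F s in at_right 0. z + s *\<^sub>R E \<in> ball p r"
    using lim z by (rule topological_tendstoD[OF _ open_ball])
  moreover have "\<forall>\<^sub>F s::real in at_right 0. 0 < s" by (rule eventually_at_right_less)
  ultimately have "\<forall>\<^sub>F s in at_right 0. z + s *\<^sub>R E \<in> closure \<Omega>"
  proof eventually_elim
    case (elim s)
    then have "z + s *\<^sub>R E \<in> \<Omega>" using ge by (simp add: chart_mem chart_add)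
    then show ?case using closure_subset by blast
  qed
  then show "z \<in> closure \<Omega>"
    by (rule Lim_in_closed_set[OF closed_closure _ trivial_limit_at_right_real lim])
qed

lemma chart_frontier:
  assumes "open \<Omega>" "z \<in> ball p r"
  shows "z \<in> frontier \<Omega> \<longleftrightarrow> \<Phi> z = 0"
  using assms chart_closure[OF assms(2)] chart_mem[OF assms(2)]
  by (auto simp: frontier_def interior_open)

text \<open>The sign of the derivative of \<Phi> along \<open>v\<close> decides both halves. The
  exterior half is what fixes the sign of the normal and produces contradictions with reflected caps
  staying in \<Omega>.\<close>

lemma chart_enter:
  assumes z: "z \<in> ball p r" "\<Phi> z = 0" and v: "0 < v \<bullet> \<Psi> z"
  shows "\<exists>\<delta>>0. \<forall>t. 0 < t \<and> t < \<delta> \<longrightarrow> z + t *\<^sub>R v \<in> \<Omega> \<and> z + t *\<^sub>R (- v) \<notin> closure \<Omega>"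
proof -
  have pos: "((\<lambda>t. \<Phi> (z + t *\<^sub>R v)) has_real_derivative \<Psi> z \<bullet> v) (at 0)"
    by (rule has_derivative_line) (simp add: chart_deriv)
  obtain d1 where d1: "d1 > 0" "\<And>t. 0 < t \<Longrightarrow> t < d1 \<Longrightarrow> 0 < \<Phi> (z + t *\<^sub>R v)"
    using DERIV_pos_inc_right[OF pos] v z by (auto simp: inner_commute)
  obtain d2 where d2: "d2 > 0" "\<And>t. 0 < t \<Longrightarrow> t < d2 \<Longrightarrow> \<Phi> (z + t *\<^sub>R (- v)) < 0"
    using DERIV_pos_inc_left[OF pos] v z by (auto simp: inner_commute)
  have lim: "((\<lambda>t::real. z + t *\<^sub>R w) \<longlongrightarrow> z + 0 *\<^sub>R w) (at_right 0)" for w by (intro tendsto_intros)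
  have ev: "\<forall>\<^sub>F t in at_right 0. z + t *\<^sub>R w \<in> ball p r" for w
    using topological_tendstoD[OF lim[of w] open_ball, of p r] z by simp
  have "\<forall>\<^sub>F t in at_right 0. z + t *\<^sub>R v \<in> ball p r \<and> z + t *\<^sub>R (- v) \<in> ball p r"
    using ev[of v] ev[of "- v"] by (rule eventually_conj)
  then obtain d3 where d3: "d3 > 0"
      "\<And>t. 0 < t \<Longrightarrow> t < d3 \<Longrightarrow> z + t *\<^sub>R v \<in> ball p r \<and> z + t *\<^sub>R (- v) \<in> ball p r"
    unfolding eventually_at_right_field by auto
  show ?thesis
  proof (intro exI[of _ "min d1 (min d2 d3)"] conjI allI impI)
    show "0 < min d1 (min d2 d3)" using d1 d2 d3 by simp
    fix t assume t: "0 < t \<and> t < min d1 (min d2 d3)"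
    show "z + t *\<^sub>R v \<in> \<Omega>" using chart_mem[of "z + t *\<^sub>R v"] d1(2)[of t] d3(2)[of t] t by auto
    show "z + t *\<^sub>R (- v) \<notin> closure \<Omega>"
      using chart_closure[of "z + t *\<^sub>R (- v)"] d2(2)[of t] d3(2)[of t] t by auto
  qed
qed

text \<open>The curve is the graph over the line \<open>z + \<real>\<tau>\<close>, reparametrised by the bounded
  function \<open>\<delta> sin (t / \<delta>)\<close> because \<^const>\<open>inner_unit_normal\<close> only tests curves defined for all times.\<close>

lemma chart_curve:
  assumes op: "open \<Omega>" and z: "z \<in> ball p r" "\<Phi> z = 0" and \<tau>: "\<tau> \<bullet> \<Psi> z = 0"
  shows "\<exists>c. (\<forall>t. c t \<in> frontier \<Omega> \<inter> ball p r) \<and> c (0::real) = z \<and> (c has_vector_derivative \<tau>) (at 0)"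
proof -
  \<comment> \<open>Subtracting the value of \<Phi> along \<open>E\<close> returns the point to the
    zero set. Since \<tau> is orthogonal to the gradient, the correction has zero derivative at 0
    and the velocity stays \<tau>.\<close>
  define k where "k s = (z + s *\<^sub>R \<tau>) - \<Phi> (z + s *\<^sub>R \<tau>) *\<^sub>R E" for s :: real
  have k0: "k 0 = z" using z by (simp add: k_def)
  have \<Phi>k: "\<Phi> (k s) = 0" for s
    using chart_add[of "z + s *\<^sub>R \<tau>" "- \<Phi> (z + s *\<^sub>R \<tau>)"] by (simp add: k_def)
  have d\<Phi>: "((\<lambda>s. \<Phi> (z + s *\<^sub>R \<tau>)) has_real_derivative \<Psi> z \<bullet> \<tau>) (at 0)"
    by (rule has_derivative_line) (simp add: chart_deriv)
  have dk: "(k has_vector_derivative \<tau>) (at 0)"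
    unfolding k_def
    by (rule derivative_eq_intros refl d\<Phi> | use \<tau> in \<open>simp add: inner_commute\<close>)+
  have "isCont k 0" using dk has_vector_derivative_continuous by blast
  then have "(k \<longlongrightarrow> k 0) (nhds 0)" by (rule isCont_tendsto_nhds)
  then have "\<forall>\<^sub>F s in nhds 0. k s \<in> ball p r"
    by (rule topological_tendstoD) (use z(1) k0 in auto)
  then obtain \<delta> where \<delta>: "\<delta> > 0" "\<And>s. \<bar>s\<bar> < \<delta> \<Longrightarrow> k s \<in> ball p r"
    unfolding eventually_nhds_metric by (auto simp: dist_real_def)
  define s where "s t = \<delta>/2 * sin (t * (2/\<delta>))" for t :: real
  have sb: "\<bar>s t\<bar> < \<delta>" for t
  proof -
    have "\<bar>s t\<bar> \<le> \<delta>/2 * 1" unfolding s_def abs_mult using \<delta>(1) by (intro mult_mono) auto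
    then show ?thesis using \<delta>(1) by simp
  qed
  have ds: "(s has_real_derivative 1) (at 0)"
    unfolding s_def using \<delta>(1) by (auto intro!: derivative_eq_intros)
  have s0: "s 0 = 0" by (simp add: s_def)
  have "((k \<circ> s) has_vector_derivative (1 *\<^sub>R \<tau>)) (at 0)"
    by (rule vector_diff_chain_at) (use ds dk s0 in \<open>auto simp: has_real_derivative_iff_has_vector_derivative\<close>)
  moreover have "(k \<circ> s) t \<in> frontier \<Omega> \<inter> ball p r" for t
    using \<delta>(2)[OF sb] chart_frontier[OF op \<delta>(2)[OF sb]] \<Phi>k by simp
  ultimately show ?thesis using s0 k0 by (intro exI[of _ "k \<circ> s"]) simp
qed

text \<open>Interior sphere condition. Taylor's formula gives \<Phi> x >= N n \<bullet> (x - z) - M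
  |x - z|^2, while points of the closed ball satisfy |x - z|^2 <= 2 R n \<bullet> (x - z); so \<Phi>
  is positive as soon as 2 R M < N.\<close>

lemma chart_inner_ball:
  assumes z: "z \<in> ball p r" "\<Phi> z = 0"
  shows "\<exists>R0>0. \<forall>R. 0 < R \<and> R \<le> R0 \<longrightarrow> cball (z + R *\<^sub>R sgn (\<Psi> z)) R - {z} \<subseteq> \<Omega>"
proof -
  define n where "n = sgn (\<Psi> z)"
  define N where "N = norm (\<Psi> z)"
  have N: "N > 0" using chart_grad_nz by (simp add: N_def)
  have \<Psi>n: "\<Psi> z = N *\<^sub>R n" using N by (simp add: n_def N_def sgn_div_norm)
  have n1: "norm n = 1" using chart_grad_nz by (simp add: n_def norm_sgn)
  obtain D where D: "(\<Psi> has_derivative D) (at z)"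
    using chart_grad_diff unfolding differentiable_def by blast
  obtain B where B: "B > 0" "\<And>v. norm (D v) \<le> norm v * B"
    using bounded_linear.pos_bounded[OF has_derivative_bounded_linear[OF D]] by blast
  obtain d where d: "d > 0" "\<And>x. norm (x - z) < d \<Longrightarrow> norm (\<Psi> x - \<Psi> z - D (x - z)) \<le> 1 * norm (x - z)"
    using conjunct2[OF D[unfolded has_derivative_at_alt], rule_format, of 1] by auto
  define M where "M = B + 1"
  have M: "M > 0" using B by (simp add: M_def)
  have Lip: "norm (\<Psi> x - \<Psi> z) \<le> M * norm (x - z)" if "norm (x - z) < d" for x
  proof -
    have "norm (\<Psi> x - \<Psi> z) \<le> norm (\<Psi> x - \<Psi> z - D (x - z)) + norm (D (x - z))"
      by (metis add.commute diff_add_cancel norm_triangle_ineq)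
    also have "\<dots> \<le> 1 * norm (x - z) + norm (x - z) * B" using d(2)[OF that] B(2) by (rule add_mono)
    finally show ?thesis by (simp add: M_def algebra_simps)
  qed
  have low: "\<Psi> z \<bullet> (x - z) - M * (norm (x - z))\<^sup>2 \<le> \<Phi> x" if x: "norm (x - z) < d" for x
  proof -
    obtain t where t: "0 < t" "t < 1" "\<Phi> x - \<Phi> z = \<Psi> (z + t *\<^sub>R (x - z)) \<bullet> (x - z)"
      by (rule chart_mvt)
    define y where "y = z + t *\<^sub>R (x - z)"
    have ny: "norm (y - z) \<le> norm (x - z)" using t by (simp add: y_def mult_left_le_one_le)
    have "\<bar>(\<Psi> y - \<Psi> z) \<bullet> (x - z)\<bar> \<le> norm (\<Psi> y - \<Psi> z) * norm (x - z)" by (rule Cauchy_Schwarz_ineq2)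
    also have "\<dots> \<le> (M * norm (y - z)) * norm (x - z)"
      using Lip[of y] ny x by (intro mult_right_mono) auto
    also have "\<dots> \<le> (M * norm (x - z)) * norm (x - z)"
      using ny M by (intro mult_right_mono mult_left_mono) auto
    finally have "\<bar>(\<Psi> y - \<Psi> z) \<bullet> (x - z)\<bar> \<le> M * (norm (x - z))\<^sup>2" by (simp add: power2_eq_square)
    then show ?thesis using t(3) z(2) by (simp add: y_def[symmetric] inner_diff_left)
  qed
  \<comment> \<open>Points of the ball are within 2 R of \<open>z\<close>; the last two bounds keep
    them in the region of the estimate and in the chart, the first gives 2 R M <= N/2.\<close>
  define R0 where "R0 = min (N / (4 * M)) (min (d / 4) ((r - dist p z) / 4))"
  have R0: "R0 > 0" using N M d z by (simp add: R0_def)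
  have "x \<in> \<Omega>" if R: "0 < R" "R \<le> R0" and x: "x \<in> cball (z + R *\<^sub>R n) R" "x \<noteq> z" for x R
  proof -
    have "norm (x - (z + R *\<^sub>R n)) \<le> R" using x by (simp add: dist_norm norm_minus_commute)
    then have "(norm ((x - z) - R *\<^sub>R n))\<^sup>2 \<le> R\<^sup>2" by (simp add: diff_diff_add power_mono)
    then have q: "(norm (x - z))\<^sup>2 \<le> 2 * R * (n \<bullet> (x - z))"
      using n1 unfolding power2_norm_eq_inner
      by (simp add: inner_diff_left inner_diff_right inner_commute power2_eq_square norm_eq_1 algebra_simps)
    have "norm (x - z) \<le> norm (x - (z + R *\<^sub>R n)) + norm (R *\<^sub>R n)"
      using norm_triangle_ineq[of "x - (z + R *\<^sub>R n)" "R *\<^sub>R n"] by simp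
    then have nx: "norm (x - z) \<le> 2 * R" using x n1 R by (simp add: dist_norm norm_minus_commute)
    have xd: "norm (x - z) < d" using nx R d by (simp add: R0_def)
    have "dist p x \<le> dist p z + norm (x - z)" by (metis dist_commute dist_norm dist_triangle)
    then have xb: "x \<in> ball p r" using nx R z(1) by (simp add: R0_def)
    have xz: "(norm (x - z))\<^sup>2 > 0" using x(2) by simp
    have "R * M \<le> N / 4" using R M by (simp add: R0_def field_simps)
    then have "2 * R * M < N" using N by linarith
    then have "2 * R * M * (norm (x - z))\<^sup>2 < N * (norm (x - z))\<^sup>2" using xz by (rule mult_strict_right_mono)
    also have "\<dots> \<le> N * (2 * R * (n \<bullet> (x - z)))" using q N by (intro mult_left_mono) auto
    finally have "2 * R * (M * (norm (x - z))\<^sup>2) < 2 * R * (N * (n \<bullet> (x - z)))" by (simp add: algebra_simps)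
    then have "M * (norm (x - z))\<^sup>2 < N * (n \<bullet> (x - z))" using R by simp
    then have "0 < \<Phi> x" using low[OF xd] by (simp add: \<Psi>n)
    then show ?thesis using chart_mem[OF xb] by simp
  qed
  then show ?thesis using R0 unfolding n_def by blast
qed

text \<open>Near \<open>z\<close>, \<Phi> decreases along \<open>e\<close> at a rate above
  \<open>k\<close>, half the rate at \<open>z\<close>. So moving backwards stays in \<Omega>, and
  moving forwards meets the zero set, before which \<Phi> is positive.\<close>

lemma chart_transversal:
  assumes op: "open \<Omega>" and z: "z \<in> ball p r" "\<Phi> z = 0" and e: "e \<bullet> \<Psi> z < 0" "norm e = 1" and \<eta>0: "0 < \<eta>0"
  shows "\<exists>\<delta>>0. \<forall>x\<in>\<Omega> \<inter> ball z \<delta>. (\<forall>s. 0 \<le> s \<and> s \<le> \<delta> \<longrightarrow> x - s *\<^sub>R e \<in> \<Omega> \<inter> ball z \<eta>0) \<and>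
    (\<exists>t>0. x + t *\<^sub>R e \<in> frontier \<Omega> \<and> (\<forall>s. 0 \<le> s \<and> s < t \<longrightarrow> x + s *\<^sub>R e \<in> \<Omega>) \<and>
        (\<forall>s. 0 \<le> s \<and> s \<le> t \<longrightarrow> x + s *\<^sub>R e \<in> ball z \<eta>0))"
proof -
  define k where "k = - (e \<bullet> \<Psi> z) / 2"
  have k: "k > 0" using e by (simp add: k_def)
  have "continuous (at z) (\<lambda>x. e \<bullet> \<Psi> x)"
    by (intro continuous_intros differentiable_imp_continuous_within chart_grad_diff)
  then have "\<forall>\<^sub>F x in nhds z. e \<bullet> \<Psi> x < - k"
    by (rule order_tendstoD(2)[OF isCont_tendsto_nhds]) (use e in \<open>simp add: k_def\<close>)
  then obtain d where d: "d > 0" "\<And>x. dist x z < d \<Longrightarrow> e \<bullet> \<Psi> x < - k"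
    unfolding eventually_nhds_metric by blast
  define \<eta> where "\<eta> = min d (min \<eta>0 (r - dist p z))"
  have \<eta>: "0 < \<eta>" "\<eta> \<le> \<eta>0" using d \<eta>0 z by (auto simp: \<eta>_def)
  have \<eta>r: "ball z \<eta> \<subseteq> ball p r"
  proof
    fix x assume "x \<in> ball z \<eta>"
    then have "dist z x < r - dist p z" by (simp add: \<eta>_def)
    then show "x \<in> ball p r" using dist_triangle[of p x z] by simp
  qed
  have neg: "e \<bullet> \<Psi> x < - k" if "x \<in> ball z \<eta>" for x using d(2)[of x] that by (simp add: \<eta>_def dist_commute)
  have dec: "\<Phi> (x + b *\<^sub>R e) < \<Phi> (x + a *\<^sub>R e) - k * (b - a)"
    if "a < b" "x + a *\<^sub>R e \<in> ball z \<eta>" "x + b *\<^sub>R e \<in> ball z \<eta>" for x a b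
  proof -
    define A where "A = x + a *\<^sub>R e"
    define B where "B = x + b *\<^sub>R e"
    obtain t where t: "0 < t" "t < 1" "\<Phi> B - \<Phi> A = \<Psi> (A + t *\<^sub>R (B - A)) \<bullet> (B - A)" by (rule chart_mvt)
    have "A + t *\<^sub>R (B - A) = (1 - t) *\<^sub>R A + t *\<^sub>R B" by (simp add: algebra_simps)
    then have "A + t *\<^sub>R (B - A) \<in> ball z \<eta>"
      using convexD_alt[OF convex_ball[of z \<eta>], of A B t] that t by (simp add: A_def B_def)
    from neg[OF this] have "e \<bullet> \<Psi> (A + t *\<^sub>R (B - A)) * (b - a) < - k * (b - a)"
      using that(1) by (intro mult_strict_right_mono) auto
    moreover have "B - A = (b - a) *\<^sub>R e" by (simp add: A_def B_def algebra_simps)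
    ultimately have "\<Phi> B - \<Phi> A < - k * (b - a)" using t(3) by (simp add: inner_commute mult.commute)
    then show ?thesis by (simp add: A_def B_def)
  qed
  have "isCont \<Phi> z" using chart_deriv has_derivative_continuous by blast
  \<comment> \<open>From a height below k \<eta>/4, a path of length \<eta>/4 along \<open>e\<close>
    is long enough to leave \<Omega>.\<close>
  then have "\<forall>\<^sub>F x in nhds z. \<Phi> x < k * (\<eta> / 4)"
    by (rule order_tendstoD(2)[OF isCont_tendsto_nhds]) (use z k \<eta> in simp)
  then obtain d2 where d2: "d2 > 0" "\<And>x. dist x z < d2 \<Longrightarrow> \<Phi> x < k * (\<eta> / 4)"
    unfolding eventually_nhds_metric by blast
  define \<delta> where "\<delta> = min (\<eta> / 4) d2"
  have \<delta>: "0 < \<delta>" "\<delta> \<le> \<eta>/4" using \<eta> d2 by (auto simp: \<delta>_def)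
  have inb: "x + s *\<^sub>R e \<in> ball z \<eta>" if "x \<in> ball z \<delta>" "\<bar>s\<bar> \<le> \<eta>/4" for x s
  proof -
    have "dist z (x + s *\<^sub>R e) \<le> dist z x + dist x (x + s *\<^sub>R e)" by (rule dist_triangle)
    also have "\<dots> < \<delta> + \<eta>/4" using that e by (simp add: dist_norm)
    finally show ?thesis using \<delta> \<eta> by simp
  qed
  show ?thesis
  proof (rule exI[of _ \<delta>], intro conjI ballI)
    show "\<delta> > 0" by (rule \<delta>)
    fix x assume x: "x \<in> \<Omega> \<inter> ball z \<delta>"
    have xb: "x \<in> ball z \<eta>" using inb[of x 0] x \<eta> by simp
    have \<Phi>x: "\<Phi> x > 0" using chart_mem[of x] x xb \<eta>r by auto
    show "\<forall>s. 0 \<le> s \<and> s \<le> \<delta> \<longrightarrow> x - s *\<^sub>R e \<in> \<Omega> \<inter> ball z \<eta>0"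
    proof (intro allI impI)
      fix s assume s: "0 \<le> s \<and> s \<le> \<delta>"
      have b: "x - s *\<^sub>R e \<in> ball z \<eta>" using inb[of x "- s"] x s \<delta> by auto
      have "0 < \<Phi> (x - s *\<^sub>R e)"
      proof (cases "s = 0")
        case False
        then have "k * s > 0" using s k by simp
        then show ?thesis using dec[of "- s" 0 x] b xb False s \<Phi>x by simp
      qed (use \<Phi>x in simp)
      then show "x - s *\<^sub>R e \<in> \<Omega> \<inter> ball z \<eta>0" using chart_mem[of "x - s *\<^sub>R e"] b \<eta>r \<eta> by auto
    qed
    have neg4: "\<Phi> (x + (\<eta>/4) *\<^sub>R e) < 0"
      using dec[of 0 "\<eta>/4" x] xb inb[of x "\<eta>/4"] x \<eta> d2(2)[of x] by (simp add: \<delta>_def dist_commute)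
    have "\<exists>t. 0 \<le> t \<and> t \<le> \<eta>/4 \<and> \<Phi> (x + t *\<^sub>R e) = 0"
      by (rule IVT2'[of "\<lambda>t. \<Phi> (x + t *\<^sub>R e)"])
         (use neg4 \<Phi>x \<eta> in \<open>auto intro!: continuous_on_compose2[OF chart_cont] continuous_intros\<close>)
    then obtain t where t: "0 \<le> t" "t \<le> \<eta>/4" "\<Phi> (x + t *\<^sub>R e) = 0" by blast
    have t0: "t > 0" using t \<Phi>x by (cases "t = 0") auto
    show "\<exists>t>0. x + t *\<^sub>R e \<in> frontier \<Omega> \<and> (\<forall>s. 0 \<le> s \<and> s < t \<longrightarrow> x + s *\<^sub>R e \<in> \<Omega>) \<and>
        (\<forall>s. 0 \<le> s \<and> s \<le> t \<longrightarrow> x + s *\<^sub>R e \<in> ball z \<eta>0)"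
    proof (intro exI[of _ t] conjI allI impI)
      have bt: "x + t *\<^sub>R e \<in> ball z \<eta>" using inb[of x t] x t by auto
      then show "x + t *\<^sub>R e \<in> frontier \<Omega>" using chart_frontier[OF op] t \<eta>r by auto
      fix s assume s: "0 \<le> s \<and> s < t"
      have bs: "x + s *\<^sub>R e \<in> ball z \<eta>" using inb[of x s] x t s by auto
      have "k * (t - s) > 0" using k s by simp
      then have "\<Phi> (x + s *\<^sub>R e) > 0" using dec[of s t x] bs bt s t by simp
      then show "x + s *\<^sub>R e \<in> \<Omega>" using chart_mem[of "x + s *\<^sub>R e"] bs \<eta>r by auto
    next
      fix s assume s: "0 \<le> s \<and> s \<le> t"
      then show "x + s *\<^sub>R e \<in> ball z \<eta>0" using inb[of x s] x t \<eta> by auto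
    qed (rule t0)
  qed
qed

end

section \<open>Domains given by charts, with their inner normal\<close>

locale smooth_domain =
  fixes \<Omega> :: "'a::euclidean_space set" and \<nu> :: "'a \<Rightarrow> 'a"
  assumes open_dom: "open \<Omega>" and bounded_dom: "bounded \<Omega>"
    and charts: "p \<in> frontier \<Omega> \<Longrightarrow> \<exists>r E \<Phi> \<Psi>. chart \<Omega> p r E \<Phi> \<Psi>"
    and normal: "chart \<Omega> p r E \<Phi> \<Psi> \<Longrightarrow> z \<in> frontier \<Omega> \<Longrightarrow> z \<in> ball p r \<Longrightarrow> \<nu> z = sgn (\<Psi> z)"
begin

lemma chart_at:
  assumes "p \<in> frontier \<Omega>"
  obtains r E \<Phi> \<Psi> where "chart \<Omega> p r E \<Phi> \<Psi>" "p \<in> ball p r" "\<Phi> p = 0" "\<nu> p = sgn (\<Psi> p)" "\<Psi> p \<noteq> 0"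
proof -
  obtain r E \<Phi> \<Psi> where c: "chart \<Omega> p r E \<Phi> \<Psi>" using charts[OF assms] by blast
  have b: "p \<in> ball p r" using chart_r[OF c] by simp
  show ?thesis
    using that[OF c b] chart_frontier[OF c open_dom b] assms normal[OF c assms b] chart_grad_nz[OF c] by simp
qed

lemma frontier_notin: "p \<in> frontier \<Omega> \<Longrightarrow> p \<notin> \<Omega>"
  using open_dom frontier_disjoint_eq by blast

lemma frontier_closure: "p \<in> frontier \<Omega> \<Longrightarrow> p \<in> closure \<Omega>"
  by (simp add: frontier_def)

lemma closure_cases: "p \<in> closure \<Omega> \<Longrightarrow> p \<in> \<Omega> \<or> p \<in> frontier \<Omega>"
  by (auto simp: closure_Un_frontier)

lemma normal_unit: "p \<in> frontier \<Omega> \<Longrightarrow> norm (\<nu> p) = 1"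
  by (erule chart_at) (simp add: norm_sgn)

lemma inner_sgn_sign:
  assumes "(y::'a) \<noteq> 0"
  shows "0 < v \<bullet> sgn y \<longleftrightarrow> 0 < v \<bullet> y" "v \<bullet> sgn y < 0 \<longleftrightarrow> v \<bullet> y < 0" "v \<bullet> sgn y = 0 \<longleftrightarrow> v \<bullet> y = 0"
  using assms by (simp_all add: sgn_div_norm zero_less_mult_iff mult_less_0_iff)

lemma normal_enter:
  assumes p: "p \<in> frontier \<Omega>" and v: "0 < v \<bullet> \<nu> p"
  shows "\<exists>\<delta>>0. \<forall>t. 0 < t \<and> t < \<delta> \<longrightarrow> p + t *\<^sub>R v \<in> \<Omega> \<and> p + t *\<^sub>R (- v) \<notin> closure \<Omega>"
proof -
  obtain r E \<Phi> \<Psi> where c: "chart \<Omega> p r E \<Phi> \<Psi>" "p \<in> ball p r" "\<Phi> p = 0" "\<nu> p = sgn (\<Psi> p)" "\<Psi> p \<noteq> 0"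
    using chart_at[OF p] by metis
  then show ?thesis using chart_enter[OF c(1-3)] v inner_sgn_sign by metis
qed

text \<open>In a chart \<nu> is the normalised gradient, which is differentiable. This is needed to
  differentiate the overdetermined condition, where \<nu> itself varies along the frontier.\<close>

lemma normal_curve:
  assumes p: "p \<in> frontier \<Omega>" and \<tau>: "\<tau> \<bullet> \<nu> p = 0"
  obtains c where "\<And>t. c t \<in> frontier \<Omega>" "c (0::real) = p" "(c has_vector_derivative \<tau>) (at 0)"
    "(\<lambda>t. \<nu> (c t)) differentiable (at 0)"
proof -
  obtain r E \<Phi> \<Psi> where c: "chart \<Omega> p r E \<Phi> \<Psi>" "p \<in> ball p r" "\<Phi> p = 0" "\<nu> p = sgn (\<Psi> p)" "\<Psi> p \<noteq> 0"
    using chart_at[OF p] by metis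
  have \<tau>': "\<tau> \<bullet> \<Psi> p = 0" using \<tau> c inner_sgn_sign by metis
  obtain k where k: "\<forall>t. k t \<in> frontier \<Omega> \<inter> ball p r" "k (0::real) = p" "(k has_vector_derivative \<tau>) (at 0)"
    using chart_curve[OF c(1) open_dom c(2,3) \<tau>'] by blast
  have e: "(\<lambda>t. \<nu> (k t)) = (\<lambda>t. inverse (norm (\<Psi> (k t))) *\<^sub>R \<Psi> (k t))"
    using normal[OF c(1)] k(1) by (auto simp: sgn_div_norm)
  have dk: "k differentiable (at 0)" using k(3) by (auto simp: has_vector_derivative_def differentiable_def)
  have d\<Psi>: "(\<lambda>t. \<Psi> (k t)) differentiable (at 0)"
    using differentiable_chain_at[OF dk chart_grad_diff[OF c(1)]] by (simp add: o_def)
  have "norm differentiable (at (\<Psi> (k 0)))" using c k by (intro differentiable_norm_at) auto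
  then have "(\<lambda>t. norm (\<Psi> (k t))) differentiable (at 0)"
    using differentiable_chain_at[OF d\<Psi>, of norm] by (simp add: o_def)
  then have "(\<lambda>t. inverse (norm (\<Psi> (k t))) *\<^sub>R \<Psi> (k t)) differentiable (at 0)"
    using c k d\<Psi> by (intro differentiable_scaleR differentiable_inverse) auto
  then show ?thesis using that[of k] k e by auto
qed

lemma normal_ball:
  assumes p: "p \<in> frontier \<Omega>"
  shows "\<exists>R0>0. \<forall>R. 0 < R \<and> R \<le> R0 \<longrightarrow> cball (p + R *\<^sub>R \<nu> p) R - {p} \<subseteq> \<Omega>"
proof -
  obtain r E \<Phi> \<Psi> where c: "chart \<Omega> p r E \<Phi> \<Psi>" "p \<in> ball p r" "\<Phi> p = 0" "\<nu> p = sgn (\<Psi> p)" "\<Psi> p \<noteq> 0"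
    using chart_at[OF p] by metis
  then show ?thesis using chart_inner_ball[OF c(1-3)] by simp
qed

lemma normal_transversal:
  assumes p: "p \<in> frontier \<Omega>" and e: "e \<bullet> \<nu> p < 0" "norm e = 1" and \<eta>0: "0 < \<eta>0"
  shows "\<exists>\<delta>>0. \<forall>x\<in>\<Omega> \<inter> ball p \<delta>. (\<forall>s. 0 \<le> s \<and> s \<le> \<delta> \<longrightarrow> x - s *\<^sub>R e \<in> \<Omega> \<inter> ball p \<eta>0) \<and>
    (\<exists>t>0. x + t *\<^sub>R e \<in> frontier \<Omega> \<and> (\<forall>s. 0 \<le> s \<and> s < t \<longrightarrow> x + s *\<^sub>R e \<in> \<Omega>) \<and>
        (\<forall>s. 0 \<le> s \<and> s \<le> t \<longrightarrow> x + s *\<^sub>R e \<in> ball p \<eta>0))"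
proof -
  obtain r E \<Phi> \<Psi> where c: "chart \<Omega> p r E \<Phi> \<Psi>" "p \<in> ball p r" "\<Phi> p = 0" "\<nu> p = sgn (\<Psi> p)" "\<Psi> p \<noteq> 0"
    using chart_at[OF p] by metis
  have e': "e \<bullet> \<Psi> p < 0" using e c inner_sgn_sign by metis
  show ?thesis by (rule chart_transversal[OF c(1) open_dom c(2,3) e' e(2) \<eta>0])
qed

text \<open>A boundary point and a nearby point of the closure are joined by a path inside the domain,
  of length comparable to their distance: move both in the chart direction \<open>E\<close> first.\<close>

lemma has_derivative_closure:
  fixes f :: "'a \<Rightarrow> real"
  assumes cf: "continuous_on (closure \<Omega>) f" and df: "\<And>x. x \<in> \<Omega> \<Longrightarrow> (f has_derivative (\<lambda>h. g x \<bullet> h)) (at x)"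
    and cg: "continuous_on (closure \<Omega>) g" and p: "p \<in> closure \<Omega>"
  shows "(f has_derivative (\<lambda>h. g p \<bullet> h)) (at p within closure \<Omega>)"
proof (cases "p \<in> \<Omega>")
  case True
  show ?thesis by (rule has_derivative_at_withinI[OF df[OF True]])
next
  case False
  then have pf: "p \<in> frontier \<Omega>" using p closure_cases by blast
  obtain r E \<Phi> \<Psi> where c: "chart \<Omega> p r E \<Phi> \<Psi>" "p \<in> ball p r" "\<Phi> p = 0" "\<nu> p = sgn (\<Psi> p)" "\<Psi> p \<noteq> 0"
    using chart_at[OF pf] by metis
  define K where "K = norm (\<Psi> p) + 1"
  have K: "K > 0" by (simp add: K_def add_nonneg_pos)
  have "isCont (\<lambda>x. norm (\<Psi> x)) p"
    by (intro continuous_intros differentiable_imp_continuous_within chart_grad_diff[OF c(1)])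
  then have "\<forall>\<^sub>F x in nhds p. norm (\<Psi> x) < K"
    by (rule order_tendstoD(2)[OF isCont_tendsto_nhds]) (simp add: K_def)
  then obtain d1 where d1: "d1 > 0" "\<And>x. dist x p < d1 \<Longrightarrow> norm (\<Psi> x) < K"
    unfolding eventually_nhds_metric by blast
  \<comment> \<open>The path has two pieces of length K |E| |x - p| each and one of length |x - p|;
    \<open>C\<close> is its total length divided by |x - p|.\<close>
  define C where "C = 1 + 2 * K * norm E"
  have C: "C \<ge> 1" using K by (simp add: C_def)
  show ?thesis
    unfolding has_derivative_within_alt
  proof (intro conjI allI impI)
    show "bounded_linear (\<lambda>h. g p \<bullet> h)" by (rule bounded_linear_inner_right)
    fix \<epsilon> :: real assume \<epsilon>: "0 < \<epsilon>"
    define \<epsilon>' where "\<epsilon>' = \<epsilon> / C"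
    have \<epsilon>': "\<epsilon>' > 0" using \<epsilon> C by (simp add: \<epsilon>'_def)
    obtain d2 where d2: "d2 > 0" "\<And>x. x \<in> closure \<Omega> \<Longrightarrow> dist x p < d2 \<Longrightarrow> dist (g x) (g p) < \<epsilon>'"
      using cg p \<epsilon>' unfolding continuous_on_iff by blast
    define \<eta> where "\<eta> = min d1 (min d2 r)"
    have \<eta>: "\<eta> > 0" using d1 d2 chart_r[OF c(1)] by (simp add: \<eta>_def)
    \<comment> \<open>Subtracting the linear part leaves a function whose gradient is smaller than
      \<epsilon>' near \<open>p\<close>, so its increment is small relative to the length of the
      path.\<close>
    define k where "k y = f y - g p \<bullet> y" for y
    have seg: "\<bar>k b - k a\<bar> \<le> \<epsilon>' * norm (b - a)"
      if ab: "a \<in> closure \<Omega>" "b \<in> closure \<Omega>" "\<And>t. 0 < t \<Longrightarrow> t < 1 \<Longrightarrow> a + t *\<^sub>R (b - a) \<in> \<Omega>"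
        and abb: "a \<in> ball p \<eta>" "b \<in> ball p \<eta>" for a b
    proof -
      have conv: "a + t *\<^sub>R (b - a) = (1 - t) *\<^sub>R a + t *\<^sub>R b" for t by (simp add: algebra_simps)
      have "closed_segment a b \<subseteq> closure \<Omega>"
      proof
        fix y assume "y \<in> closed_segment a b"
        then obtain t where t: "0 \<le> t" "t \<le> 1" "y = a + t *\<^sub>R (b - a)" unfolding in_segment conv by auto
        then consider "t = 0" | "t = 1" | "0 < t" "t < 1" by linarith
        then show "y \<in> closure \<Omega>" using ab t closure_subset by cases auto
      qed
      then have "continuous_on (closed_segment a b) k"
        unfolding k_def by (intro continuous_intros continuous_on_subset[OF cf])
      moreover have "(k has_derivative (\<lambda>h. g (a + t *\<^sub>R (b - a)) \<bullet> h - g p \<bullet> h)) (at (a + t *\<^sub>R (b - a)))"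
        if "0 < t" "t < 1" for t
        unfolding k_def using df[OF ab(3)[OF that]] by (auto intro!: derivative_eq_intros)
      ultimately obtain t where t: "0 < t" "t < 1"
          "k b - k a = g (a + t *\<^sub>R (b - a)) \<bullet> (b - a) - g p \<bullet> (b - a)"
        using segment_mvt[where k = k and a = a and b = b and K = "\<lambda>y h. g y \<bullet> h - g p \<bullet> h"] by blast
      define y where "y = a + t *\<^sub>R (b - a)"
      have "y \<in> ball p \<eta>" unfolding y_def conv using convexD_alt[OF convex_ball abb] t by simp
      moreover have "y \<in> closure \<Omega>" using ab(3)[OF t(1,2)] closure_subset unfolding y_def by blast
      ultimately have "dist (g y) (g p) < \<epsilon>'" using d2(2)[of y] by (simp add: \<eta>_def dist_commute)
      then have "norm (g y - g p) * norm (b - a) \<le> \<epsilon>' * norm (b - a)"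
        by (intro mult_right_mono) (auto simp: dist_norm)
      moreover have "\<bar>(g y - g p) \<bullet> (b - a)\<bar> \<le> norm (g y - g p) * norm (b - a)"
        by (rule Cauchy_Schwarz_ineq2)
      ultimately show ?thesis using t(3) by (simp add: y_def[symmetric] inner_diff_left)
    qed
    define d where "d = \<eta> / (1 + K * norm E)"
    have KE: "K * norm E \<ge> 0" using K by simp
    have d: "d > 0" using \<eta> KE by (simp add: d_def add_pos_nonneg)
    have de: "d * (1 + K * norm E) = \<eta>" using KE by (simp add: d_def)
    show "\<exists>d>0. \<forall>y\<in>closure \<Omega>. norm (y - p) < d \<longrightarrow>
      norm (f y - f p - g p \<bullet> (y - p)) \<le> \<epsilon> * norm (y - p)"
    proof (intro exI[of _ d] conjI ballI impI d)
      fix x assume x: "x \<in> closure \<Omega>" "norm (x - p) < d"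
      show "norm (f x - f p - g p \<bullet> (x - p)) \<le> \<epsilon> * norm (x - p)"
      proof (cases "x = p")
        case False
        \<comment> \<open>As \<open>K\<close> bounds the gradient near \<open>p\<close>, \<Phi>
          exceeds -\<theta> on the segment from \<open>p\<close> towards \<open>x\<close>; lifting
          the segment by \<theta> along \<open>E\<close> therefore moves it into \<Omega>.\<close>
        define \<theta> where "\<theta> = K * norm (x - p)"
        have \<theta>: "\<theta> > 0" using K False by (simp add: \<theta>_def)
        have sm: "norm (x - p) + \<theta> * norm E < \<eta>"
        proof -
          have "norm (x - p) + \<theta> * norm E = norm (x - p) * (1 + K * norm E)" by (simp add: \<theta>_def algebra_simps)
          also have "\<dots> < d * (1 + K * norm E)" using x KE by (intro mult_strict_right_mono) auto
          finally show ?thesis using de by simp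
        qed
        have near: "p + t *\<^sub>R (x - p) + s *\<^sub>R E \<in> ball p \<eta>" if "0 \<le> t" "t \<le> 1" "0 \<le> s" "s \<le> \<theta>" for t s
        proof -
          have "norm (t *\<^sub>R (x - p) + s *\<^sub>R E) \<le> t * norm (x - p) + s * norm E"
            using norm_triangle_ineq[of "t *\<^sub>R (x - p)" "s *\<^sub>R E"] that by simp
          also have "\<dots> \<le> 1 * norm (x - p) + \<theta> * norm E" using that by (intro add_mono mult_right_mono) auto
          also have "\<dots> < \<eta>" using sm by simp
          finally have "norm (t *\<^sub>R (x - p) + s *\<^sub>R E) < \<eta>" .
          moreover have "norm (p - (p + v)) = norm v" for v by simp
          ultimately show ?thesis unfolding mem_ball dist_norm add.assoc by (simp only:)
        qed
        have \<eta>r: "y \<in> ball p r" if "y \<in> ball p \<eta>" for y using that by (simp add: \<eta>_def)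
        have \<Phi>x: "\<Phi> x \<ge> 0" using chart_closure[OF c(1)] x(1) \<eta>r near[of 1 0] \<theta> by simp
        have p1: "p + s *\<^sub>R E \<in> \<Omega>" if "0 < s" "s \<le> \<theta>" for s
          using chart_mem[OF c(1) \<eta>r[OF near[of 0 s]]] that c(3) by (simp add: chart_add[OF c(1)])
        have x1: "x + s *\<^sub>R E \<in> \<Omega>" if "0 < s" "s \<le> \<theta>" for s
          using chart_mem[OF c(1) \<eta>r[OF near[of 1 s]]] that \<Phi>x by (simp add: chart_add[OF c(1)])
        have px: "p + t *\<^sub>R (x - p) + \<theta> *\<^sub>R E \<in> \<Omega>" if t: "0 \<le> t" "t < 1" for t
        proof -
          obtain s where s: "0 < s" "s < 1"
            "\<Phi> (p + t *\<^sub>R (x - p)) - \<Phi> p = \<Psi> (p + s *\<^sub>R (p + t *\<^sub>R (x - p) - p)) \<bullet> (p + t *\<^sub>R (x - p) - p)"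
            by (rule chart_mvt[OF c(1)])
          have st: "0 \<le> s * t" "s * t \<le> 1" using s t by (auto simp: mult_le_one)
          have "p + (s * t) *\<^sub>R (x - p) \<in> ball p \<eta>" using near[of "s * t" 0] st \<theta> by simp
          then have "norm (\<Psi> (p + (s * t) *\<^sub>R (x - p))) < K" using d1(2) by (simp add: \<eta>_def dist_commute)
          then have "norm (\<Psi> (p + (s * t) *\<^sub>R (x - p))) * norm (t *\<^sub>R (x - p)) \<le> K * norm (t *\<^sub>R (x - p))"
            by (intro mult_right_mono) auto
          moreover have "\<bar>\<Psi> (p + (s * t) *\<^sub>R (x - p)) \<bullet> (t *\<^sub>R (x - p))\<bar>
              \<le> norm (\<Psi> (p + (s * t) *\<^sub>R (x - p))) * norm (t *\<^sub>R (x - p))" by (rule Cauchy_Schwarz_ineq2)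
          ultimately have "\<bar>\<Phi> (p + t *\<^sub>R (x - p))\<bar> \<le> t * \<theta>"
            using s(3) c(3) t by (simp add: \<theta>_def mult.left_commute)
          also have "\<dots> < \<theta>" using t \<theta> by simp
          finally have "\<bar>\<Phi> (p + t *\<^sub>R (x - p))\<bar> < \<theta>" .
          then show ?thesis
            using chart_mem[OF c(1) \<eta>r[OF near[of t \<theta>]]] t \<theta> by (simp add: chart_add[OF c(1)])
        qed
        have cl: "y \<in> \<Omega> \<Longrightarrow> y \<in> closure \<Omega>" for y using closure_subset by blast
        have s1: "\<bar>k (p + \<theta> *\<^sub>R E) - k p\<bar> \<le> \<epsilon>' * norm (p + \<theta> *\<^sub>R E - p)"
        proof (rule seg)
          fix t :: real assume t: "0 < t" "t < 1"
          then show "p + t *\<^sub>R (p + \<theta> *\<^sub>R E - p) \<in> \<Omega>" using p1[of "t * \<theta>"] \<theta> by simp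
        qed (use p p1[of \<theta>] \<theta> cl near[of 0 \<theta>] \<eta> in auto)
        have s2: "\<bar>k (x + \<theta> *\<^sub>R E) - k x\<bar> \<le> \<epsilon>' * norm (x + \<theta> *\<^sub>R E - x)"
        proof (rule seg)
          fix t :: real assume t: "0 < t" "t < 1"
          then show "x + t *\<^sub>R (x + \<theta> *\<^sub>R E - x) \<in> \<Omega>" using x1[of "t * \<theta>"] \<theta> by simp
        qed (use x x1[of \<theta>] \<theta> cl near[of 1 \<theta>] near[of 1 0] in auto)
        have s3: "\<bar>k (x + \<theta> *\<^sub>R E) - k (p + \<theta> *\<^sub>R E)\<bar> \<le> \<epsilon>' * norm ((x + \<theta> *\<^sub>R E) - (p + \<theta> *\<^sub>R E))"
        proof (rule seg)
          fix t :: real assume t: "0 < t" "t < 1"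
          then show "p + \<theta> *\<^sub>R E + t *\<^sub>R (x + \<theta> *\<^sub>R E - (p + \<theta> *\<^sub>R E)) \<in> \<Omega>"
            using px[of t] by (simp add: algebra_simps)
        qed (use p1[of \<theta>] x1[of \<theta>] \<theta> cl near[of 1 \<theta>] near[of 0 \<theta>] in auto)
        have "\<bar>k x - k p\<bar> \<le> \<epsilon>' * (\<theta> * norm E) + \<epsilon>' * (\<theta> * norm E) + \<epsilon>' * norm (x - p)"
          using s1 s2 s3 \<theta> by simp
        also have "\<dots> = \<epsilon>' * (C * norm (x - p))" by (simp add: C_def \<theta>_def algebra_simps)
        also have "\<dots> = \<epsilon> * norm (x - p)" using C by (simp add: \<epsilon>'_def)
        finally show ?thesis by (simp add: k_def inner_diff_right algebra_simps)
      qed simp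
    qed
  qed
qed

end

text \<open>The second difference \<Delta> is symmetric in \<open>a\<close> and \<open>b\<close>,
  and divided by t^2 it converges to both bilinear expressions. Differentiability of the gradient at
  the single point \<open>x\<close> suffices for this.\<close>

lemma symmetric_second_derivative:
  fixes u :: "'a::real_inner \<Rightarrow> real"
  assumes S: "open S" "x \<in> S" and du: "\<And>y. y \<in> S \<Longrightarrow> (u has_derivative (\<lambda>h. G y \<bullet> h)) (at y)"
    and dG: "(G has_derivative H) (at x)"
  shows "a \<bullet> H b = b \<bullet> H a"
proof -
  define \<Delta> where "\<Delta> a b t = u (x + t *\<^sub>R a + t *\<^sub>R b) - u (x + t *\<^sub>R a) - u (x + t *\<^sub>R b) + u x" for a b t
  interpret H: bounded_linear H using dG by (rule has_derivative_bounded_linear)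
  have main: "\<exists>\<delta>>0. \<forall>t. 0 < t \<and> t < \<delta> \<longrightarrow> \<bar>\<Delta> a b t - t\<^sup>2 * (a \<bullet> H b)\<bar> \<le> \<epsilon> * t\<^sup>2" if \<epsilon>: "0 < \<epsilon>" for a b \<epsilon>
  proof -
    \<comment> \<open>The remainders of \<open>G\<close> at the two points of the difference are
      bounded by multiples of |a| + |b| and of |a|; pairing with \<open>a\<close> gives the product,
      and the added 1 avoids division by zero.\<close>
    define M where "M = norm a * (2 * norm a + norm b) + 1"
    have M: "M > 0" by (simp add: M_def add_nonneg_pos)
    obtain d where d: "d > 0" "\<And>y. norm (y - x) < d \<Longrightarrow> norm (G y - G x - H (y - x)) \<le> \<epsilon> / M * norm (y - x)"
      using conjunct2[OF dG[unfolded has_derivative_at_alt], rule_format, of "\<epsilon> / M"] \<epsilon> M by auto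
    obtain s where s: "s > 0" "ball x s \<subseteq> S" using S by (auto simp: open_contains_ball)
    define \<delta> where "\<delta> = min d s / (norm a + norm b + 1)"
    have nab: "norm a + norm b + 1 > 0" by (simp add: add_nonneg_pos)
    have \<delta>: "\<delta> > 0" using d s nab by (simp add: \<delta>_def)
    have \<delta>e: "\<delta> * (norm a + norm b + 1) = min d s" using nab by (simp add: \<delta>_def)
    show ?thesis
    proof (intro exI[of _ \<delta>] conjI allI impI \<delta>)
      fix t assume t: "0 < t \<and> t < \<delta>"
      have near: "norm (r *\<^sub>R a + q *\<^sub>R b) < min d s" if "0 \<le> r" "r \<le> t" "0 \<le> q" "q \<le> t" for r q
      proof -
        have "norm (r *\<^sub>R a + q *\<^sub>R b) \<le> r * norm a + q * norm b"
          using norm_triangle_ineq[of "r *\<^sub>R a" "q *\<^sub>R b"] that by simp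
        also have "\<dots> \<le> t * norm a + t * norm b" using that by (intro add_mono mult_right_mono) auto
        also have "\<dots> < t * (norm a + norm b + 1)" using t by (simp add: algebra_simps)
        also have "\<dots> \<le> \<delta> * (norm a + norm b + 1)" using t nab by (intro mult_right_mono) auto
        finally show ?thesis using \<delta>e by simp
      qed
      have inS: "x + r *\<^sub>R a + q *\<^sub>R b \<in> S" if "0 \<le> r" "r \<le> t" "0 \<le> q" "q \<le> t" for r q
      proof -
        have "dist x (x + r *\<^sub>R a + q *\<^sub>R b) = norm (r *\<^sub>R a + q *\<^sub>R b)"
        proof -
          have "norm (x - (x + v)) = norm v" for v by simp
          then show ?thesis unfolding dist_norm add.assoc by (simp only:)
        qed
        then show ?thesis using near[OF that] s by auto
      qed
      define \<phi> where "\<phi> r = u (x + t *\<^sub>R b + r *\<^sub>R a) - u (x + r *\<^sub>R a)" for r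
      have "(\<phi> has_real_derivative (G (x + t *\<^sub>R b + r *\<^sub>R a) \<bullet> a - G (x + r *\<^sub>R a) \<bullet> a)) (at r)"
        if "0 \<le> r" "r \<le> t" for r
        unfolding \<phi>_def using inS[OF that, of t] inS[OF that, of 0] t
        by (intro DERIV_diff has_derivative_line du) (auto simp: algebra_simps)
      then have "\<exists>r>0. r < t \<and> \<phi> t - \<phi> 0 = (t - 0) * (G (x + t *\<^sub>R b + r *\<^sub>R a) \<bullet> a - G (x + r *\<^sub>R a) \<bullet> a)"
        using t by (intro MVT2) auto
      then obtain r where r: "0 < r" "r < t" "\<phi> t - \<phi> 0 = t * ((G (x + t *\<^sub>R b + r *\<^sub>R a) - G (x + r *\<^sub>R a)) \<bullet> a)"
        by (auto simp: inner_diff_left)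
      define R1 where "R1 = G (x + t *\<^sub>R b + r *\<^sub>R a) - G x - H (t *\<^sub>R b + r *\<^sub>R a)"
      define R2 where "R2 = G (x + r *\<^sub>R a) - G x - H (r *\<^sub>R a)"
      have R1: "norm R1 \<le> \<epsilon> / M * (t * norm b + t * norm a)"
      proof -
        have n1: "norm (t *\<^sub>R b + r *\<^sub>R a) < d" using near[of r t] r t by (simp add: add.commute)
        have "norm R1 \<le> \<epsilon> / M * norm (t *\<^sub>R b + r *\<^sub>R a)"
          using d(2)[of "x + t *\<^sub>R b + r *\<^sub>R a"] n1 unfolding R1_def by (simp add: add.assoc)
        also have "\<dots> \<le> \<epsilon> / M * (t * norm b + t * norm a)"
        proof (rule mult_left_mono)
          have "norm (t *\<^sub>R b + r *\<^sub>R a) \<le> t * norm b + r * norm a"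
            using norm_triangle_ineq[of "t *\<^sub>R b" "r *\<^sub>R a"] r t by simp
          also have "\<dots> \<le> t * norm b + t * norm a" using r by (intro add_mono mult_right_mono) auto
          finally show "norm (t *\<^sub>R b + r *\<^sub>R a) \<le> t * norm b + t * norm a" .
        qed (use \<epsilon> M in simp)
        finally show ?thesis .
      qed
      have R2: "norm R2 \<le> \<epsilon> / M * (t * norm a)"
      proof -
        have n1: "norm (r *\<^sub>R a) < d" using near[of r 0] r t by simp
        have "norm R2 \<le> \<epsilon> / M * norm (r *\<^sub>R a)"
          using d(2)[of "x + r *\<^sub>R a"] n1 unfolding R2_def by simp
        also have "\<dots> \<le> \<epsilon> / M * (t * norm a)"
          using \<epsilon> M r by (intro mult_left_mono) (auto intro: mult_right_mono)
        finally show ?thesis .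
      qed
      have A: "\<phi> t - \<phi> 0 = \<Delta> a b t" unfolding \<phi>_def \<Delta>_def by (simp add: algebra_simps)
      have B: "G (x + t *\<^sub>R b + r *\<^sub>R a) - G (x + r *\<^sub>R a) = t *\<^sub>R H b + (R1 - R2)"
        unfolding R1_def R2_def by (simp add: H.add H.scaleR)
      have "\<Delta> a b t = t * ((t *\<^sub>R H b + (R1 - R2)) \<bullet> a)" using r(3) unfolding A B .
      also have "\<dots> = t\<^sup>2 * (a \<bullet> H b) + t * ((R1 - R2) \<bullet> a)"
        by (simp only: inner_add_left inner_scaleR_left inner_commute[of "H b"] power2_eq_square distrib_left mult.assoc)
      finally have "\<Delta> a b t - t\<^sup>2 * (a \<bullet> H b) = t * ((R1 - R2) \<bullet> a)" by simp
      then have "\<bar>\<Delta> a b t - t\<^sup>2 * (a \<bullet> H b)\<bar> \<le> t * (norm (R1 - R2) * norm a)"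
        using t Cauchy_Schwarz_ineq2[of "R1 - R2" a] by (simp add: abs_mult)
      also have "\<dots> \<le> t * ((\<epsilon> / M * (t * norm b + t * norm a) + \<epsilon> / M * (t * norm a)) * norm a)"
        using t R1 R2 norm_triangle_ineq4[of R1 R2] by (intro mult_left_mono mult_right_mono) auto
      also have "\<dots> = \<epsilon> / M * t\<^sup>2 * (norm a * (2 * norm a + norm b))"
        by (simp add: power2_eq_square algebra_simps)
      also have "\<dots> \<le> \<epsilon> / M * t\<^sup>2 * M" using \<epsilon> M by (intro mult_left_mono) (auto simp: M_def)
      also have "\<dots> = \<epsilon> * t\<^sup>2" using M by simp
      finally show "\<bar>\<Delta> a b t - t\<^sup>2 * (a \<bullet> H b)\<bar> \<le> \<epsilon> * t\<^sup>2" .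
    qed
  qed
  have sym: "\<Delta> a b t = \<Delta> b a t" for t by (simp add: \<Delta>_def algebra_simps)
  have bnd: "\<bar>a \<bullet> H b - b \<bullet> H a\<bar> \<le> \<epsilon>" if \<epsilon>: "0 < \<epsilon>" for \<epsilon>
  proof -
    obtain d1 where d1: "d1 > 0" "\<And>t. 0 < t \<Longrightarrow> t < d1 \<Longrightarrow> \<bar>\<Delta> a b t - t\<^sup>2 * (a \<bullet> H b)\<bar> \<le> \<epsilon>/2 * t\<^sup>2"
      using main[of "\<epsilon>/2" a b] \<epsilon> by auto
    obtain d2 where d2: "d2 > 0" "\<And>t. 0 < t \<Longrightarrow> t < d2 \<Longrightarrow> \<bar>\<Delta> b a t - t\<^sup>2 * (b \<bullet> H a)\<bar> \<le> \<epsilon>/2 * t\<^sup>2"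
      using main[of "\<epsilon>/2" b a] \<epsilon> by auto
    define t where "t = min d1 d2 / 2"
    have t: "0 < t" "t < d1" "t < d2" using d1 d2 by (auto simp: t_def)
    have "t\<^sup>2 * \<bar>a \<bullet> H b - b \<bullet> H a\<bar> = \<bar>t\<^sup>2 * (a \<bullet> H b) - t\<^sup>2 * (b \<bullet> H a)\<bar>"
      by (simp add: abs_mult right_diff_distrib[symmetric])
    also have "\<dots> \<le> \<epsilon>/2 * t\<^sup>2 + \<epsilon>/2 * t\<^sup>2" using d1(2)[of t] d2(2)[of t] t sym[of t] by linarith
    also have "\<dots> = t\<^sup>2 * \<epsilon>" by simp
    finally show ?thesis using t by simp
  qed
  have "\<bar>a \<bullet> H b - b \<bullet> H a\<bar> \<le> 0" by (rule field_le_epsilon) (use bnd in simp)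
  then show ?thesis by simp
qed

section \<open>From partial derivatives to gradients, Hessians and charts\<close>

lemma partial_gradient:
  fixes f :: "real^'n \<Rightarrow> real"
  assumes "f differentiable (at x)"
  shows "(f has_derivative (\<lambda>h. (\<chi> i. partial_deriv f i x) \<bullet> h)) (at x)"
proof -
  obtain f' where f': "(f has_derivative f') (at x)" using assms unfolding differentiable_def by blast
  have lin: "linear f'" using f' has_derivative_linear by blast
  have p: "f' (axis i 1) = partial_deriv f i x" for i
  proof -
    have "((\<lambda>t. f (x + t *\<^sub>R axis i 1)) has_real_derivative f' (axis i 1)) (at 0)"
      by (rule has_derivative_line) (simp add: f')
    then show ?thesis unfolding partial_deriv_def by (simp add: DERIV_imp_deriv)
  qed
  have "f' h = (\<chi> i. partial_deriv f i x) \<bullet> h" for h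
  proof -
    have "f' h = f' (\<Sum>i\<in>UNIV. (h $ i) *\<^sub>R axis i 1)"
      using basis_expansion[of h] by (simp add: scalar_mult_eq_scaleR)
    also have "\<dots> = (\<Sum>i\<in>UNIV. (h $ i) *\<^sub>R f' (axis i 1))"
      by (simp add: linear_sum[OF lin] linear_cmul[OF lin])
    also have "\<dots> = (\<chi> i. partial_deriv f i x) \<bullet> h"
      by (simp add: p inner_vec_def mult.commute)
    finally show ?thesis .
  qed
  then have "f' = (\<lambda>h. (\<chi> i. partial_deriv f i x) \<bullet> h)" by (rule ext)
  then show ?thesis using f' by simp
qed

lemma C1_on_gradient:
  assumes "C1_on S f" "open S" "x \<in> S"
  shows "(f has_derivative (\<lambda>h. (\<chi> i. partial_deriv f i x) \<bullet> h)) (at x)"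
proof (rule partial_gradient)
  have "f differentiable (at x within S)" using assms unfolding C1_on_def differentiable_on_def by blast
  then show "f differentiable (at x)" by (simp add: at_within_open[OF assms(3,2)])
qed

lemma vec_has_derivative:
  fixes f :: "'b::real_normed_vector \<Rightarrow> real^'n"
  assumes "\<And>j. ((\<lambda>x. f x $ j) has_derivative (\<lambda>h. f' h $ j)) (at a within S)"
  shows "(f has_derivative f') (at a within S)"
proof (rule iffD2[OF has_derivative_componentwise_within], rule ballI)
  fix i :: "real^'n" assume "i \<in> Basis"
  then obtain j where "i = axis j 1" by (auto simp: Basis_vec_def)
  then show "((\<lambda>x. f x \<bullet> i) has_derivative (\<lambda>x. f' x \<bullet> i)) (at a within S)"
    using assms[of j] by (simp add: inner_axis)
qed

lemma C2_on_hessian: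
  assumes "C2_on S f" "open S" "x \<in> S"
  shows "((\<lambda>y. \<chi> i. partial_deriv f i y) has_derivative
    (\<lambda>h. \<chi> i. (\<chi> j. partial_deriv (partial_deriv f i) j x) \<bullet> h)) (at x)"
proof (rule vec_has_derivative)
  fix i
  have "C1_on S (partial_deriv f i)" using assms by (simp add: C2_on_def)
  from C1_on_gradient[OF this assms(2,3)]
  show "((\<lambda>y. (\<chi> i. partial_deriv f i y) $ i) has_derivative
    (\<lambda>h. (\<chi> i. (\<chi> j. partial_deriv (partial_deriv f i) j x) \<bullet> h) $ i)) (at x)"
    by simp
qed

text \<open>With \<open>P\<close> the orthogonal projection along \<open>E\<close>, the defining
  function is x \<bullet> E - \<gamma> (P x). As \<open>P\<close> is self-adjoint, the gradient is
  \<open>E\<close> minus the projection of the gradient of \<gamma>.\<close>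

lemma C2_graph_chart:
  fixes \<Omega> :: "(real^'n) set"
  assumes r: "r > 0" and E: "norm E = 1" and \<gamma>: "C2_on UNIV \<gamma>"
    and eq: "\<Omega> \<inter> ball p r = {x \<in> ball p r. \<gamma> (x - (x \<bullet> E) *\<^sub>R E) < x \<bullet> E}"
  shows "\<exists>\<Phi> \<Psi>. chart \<Omega> p r E \<Phi> \<Psi>"
proof -
  define P where "P x = x - (x \<bullet> E) *\<^sub>R E" for x :: "real^'n"
  define g where "g y = (\<chi> i. partial_deriv \<gamma> i y)" for y
  have EE: "E \<bullet> E = 1" using E by (simp add: norm_eq_1)
  have dP: "(P has_derivative P) (at x)" for x
    unfolding P_def by (auto intro!: derivative_eq_intros)
  have d\<gamma>: "(\<gamma> has_derivative (\<lambda>h. g y \<bullet> h)) (at y)" for y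
    unfolding g_def using C1_on_gradient[of UNIV \<gamma> y] \<gamma> by (simp add: C2_on_def)
  have dg: "g differentiable (at y)" for y
    unfolding g_def differentiable_def using C2_on_hessian[OF \<gamma>, of y] by auto
  have adj: "v \<bullet> P h = P v \<bullet> h" for v h
    unfolding P_def by (simp add: inner_diff_left inner_diff_right inner_commute)
  have "((\<lambda>x. x \<bullet> E - \<gamma> (P x)) has_derivative (\<lambda>h. (E - P (g (P x))) \<bullet> h)) (at x)" for x
  proof -
    have "((\<lambda>x. \<gamma> (P x)) has_derivative (\<lambda>h. g (P x) \<bullet> P h)) (at x)"
      by (rule has_derivative_compose[OF dP d\<gamma>])
    then show ?thesis
      by (auto intro!: derivative_eq_intros simp: adj inner_diff_left inner_commute[of E])
  qed
  moreover have "(\<lambda>x. E - P (g (P x))) differentiable (at x)" for x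
  proof -
    have "P differentiable (at y)" for y using dP differentiable_def by blast
    then have "(\<lambda>x. P (g (P x))) differentiable (at x)"
      using differentiable_chain_at[OF differentiable_chain_at[OF _ dg]] by (fastforce simp: o_def)
    then show ?thesis by simp
  qed
  moreover have "(x + s *\<^sub>R E) \<bullet> E - \<gamma> (P (x + s *\<^sub>R E)) = x \<bullet> E - \<gamma> (P x) + s" for x s
  proof -
    have "P (x + s *\<^sub>R E) = P x" unfolding P_def by (simp add: inner_add_left EE algebra_simps)
    then show ?thesis by (simp add: inner_add_left EE)
  qed
  ultimately have "chart \<Omega> p r E (\<lambda>x. x \<bullet> E - \<gamma> (P x)) (\<lambda>x. E - P (g (P x)))"
    unfolding chart_def using r eq by (simp add: P_def)
  then show ?thesis by blast
qed

text \<open>The tangential part \<tau> of \<open>v\<close> is itself the velocity of a frontier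
  curve, so \<open>v\<close> is orthogonal to it and \<tau> = 0. Hence \<open>v\<close> is plus or
  minus \<open>n\<close>, and the minus sign is excluded because that direction leaves the
  closure.\<close>

lemma inner_unit_normal_chart:
  assumes op: "open \<Omega>" and nv: "inner_unit_normal \<Omega> z v" and c: "chart \<Omega> p r E \<Phi> \<Psi>"
    and z: "z \<in> frontier \<Omega>" "z \<in> ball p r"
  shows "v = sgn (\<Psi> z)"
proof -
  define n where "n = sgn (\<Psi> z)"
  have nz: "\<Psi> z \<noteq> 0" using chart_grad_nz[OF c] .
  have n1: "norm n = 1" using nz by (simp add: n_def norm_sgn)
  then have nn: "n \<bullet> n = 1" by (simp add: norm_eq_1)
  have \<Phi>z: "\<Phi> z = 0" using chart_frontier[OF c op z(2)] z(1) by simp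
  have \<Psi>n: "\<Psi> z = norm (\<Psi> z) *\<^sub>R n" using nz by (simp add: n_def sgn_div_norm)
  define \<tau> where "\<tau> = v - (v \<bullet> n) *\<^sub>R n"
  have \<tau>n: "\<tau> \<bullet> n = 0" by (simp add: \<tau>_def inner_diff_left nn)
  then have "\<tau> \<bullet> \<Psi> z = 0" by (subst \<Psi>n) simp
  then obtain k where k: "\<forall>t. k t \<in> frontier \<Omega> \<inter> ball p r" "k (0::real) = z" "(k has_vector_derivative \<tau>) (at 0)"
    using chart_curve[OF c op z(2) \<Phi>z] by blast
  have "\<forall>c w. (\<forall>t::real. c t \<in> frontier \<Omega>) \<longrightarrow> c 0 = z \<longrightarrow> (c has_vector_derivative w) (at 0) \<longrightarrow> v \<bullet> w = 0"
    using nv unfolding inner_unit_normal_def by (elim conjE)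
  from this[rule_format, of k \<tau>] k have "v \<bullet> \<tau> = 0" by auto
  then have "\<tau> \<bullet> \<tau> = 0" using \<tau>n by (simp add: \<tau>_def inner_diff_left inner_diff_right inner_commute)
  then have vn: "v = (v \<bullet> n) *\<^sub>R n" by (simp add: \<tau>_def)
  have "norm v = 1" using nv by (simp add: inner_unit_normal_def)
  then have "\<bar>v \<bullet> n\<bar> = 1" using vn n1 by (metis mult.right_neutral norm_scaleR)
  moreover have "v \<bullet> n \<noteq> - 1"
  proof
    assume "v \<bullet> n = - 1"
    then have v: "v = - n" using vn by simp
    have "0 < n \<bullet> \<Psi> z" using nz by (subst \<Psi>n) (simp add: nn)
    then obtain d where d: "d > 0" "\<And>t. 0 < t \<Longrightarrow> t < d \<Longrightarrow> z + t *\<^sub>R (- n) \<notin> closure \<Omega>"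
      using chart_enter[OF c z(2) \<Phi>z] by blast
    obtain e where e: "e > 0" "\<And>t. 0 < t \<Longrightarrow> t < e \<Longrightarrow> z + t *\<^sub>R v \<in> \<Omega>"
      using nv unfolding inner_unit_normal_def by blast
    define t where "t = min d e / 2"
    have "0 < t" "t < d" "t < e" using d(1) e(1) by (auto simp: t_def)
    then show False using d(2)[of t] e(2)[of t] v closure_subset[of \<Omega>] by blast
  qed
  ultimately have "v \<bullet> n = 1" by linarith
  then show ?thesis using vn by (simp add: n_def)
qed

lemma smooth_domainI:
  fixes \<Omega> :: "(real^'n) set"
  assumes "open \<Omega>" "bounded \<Omega>" "C2_domain \<Omega>" "\<forall>x\<in>frontier \<Omega>. inner_unit_normal \<Omega> x (\<nu> x)"
  shows "smooth_domain \<Omega> \<nu>"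
proof
  fix p assume "p \<in> frontier \<Omega>"
  then obtain r E \<gamma> where "r > 0" "norm E = 1" "C2_on UNIV \<gamma>"
     "\<Omega> \<inter> ball p r = {x \<in> ball p r. \<gamma> (x - (x \<bullet> E) *\<^sub>R E) < x \<bullet> E}"
    using assms(3) unfolding C2_domain_def by blast
  from C2_graph_chart[OF this] show "\<exists>r E \<Phi> \<Psi>. chart \<Omega> p r E \<Phi> \<Psi>" by iprover
next
  fix p r E z and \<Phi> :: "real^'n \<Rightarrow> real" and \<Psi>
  assume c: "chart \<Omega> p r E \<Phi> \<Psi>" and z: "z \<in> frontier \<Omega>" "z \<in> ball p r"
  from inner_unit_normal_chart[OF assms(1) assms(4)[rule_format, OF z(1)] c z]
  show "\<nu> z = sgn (\<Psi> z)" .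
qed (use assms in auto)

lemma sum_Basis_vec:
  fixes f :: "real^'n \<Rightarrow> 'b::comm_monoid_add"
  shows "(\<Sum>b\<in>Basis. f b) = (\<Sum>i\<in>UNIV. f (axis i (1::real)))"
proof -
  have B: "(Basis :: (real^'n) set) = range (\<lambda>i. axis i 1)" by (auto simp: Basis_vec_def)
  have I: "inj (\<lambda>i::'n. axis i (1::real))" by (auto simp: inj_on_def axis_eq_axis)
  show ?thesis unfolding B using sum.reindex[OF I, of f] by (simp add: o_def)
qed

text \<open>Derivatives are taken within the closure, which makes sense up to the frontier and
  ignores values outside. \<open>G\<close> and \<open>H\<close> stand for the continuous extensions
  of the gradient and the Hessian.\<close>

locale C2_function = smooth_domain \<Omega> \<nu> for \<Omega> :: "'a::euclidean_space set" and \<nu> +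
  fixes u :: "'a \<Rightarrow> real" and G :: "'a \<Rightarrow> 'a" and H :: "'a \<Rightarrow> 'a \<Rightarrow> 'a"
  assumes u_deriv: "x \<in> closure \<Omega> \<Longrightarrow> (u has_derivative (\<lambda>h. G x \<bullet> h)) (at x within closure \<Omega>)"
    and G_deriv: "x \<in> closure \<Omega> \<Longrightarrow> (G has_derivative H x) (at x within closure \<Omega>)"
    and H_cont: "continuous_on (closure \<Omega>) (\<lambda>x. H x v)"
    and H_sym: "x \<in> closure \<Omega> \<Longrightarrow> v \<bullet> H x w = w \<bullet> H x v"

text \<open>The hypothesis only says that partial derivatives extend continuously. Applying
  \<open>has_derivative_closure\<close> to \<open>u\<close> and to every extended first derivative
  makes the extensions genuine derivatives at the frontier; symmetry of the Hessian passes to the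
  closure by continuity.\<close>

lemma C2_closure_C2_function:
  fixes \<Omega> :: "(real^'n) set"
  assumes dom: "smooth_domain \<Omega> \<nu>" and u: "C2_closure \<Omega> u"
  obtains G H where "C2_function \<Omega> \<nu> u G H" "\<And>x. x \<in> \<Omega> \<Longrightarrow> (\<Sum>b\<in>Basis. b \<bullet> H x b) = laplacian u x"
proof -
  interpret smooth_domain \<Omega> \<nu> by (rule dom)
  have "\<forall>i. \<exists>g. continuous_on (closure \<Omega>) g \<and> (\<forall>x\<in>\<Omega>. g x = partial_deriv u i x)"
    using u unfolding C2_closure_def extends_continuously_def by blast
  then obtain g where g: "\<And>i. continuous_on (closure \<Omega>) (g i)" "\<And>i x. x \<in> \<Omega> \<Longrightarrow> g i x = partial_deriv u i x"
    by metis
  have "\<forall>i j. \<exists>k. continuous_on (closure \<Omega>) k \<and> (\<forall>x\<in>\<Omega>. k x = partial_deriv (partial_deriv u i) j x)"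
    using u unfolding C2_closure_def extends_continuously_def by blast
  then obtain k where k: "\<And>i j. continuous_on (closure \<Omega>) (k i j)"
      "\<And>i j x. x \<in> \<Omega> \<Longrightarrow> k i j x = partial_deriv (partial_deriv u i) j x"
    by metis
  define G where "G x = (\<chi> i. g i x)" for x
  define H where "H x h = (\<chi> i. (\<chi> j. k i j x) \<bullet> h)" for x h
  have C2: "C2_on \<Omega> u" and cu: "continuous_on (closure \<Omega>) u" using u by (auto simp: C2_closure_def)
  have du: "(u has_derivative (\<lambda>h. G x \<bullet> h)) (at x)" if "x \<in> \<Omega>" for x
    using C1_on_gradient[of \<Omega> u x] C2 open_dom that g(2) by (simp add: C2_on_def G_def)
  have cG: "continuous_on (closure \<Omega>) G" unfolding G_def by (intro continuous_intros g)
  have dg: "(g i has_derivative (\<lambda>h. (\<chi> j. k i j x) \<bullet> h)) (at x)" if x: "x \<in> \<Omega>" for x i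
  proof (rule has_derivative_transform_within_open[OF _ open_dom x])
    show "(partial_deriv u i has_derivative (\<lambda>h. (\<chi> j. k i j x) \<bullet> h)) (at x)"
      using C1_on_gradient[of \<Omega> "partial_deriv u i" x] C2 open_dom x k(2) by (simp add: C2_on_def)
  qed (use g(2) in auto)
  have dgc: "(g i has_derivative (\<lambda>h. (\<chi> j. k i j x) \<bullet> h)) (at x within closure \<Omega>)" if x: "x \<in> closure \<Omega>" for x i
    by (rule has_derivative_closure[where f = "g i" and g = "\<lambda>x. \<chi> j. k i j x", OF g(1) dg _ x])
       (auto intro!: continuous_intros k)
  have dG: "(G has_derivative H x) (at x within closure \<Omega>)" if x: "x \<in> closure \<Omega>" for x
    by (rule vec_has_derivative) (use dgc[OF x] in \<open>simp add: G_def H_def\<close>)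
  have cH: "continuous_on (closure \<Omega>) (\<lambda>x. H x v)" for v
    unfolding H_def by (intro continuous_intros k)
  have sym: "v \<bullet> H x w = w \<bullet> H x v" if x: "x \<in> \<Omega>" for x v w
  proof (rule symmetric_second_derivative[OF open_dom x du])
    have "at x within closure \<Omega> = at x"
      using x open_dom closure_subset[of \<Omega>] by (intro at_within_interior) (auto intro: interiorI)
    then show "(G has_derivative H x) (at x)" using dG[of x] x closure_subset[of \<Omega>] by auto
  qed
  have symc: "v \<bullet> H x w = w \<bullet> H x v" if x: "x \<in> closure \<Omega>" for x v w
  proof -
    have "v \<bullet> H x w - w \<bullet> H x v = 0"
      by (rule continuous_constant_on_closure[OF _ _ x, where f = "\<lambda>x. v \<bullet> H x w - w \<bullet> H x v"])
         (use sym in \<open>auto intro!: continuous_intros cH\<close>)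
    then show ?thesis by simp
  qed
  have "C2_function \<Omega> \<nu> u G H"
    by unfold_locales (use has_derivative_closure[OF cu du cG] dG cH symc in auto)
  moreover have "(\<Sum>b\<in>Basis. b \<bullet> H x b) = laplacian u x" if x: "x \<in> \<Omega>" for x
    unfolding sum_Basis_vec laplacian_def
    by (rule sum.cong) (use x k(2) in \<open>auto simp: H_def inner_axis' inner_axis\<close>)
  ultimately show ?thesis using that by blast
qed

section \<open>Reflections and the comparison function\<close>

lemma one_sided_deriv_ge:
  assumes d: "(\<psi> has_real_derivative D) (at 0 within {0..})" and z: "\<psi> 0 = 0" and \<delta>: "0 < (\<delta>::real)"
    and low: "\<And>t. 0 < t \<Longrightarrow> t < \<delta> \<Longrightarrow> k * t \<le> \<psi> t"
  shows "k \<le> D"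
proof -
  have "((\<lambda>t. \<psi> t / t) \<longlongrightarrow> D) (at_right 0)"
    using d z by (simp add: has_field_derivative_iff at_within_Ici_at_right)
  moreover have "\<forall>\<^sub>F t in at_right 0. k \<le> \<psi> t / t"
    unfolding eventually_at_right_field
    using \<delta> low by (intro exI[of _ \<delta>]) (auto simp: field_simps)
  ultimately show ?thesis by (rule tendsto_lowerbound) simp
qed

lemma second_dir_transform:
  assumes "second_dir v x d D" and ev: "\<forall>\<^sub>F y in nhds x. v y = w y"
  shows "second_dir w x d D"
proof -
  obtain v' where v: "\<forall>\<^sub>F t in nhds 0. ((\<lambda>t. v (x + t *\<^sub>R d)) has_real_derivative v' t) (at t)"
      "(v' has_real_derivative D) (at 0)"
    using assms(1) unfolding second_dir_def by blast
  have "((\<lambda>t::real. x + t *\<^sub>R d) \<longlongrightarrow> x + 0 *\<^sub>R d) (nhds 0)" by (intro tendsto_intros filterlim_ident)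
  then have "filterlim (\<lambda>t::real. x + t *\<^sub>R d) (nhds x) (nhds 0)" by simp
  from filterlim_iff[THEN iffD1, OF this, rule_format, OF ev]
  have "\<forall>\<^sub>F t in nhds 0. v (x + t *\<^sub>R d) = w (x + t *\<^sub>R d)" .
  then have "\<forall>\<^sub>F t in nhds 0. \<forall>\<^sub>F s in nhds t. v (x + s *\<^sub>R d) = w (x + s *\<^sub>R d)"
    by (simp only: eventually_eventually)
  with v(1) have "\<forall>\<^sub>F t in nhds 0. ((\<lambda>t. w (x + t *\<^sub>R d)) has_real_derivative v' t) (at t)"
  proof eventually_elim
    case (elim t)
    show ?case using DERIV_cong_ev[OF refl elim(2) refl] elim(1) by blast
  qed
  with v(2) show ?thesis unfolding second_dir_def by (intro exI[of _ v'] conjI)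
qed

lemma supersol_cong:
  fixes w :: "'a::euclidean_space \<Rightarrow> real"
  assumes D: "open D" and v: "supersol D L v" and eq: "\<And>x. x \<in> D \<Longrightarrow> v x = w x"
  shows "supersol D L w"
  unfolding supersol_def
proof (intro ballI)
  fix x assume x: "x \<in> D"
  obtain v' where v': "(v has_derivative v') (at x)"
    using v x unfolding supersol_def differentiable_def by blast
  obtain D2 where D2: "\<forall>b\<in>Basis. second_dir v x b (D2 b)" "(\<Sum>b\<in>Basis. D2 b) \<le> L * v x"
    using v x unfolding supersol_def by blast
  have ev: "\<forall>\<^sub>F y in nhds x. v y = w y"
    using eventually_nhds_in_open[OF D x] by eventually_elim (rule eq)
  have "(w has_derivative v') (at x)"
    by (rule has_derivative_transform_within_open[OF v' D x eq])
  moreover have "0 \<le> w x" using v x eq[OF x] unfolding supersol_def by auto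
  moreover have "\<forall>b\<in>Basis. second_dir w x b (D2 b)" using D2(1) second_dir_transform[OF _ ev] by blast
  ultimately show "w differentiable at x \<and> 0 \<le> w x \<and>
      (\<exists>D2. (\<forall>b\<in>Basis. second_dir w x b (D2 b)) \<and> sum D2 Basis \<le> L * w x)"
    using D2(2) eq[OF x] unfolding differentiable_def by auto
qed

section \<open>Reflections in hyperplanes\<close>

definition mirror :: "'a::real_inner \<Rightarrow> real \<Rightarrow> 'a \<Rightarrow> 'a" where
  "mirror e l x = x + (2 * (l - x \<bullet> e)) *\<^sub>R e"

abbreviation mirror0 :: "'a::real_inner \<Rightarrow> 'a \<Rightarrow> 'a" where
  "mirror0 e \<equiv> mirror e 0"

lemma mirror_line: "mirror e l (x + t *\<^sub>R v) = mirror e l x + t *\<^sub>R mirror0 e v"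
  by (simp add: mirror_def inner_add_left algebra_simps)

lemma mirror_diff: "mirror e l x - mirror e l y = mirror0 e (x - y)"
  by (simp add: mirror_def inner_diff_left algebra_simps)

lemma mirror0_adjoint: "mirror0 e v \<bullet> w = v \<bullet> mirror0 e w"
  by (simp add: mirror_def inner_diff_left inner_diff_right inner_commute)

lemma mirror_fix: "x \<bullet> e = l \<Longrightarrow> mirror e l x = x"
  by (simp add: mirror_def)

lemma continuous_mirror: "continuous_on S (mirror e l)"
  unfolding mirror_def by (intro continuous_intros)

context
  fixes e :: "'a::real_inner"
  assumes e: "norm e = 1"
begin

lemma unit_inner: "e \<bullet> e = 1"
  using e by (simp add: norm_eq_1)

lemma mirror_inner: "mirror e l x \<bullet> e = 2 * l - x \<bullet> e"
  by (simp add: mirror_def inner_add_left unit_inner)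

lemma mirror_mirror: "mirror e l (mirror e l x) = x"
  unfolding mirror_def[of e l "mirror e l x"] mirror_inner by (simp add: mirror_def scaleR_left_distrib[symmetric])

lemma norm_mirror0: "norm (mirror0 e v) = norm v"
proof -
  have "mirror0 e v \<bullet> mirror0 e v = v \<bullet> v" unfolding mirror0_adjoint mirror_mirror ..
  then show ?thesis by (simp add: norm_eq_sqrt_inner)
qed

lemma dist_mirror: "dist (mirror e l x) (mirror e l y) = dist x y"
  unfolding dist_norm mirror_diff norm_mirror0 ..

end

text \<open>Invariance of the trace under an orthogonal change of basis, i.e. of the Laplacian under
  reflections. As the reflection is the identity plus a rank one map, it is enough to
  expand.\<close>

lemma trace_mirror:
  fixes e :: "'a::euclidean_space"
  assumes e: "norm e = 1" and A: "linear A"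
  shows "(\<Sum>b\<in>Basis. mirror0 e b \<bullet> A (mirror0 e b)) = (\<Sum>b\<in>Basis. b \<bullet> A b)"
proof -
  have expand: "mirror0 e b \<bullet> A (mirror0 e b) = b \<bullet> A b - 2 * ((e \<bullet> b) * (A e \<bullet> b))
      - 2 * (e \<bullet> A ((e \<bullet> b) *\<^sub>R b)) + 4 * ((e \<bullet> b) * (e \<bullet> b)) * (e \<bullet> A e)" for b
    by (simp add: mirror_def linear_add[OF A] linear_cmul[OF A] linear_diff[OF A] inner_add_left inner_add_right
        inner_diff_left inner_diff_right inner_commute algebra_simps)
  have s1: "(\<Sum>b\<in>Basis. (e \<bullet> b) * (A e \<bullet> b)) = e \<bullet> A e" by (rule euclidean_inner[symmetric])
  have s2: "(\<Sum>b\<in>Basis. e \<bullet> A ((e \<bullet> b) *\<^sub>R b)) = e \<bullet> A e"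
    unfolding inner_sum_right[symmetric] linear_sum[OF A, symmetric] euclidean_representation ..
  have s3: "(\<Sum>b\<in>Basis. (e \<bullet> b) * (e \<bullet> b)) = 1"
    using euclidean_inner[of e e] e by (simp add: norm_eq_1)
  show ?thesis
    unfolding expand sum.distrib sum_subtractf sum_distrib_left[symmetric] sum_distrib_right[symmetric] s1 s2 s3
    by simp
qed

section \<open>Derivatives along rays and frontier curves, up to the boundary\<close>

context C2_function
begin

lemma at_closure: "x \<in> \<Omega> \<Longrightarrow> at x within closure \<Omega> = at x"
  using open_dom closure_subset[of \<Omega>] by (intro at_within_interior) (auto intro: interiorI)

lemma in_closure: "x \<in> \<Omega> \<Longrightarrow> x \<in> closure \<Omega>"
  using closure_subset by blast

lemma u_at: "x \<in> \<Omega> \<Longrightarrow> (u has_derivative (\<lambda>h. G x \<bullet> h)) (at x)"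
  using u_deriv[OF in_closure] at_closure by simp

lemma G_at: "x \<in> \<Omega> \<Longrightarrow> (G has_derivative H x) (at x)"
  using G_deriv[OF in_closure] at_closure by simp

lemma H_linear: "x \<in> closure \<Omega> \<Longrightarrow> linear (H x)"
  using G_deriv has_derivative_linear by blast

lemma u_cont: "continuous_on (closure \<Omega>) u"
  unfolding continuous_on_eq_continuous_within using u_deriv has_derivative_continuous by blast

lemma G_cont: "continuous_on (closure \<Omega>) G"
  unfolding continuous_on_eq_continuous_within using G_deriv has_derivative_continuous by blast

lemma u_line: "x + t *\<^sub>R v \<in> \<Omega> \<Longrightarrow> ((\<lambda>t. u (x + t *\<^sub>R v)) has_real_derivative G (x + t *\<^sub>R v) \<bullet> v) (at t)"
  by (rule has_derivative_line[OF u_at])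

lemma G_line:
  assumes "x + t *\<^sub>R v \<in> \<Omega>"
  shows "((\<lambda>t. G (x + t *\<^sub>R v) \<bullet> w) has_real_derivative H (x + t *\<^sub>R v) v \<bullet> w) (at t)"
proof -
  have "((\<lambda>y. G y \<bullet> w) has_derivative (\<lambda>h. H (x + t *\<^sub>R v) h \<bullet> w)) (at (x + t *\<^sub>R v))"
    using G_at[OF assms] by (auto intro!: derivative_eq_intros)
  from has_derivative_line[OF this] show ?thesis .
qed

lemma near_line: "x \<in> \<Omega> \<Longrightarrow> \<forall>\<^sub>F t in nhds 0. x + t *\<^sub>R v \<in> \<Omega>"
proof -
  assume x: "x \<in> \<Omega>"
  have "((\<lambda>t::real. x + t *\<^sub>R v) \<longlongrightarrow> x + 0 *\<^sub>R v) (nhds 0)" by (intro tendsto_intros filterlim_ident)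
  then show ?thesis by (rule topological_tendstoD) (use open_dom x in auto)
qed

lemma second_dir_u:
  assumes x: "x \<in> \<Omega>"
  shows "second_dir u x v (v \<bullet> H x v)"
proof -
  have "\<forall>\<^sub>F t in nhds 0. ((\<lambda>t. u (x + t *\<^sub>R v)) has_real_derivative G (x + t *\<^sub>R v) \<bullet> v) (at t)"
    using near_line[OF x] by eventually_elim (rule u_line)
  moreover have "((\<lambda>t. G (x + t *\<^sub>R v) \<bullet> v) has_real_derivative v \<bullet> H x v) (at 0)"
    using G_line[of x 0 v v] x by (simp add: inner_commute)
  ultimately show ?thesis unfolding second_dir_def by (intro exI[of _ "\<lambda>t. G (x + t *\<^sub>R v) \<bullet> v"] conjI)
qed

text \<open>The ray may leave the closure later; a one-sided derivative at 0 sees only its initial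
  part.\<close>

lemma ray_deriv:
  assumes \<delta>: "0 < \<delta>" and ray: "\<And>t. 0 \<le> t \<Longrightarrow> t < \<delta> \<Longrightarrow> p + t *\<^sub>R v \<in> closure \<Omega>"
  shows "((\<lambda>t. u (p + t *\<^sub>R v)) has_real_derivative G p \<bullet> v) (at 0 within {0..})"
proof -
  have p: "p \<in> closure \<Omega>" using ray[of 0] \<delta> by simp
  have "((\<lambda>t. p + t *\<^sub>R v) has_derivative (\<lambda>s. s *\<^sub>R v)) (at 0 within {0..<\<delta>})"
    by (auto intro!: derivative_eq_intros)
  moreover have "(u has_derivative (\<lambda>h. G p \<bullet> h)) (at (p + 0 *\<^sub>R v) within (\<lambda>t. p + t *\<^sub>R v) ` {0..<\<delta>})"
    using has_derivative_subset[OF u_deriv[OF p]] ray by (simp add: image_subset_iff)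
  ultimately have "((\<lambda>t. u (p + t *\<^sub>R v)) has_derivative (\<lambda>s. G p \<bullet> (s *\<^sub>R v))) (at 0 within {0..<\<delta>})"
    by (rule has_derivative_in_compose)
  then have "((\<lambda>t. u (p + t *\<^sub>R v)) has_real_derivative G p \<bullet> v) (at 0 within {0..<\<delta>})"
    by (rule has_derivative_imp_has_field_derivative) simp
  moreover have "at 0 within {0..<\<delta>} = at 0 within {0..}"
    by (rule at_within_nhd[of _ "{- \<delta><..<\<delta>}"]) (use \<delta> in auto)
  ultimately show ?thesis by simp
qed

lemma normal_ray:
  assumes p: "p \<in> frontier \<Omega>" and v: "0 < v \<bullet> \<nu> p"
  obtains \<delta> where "0 < \<delta>" "\<And>t. 0 < t \<Longrightarrow> t < \<delta> \<Longrightarrow> p + t *\<^sub>R v \<in> \<Omega>"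
    "\<And>t. 0 \<le> t \<Longrightarrow> t < \<delta> \<Longrightarrow> p + t *\<^sub>R v \<in> closure \<Omega>"
proof -
  obtain \<delta> where \<delta>: "0 < \<delta>" "\<And>t. 0 < t \<Longrightarrow> t < \<delta> \<Longrightarrow> p + t *\<^sub>R v \<in> \<Omega>"
    using normal_enter[OF p v] by blast
  have "p + t *\<^sub>R v \<in> closure \<Omega>" if "0 \<le> t" "t < \<delta>" for t
    using \<delta>(2)[of t] that in_closure frontier_closure[OF p] by (cases "t = 0") auto
  then show ?thesis using that \<delta> by blast
qed

lemma inward_deriv_eq:
  assumes p: "p \<in> frontier \<Omega>"
  shows "vector_derivative (\<lambda>t. u (p + t *\<^sub>R \<nu> p)) (at 0 within {0..}) = G p \<bullet> \<nu> p"
proof -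
  have "0 < \<nu> p \<bullet> \<nu> p" using normal_unit[OF p] by (simp add: norm_eq_1)
  then obtain \<delta> where \<delta>: "0 < \<delta>" "\<And>t. 0 \<le> t \<Longrightarrow> t < \<delta> \<Longrightarrow> p + t *\<^sub>R \<nu> p \<in> closure \<Omega>"
    using normal_ray[OF p] by metis
  show ?thesis
  proof (rule vector_derivative_within)
    show "at 0 within {0::real..} \<noteq> bot" by (simp add: at_within_Ici_at_right)
    show "((\<lambda>t. u (p + t *\<^sub>R \<nu> p)) has_vector_derivative G p \<bullet> \<nu> p) (at 0 within {0..})"
      using ray_deriv[OF \<delta>] by (simp add: has_real_derivative_iff_has_vector_derivative)
  qed
qed

lemma G_curve:
  assumes c: "\<And>t. c t \<in> closure \<Omega>" and dc: "(c has_vector_derivative \<tau>) (at (0::real))"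
  shows "((\<lambda>t. G (c t)) has_vector_derivative H (c 0) \<tau>) (at 0)"
    and "((\<lambda>t. u (c t)) has_real_derivative G (c 0) \<bullet> \<tau>) (at 0)"
proof -
  have "(G has_derivative H (c 0)) (at (c 0) within c ` UNIV)"
    using has_derivative_subset[OF G_deriv[OF c]] c by blast
  from vector_derivative_diff_chain_within[OF dc this]
  show "((\<lambda>t. G (c t)) has_vector_derivative H (c 0) \<tau>) (at 0)" by (simp add: o_def)
  have "(u has_derivative (\<lambda>h. G (c 0) \<bullet> h)) (at (c 0) within c ` UNIV)"
    using has_derivative_subset[OF u_deriv[OF c]] c by blast
  from vector_derivative_diff_chain_within[OF dc this]
  show "((\<lambda>t. u (c t)) has_real_derivative G (c 0) \<bullet> \<tau>) (at 0)"
    by (simp add: o_def has_real_derivative_iff_has_vector_derivative)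
qed

text \<open>The mean value theorem is applied to \<open>u\<close> minus its quadratic polynomial
  along the ray; the derivative of this difference is the first order remainder of \<open>G\<close>
  paired with \<open>v\<close>. That pairing and the length of the step each contribute a factor
  |v|, which \<open>N\<close> absorbs.\<close>

lemma boundary_taylor:
  assumes p: "p \<in> frontier \<Omega>" and v: "0 < v \<bullet> \<nu> p" and \<epsilon>: "0 < \<epsilon>"
  shows "\<exists>\<delta>>0. \<forall>t. 0 < t \<and> t < \<delta> \<longrightarrow>
    \<bar>u (p + t *\<^sub>R v) - u p - t * (G p \<bullet> v) - t\<^sup>2 / 2 * (v \<bullet> H p v)\<bar> \<le> \<epsilon> * t\<^sup>2"
proof -
  have pc: "p \<in> closure \<Omega>" using p frontier_closure by blast
  obtain \<delta>1 where \<delta>1: "0 < \<delta>1" "\<And>t. 0 < t \<Longrightarrow> t < \<delta>1 \<Longrightarrow> p + t *\<^sub>R v \<in> \<Omega>"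
      "\<And>t. 0 \<le> t \<Longrightarrow> t < \<delta>1 \<Longrightarrow> p + t *\<^sub>R v \<in> closure \<Omega>"
    using normal_ray[OF p v] by blast
  define N where "N = norm v * norm v + 1"
  have N: "N > 0" by (simp add: N_def add_nonneg_pos)
  obtain d where d: "d > 0" "\<And>y. y \<in> closure \<Omega> \<Longrightarrow> norm (y - p) < d \<Longrightarrow>
      norm (G y - G p - H p (y - p)) \<le> \<epsilon> / N * norm (y - p)"
    using conjunct2[OF G_deriv[OF pc, unfolded has_derivative_within_alt], rule_format, of "\<epsilon> / N"] \<epsilon> N by auto
  define \<delta> where "\<delta> = min \<delta>1 (d / (norm v + 1))"
  have nv: "norm v + 1 > 0" by (simp add: add_nonneg_pos)
  have \<delta>: "\<delta> > 0" using \<delta>1 d nv by (simp add: \<delta>_def)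
  interpret Hp: linear "H p" by (rule H_linear[OF pc])
  show ?thesis
  proof (intro exI[of _ \<delta>] conjI allI impI \<delta>)
    fix t assume t: "0 < t \<and> t < \<delta>"
    define \<phi> where "\<phi> s = u (p + s *\<^sub>R v) - s * (G p \<bullet> v) - s\<^sup>2 / 2 * (v \<bullet> H p v)" for s
    have der: "(\<phi> has_real_derivative ((G (p + s *\<^sub>R v) - G p - H p (s *\<^sub>R v)) \<bullet> v)) (at s)" if s: "0 < s" "s < t" for s
    proof -
      have "p + s *\<^sub>R v \<in> \<Omega>" using \<delta>1(2)[of s] s t by (simp add: \<delta>_def)
      from u_line[OF this] show ?thesis
        unfolding \<phi>_def
        by (auto intro!: derivative_eq_intros simp: inner_diff_left inner_diff_right Hp.scale inner_commute)
    qed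
    have "continuous_on {0..t} \<phi>"
      unfolding \<phi>_def
      by (intro continuous_intros continuous_on_compose2[OF u_cont]) (use \<delta>1(3) t in \<open>auto simp: \<delta>_def\<close>)
    then obtain s where s: "0 < s" "s < t" "\<phi> t - \<phi> 0 = ((G (p + s *\<^sub>R v) - G p - H p (s *\<^sub>R v)) \<bullet> v) * (t - 0)"
      using mvt[of 0 t \<phi> "\<lambda>s h. ((G (p + s *\<^sub>R v) - G p - H p (s *\<^sub>R v)) \<bullet> v) * h"]
        der[unfolded has_field_derivative_def] t by blast
    have small: "norm (s *\<^sub>R v) < d"
    proof -
      have "norm (s *\<^sub>R v) \<le> s * (norm v + 1)" using s by (simp add: algebra_simps)
      also have "\<dots> < \<delta> * (norm v + 1)" using s t nv by (intro mult_strict_right_mono) auto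
      also have "\<dots> \<le> d / (norm v + 1) * (norm v + 1)" using nv by (intro mult_right_mono) (auto simp: \<delta>_def)
      finally show ?thesis using nv by simp
    qed
    have "norm (G (p + s *\<^sub>R v) - G p - H p (s *\<^sub>R v)) \<le> \<epsilon> / N * norm (s *\<^sub>R v)"
      using d(2)[of "p + s *\<^sub>R v"] small \<delta>1(3)[of s] s t by (simp add: \<delta>_def)
    also have "\<dots> \<le> \<epsilon> / N * (t * norm v)" using s \<epsilon> N by (intro mult_left_mono) (auto intro: mult_right_mono)
    finally have 1: "norm (G (p + s *\<^sub>R v) - G p - H p (s *\<^sub>R v)) \<le> \<epsilon> / N * (t * norm v)" .
    have "\<bar>\<phi> t - \<phi> 0\<bar> = t * \<bar>(G (p + s *\<^sub>R v) - G p - H p (s *\<^sub>R v)) \<bullet> v\<bar>" using s t by (simp add: abs_mult)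
    also have "\<dots> \<le> t * (norm (G (p + s *\<^sub>R v) - G p - H p (s *\<^sub>R v)) * norm v)"
      using t Cauchy_Schwarz_ineq2 by (intro mult_left_mono) auto
    also have "\<dots> \<le> t * ((\<epsilon> / N * (t * norm v)) * norm v)"
      using t 1 by (intro mult_left_mono mult_right_mono) auto
    also have "\<dots> = \<epsilon> / N * t\<^sup>2 * (norm v * norm v)" by (simp add: power2_eq_square)
    also have "\<dots> \<le> \<epsilon> / N * t\<^sup>2 * N" using \<epsilon> N by (intro mult_left_mono) (auto simp: N_def)
    also have "\<dots> = \<epsilon> * t\<^sup>2" using N by simp
    finally show "\<bar>u (p + t *\<^sub>R v) - u p - t * (G p \<bullet> v) - t\<^sup>2 / 2 * (v \<bullet> H p v)\<bar> \<le> \<epsilon> * t\<^sup>2"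
      by (simp add: \<phi>_def algebra_simps)
  qed
qed

text \<open>Used with \<open>k = 0\<close> for mere strict decrease and with positive
  \<open>k\<close> for a bound linear in the step.\<close>

lemma decrease_along:
  assumes s: "0 < s" and seg: "\<And>r. 0 \<le> r \<Longrightarrow> r \<le> s \<Longrightarrow> x - r *\<^sub>R e \<in> \<Omega>"
    and neg: "\<And>r. 0 \<le> r \<Longrightarrow> r \<le> s \<Longrightarrow> G (x - r *\<^sub>R e) \<bullet> e < - k"
  shows "u x + k * s < u (x - s *\<^sub>R e)"
proof -
  have der: "((\<lambda>t. u (x + t *\<^sub>R (- e))) has_real_derivative G (x + t *\<^sub>R (- e)) \<bullet> (- e)) (at t)"
    if "0 \<le> t" "t \<le> s" for t
    by (rule u_line) (use seg[of t] that in simp)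
  have "\<exists>z>0. z < s \<and> u (x + s *\<^sub>R (- e)) - u (x + 0 *\<^sub>R (- e)) = (s - 0) * (G (x + z *\<^sub>R (- e)) \<bullet> (- e))"
    by (rule MVT2) (use s der in auto)
  then obtain z where z: "0 < z" "z < s" "u (x - s *\<^sub>R e) - u x = s * - (G (x - z *\<^sub>R e) \<bullet> e)" by auto
  have "k < - (G (x - z *\<^sub>R e) \<bullet> e)" using neg[of z] z by simp
  then have "s * k < s * - (G (x - z *\<^sub>R e) \<bullet> e)" using s by (intro mult_strict_left_mono) auto
  then show ?thesis using z(3) by (simp add: mult.commute)
qed

end

section \<open>Solutions of the Dirichlet problem, extended by zero and compared with their
  reflections\<close>

locale dirichlet_solution = C2_function \<Omega> \<nu> u G H
  for \<Omega> :: "'a::euclidean_space set" and \<nu> u G H +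
  fixes f g h :: "real \<Rightarrow> real"
  assumes conn: "connected \<Omega>"
    and u_pos: "x \<in> \<Omega> \<Longrightarrow> 0 < u x"
    and u_zero: "x \<in> frontier \<Omega> \<Longrightarrow> u x = 0"
    and pde: "x \<in> \<Omega> \<Longrightarrow> (\<Sum>b\<in>Basis. b \<bullet> H x b) = - f (u x)"
    and split: "f s = g s + h s"
    and lip: "locally_lipschitz g"
    and h_mono: "mono h"
begin

lemma u_nonneg: "x \<in> closure \<Omega> \<Longrightarrow> 0 \<le> u x"
  using closure_cases[of x] u_pos[of x] u_zero[of x] by fastforce

lemma G_tangent:
  assumes p: "p \<in> frontier \<Omega>" and \<tau>: "\<tau> \<bullet> \<nu> p = 0"
  shows "G p \<bullet> \<tau> = 0"
proof -
  obtain c where c: "\<And>t. c t \<in> frontier \<Omega>" "c (0::real) = p" "(c has_vector_derivative \<tau>) (at 0)"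
    using normal_curve[OF p \<tau>] by metis
  have "((\<lambda>t. u (c t)) has_real_derivative G (c 0) \<bullet> \<tau>) (at 0)"
    by (rule G_curve(2)[OF _ c(3)]) (use c(1) frontier_closure in blast)
  moreover have "(\<lambda>t. u (c t)) = (\<lambda>t. 0)" using c(1) u_zero by auto
  ultimately have "((\<lambda>t::real. 0::real) has_real_derivative G p \<bullet> \<tau>) (at 0)" using c(2) by simp
  then show ?thesis using DERIV_unique DERIV_const by metis
qed

lemma inner_normal_split:
  assumes p: "p \<in> frontier \<Omega>"
  shows "(v - (v \<bullet> \<nu> p) *\<^sub>R \<nu> p) \<bullet> \<nu> p = 0"
  using normal_unit[OF p] by (simp add: inner_diff_left norm_eq_1)

lemma G_normal:
  assumes p: "p \<in> frontier \<Omega>"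
  shows "G p \<bullet> v = (G p \<bullet> \<nu> p) * (v \<bullet> \<nu> p)"
  using G_tangent[OF p inner_normal_split[OF p, of v]] by (simp add: inner_diff_right mult.commute)

lemma G_normal_eq:
  assumes p: "p \<in> frontier \<Omega>"
  shows "G p = (G p \<bullet> \<nu> p) *\<^sub>R \<nu> p"
proof -
  have "(G p - (G p \<bullet> \<nu> p) *\<^sub>R \<nu> p) \<bullet> v = 0" for v
    using G_normal[OF p, of v] by (simp add: inner_diff_left inner_commute[of "\<nu> p" v])
  from this[of "G p - (G p \<bullet> \<nu> p) *\<^sub>R \<nu> p"] show ?thesis by simp
qed

lemma ray_nonneg:
  assumes p: "p \<in> frontier \<Omega>" and \<delta>: "0 < \<delta>" and ray: "\<And>t. 0 \<le> t \<Longrightarrow> t < \<delta> \<Longrightarrow> p + t *\<^sub>R v \<in> closure \<Omega>"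
  shows "0 \<le> G p \<bullet> v"
  by (rule one_sided_deriv_ge[OF ray_deriv[OF \<delta> ray] _ \<delta>, where k = 0]) (use u_zero[OF p] u_nonneg ray in auto)

lemma normal_deriv_nonneg:
  assumes p: "p \<in> frontier \<Omega>"
  shows "0 \<le> G p \<bullet> \<nu> p"
proof -
  have "0 < \<nu> p \<bullet> \<nu> p" using normal_unit[OF p] by (simp add: norm_eq_1)
  then obtain \<delta> where \<delta>: "0 < \<delta>" "\<And>t. 0 \<le> t \<Longrightarrow> t < \<delta> \<Longrightarrow> p + t *\<^sub>R \<nu> p \<in> closure \<Omega>"
    using normal_ray[OF p] by metis
  then show ?thesis using ray_nonneg[OF p] by blast
qed

text \<open>\<open>u\<close> maps the closure of \<Omega> to a compact set, on which a locally
  Lipschitz function is Lipschitz.\<close>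

lemma one_sided_lipschitz:
  obtains L where "0 \<le> L"
    "\<And>x y. x \<in> closure \<Omega> \<Longrightarrow> y \<in> closure \<Omega> \<Longrightarrow> g (u x) - g (u y) \<le> L * \<bar>u x - u y\<bar>"
proof -
  have "compact (closure \<Omega>)" using bounded_dom by (simp add: compact_closure)
  then have "compact (u ` closure \<Omega>)" using u_cont by (rule compact_continuous_image[rotated])
  have "local_lipschitz (UNIV :: real set) (UNIV :: real set) (\<lambda>_. g)"
    using lip by (simp add: locally_lipschitz_def)
  then have ll: "local_lipschitz {0::real} (u ` closure \<Omega>) (\<lambda>_. g)"
    by (rule local_lipschitz_subset) auto
  obtain L where L: "\<And>t. t \<in> {0::real} \<Longrightarrow> L-lipschitz_on (u ` closure \<Omega>) g"
    using local_lipschitz_compact_implies_lipschitz[OF ll \<open>compact (u ` closure \<Omega>)\<close>] by auto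
  then have L': "L-lipschitz_on (u ` closure \<Omega>) g" by simp
  show ?thesis
  proof (rule that[of L])
    show "0 \<le> L" using L' lipschitz_on_nonneg by blast
    fix x y assume "x \<in> closure \<Omega>" "y \<in> closure \<Omega>"
    then have "dist (g (u x)) (g (u y)) \<le> L * dist (u x) (u y)"
      using lipschitz_onD[OF L'] by blast
    then show "g (u x) - g (u y) \<le> L * \<bar>u x - u y\<bar>" by (simp add: dist_real_def)
  qed
qed

definition ubar :: "'a \<Rightarrow> real" where
  "ubar x = (if x \<in> \<Omega> then u x else 0)"

lemma ubar_in: "x \<in> \<Omega> \<Longrightarrow> ubar x = u x"
  by (simp add: ubar_def)

lemma ubar_out: "x \<notin> \<Omega> \<Longrightarrow> ubar x = 0"
  by (simp add: ubar_def)

lemma ubar_closure: "x \<in> closure \<Omega> \<Longrightarrow> ubar x = u x"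
  using closure_cases u_zero frontier_notin by (auto simp: ubar_def)

lemma ubar_pos: "0 < ubar x \<longleftrightarrow> x \<in> \<Omega>"
  using u_pos by (auto simp: ubar_def)

lemma ubar_nonneg: "0 \<le> ubar x"
  using u_pos by (auto simp: ubar_def less_imp_le)

lemma ubar_cont: "continuous_on S ubar"
proof -
  have "continuous_on (closure \<Omega> \<union> - \<Omega>) (\<lambda>x. if x \<in> \<Omega> then u x else 0)"
    by (rule continuous_on_cases)
       (use open_dom u_cont u_zero closure_cases in \<open>auto intro: continuous_on_const\<close>)
  moreover have "closure \<Omega> \<union> - \<Omega> = UNIV" using closure_subset[of \<Omega>] by blast
  ultimately show ?thesis unfolding ubar_def[abs_def] using continuous_on_subset by fastforce
qed

text \<open>For \<open>s = 2 (x \<bullet> e - \<mu>)\<close> with \<open>\<mu> \<ge> l\<close> the inequality reads \<open>ubar x \<le> ubar (mirror e \<mu> x)\<close>. It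
  says at once that the reflected caps stay in the domain, since \<open>ubar\<close> is positive exactly there.\<close>

definition mp :: "'a \<Rightarrow> real \<Rightarrow> bool" where
  "mp e l \<longleftrightarrow> (\<forall>x s. 0 \<le> s \<longrightarrow> l \<le> x \<bullet> e - s / 2 \<longrightarrow> ubar x \<le> ubar (x - s *\<^sub>R e))"

definition cap :: "'a \<Rightarrow> real \<Rightarrow> 'a set" where
  "cap e l = {x \<in> \<Omega>. l < x \<bullet> e}"

lemma cap_open: "open (cap e l)"
  unfolding cap_def Collect_conj_eq
  by (intro open_Int open_Collect_less continuous_intros) (simp add: open_dom)

definition w :: "'a \<Rightarrow> real \<Rightarrow> 'a \<Rightarrow> real" where
  "w e l x = ubar (mirror e l x) - ubar x"

lemma w_cont: "continuous_on S (w e l)"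
  unfolding w_def[abs_def]
  by (intro continuous_on_diff ubar_cont continuous_on_compose2[OF ubar_cont[of UNIV] continuous_mirror]) auto

context
  fixes e :: 'a and l :: real
  assumes e1: "norm e = 1" and mp: "mp e l"
begin

lemma w_nonneg: "l \<le> x \<bullet> e \<Longrightarrow> 0 \<le> w e l x"
proof -
  assume "l \<le> x \<bullet> e"
  then have "ubar x \<le> ubar (x - (2 * (x \<bullet> e - l)) *\<^sub>R e)"
    by (intro mp[unfolded mp_def, rule_format]) (simp_all add: field_simps)
  moreover have "x - (2 * (x \<bullet> e - l)) *\<^sub>R e = mirror e l x" by (simp add: mirror_def algebra_simps)
  ultimately show ?thesis by (simp add: w_def)
qed

lemma mirror_cap: "x \<in> cap e l \<Longrightarrow> mirror e l x \<in> \<Omega>"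
  using w_nonneg[of x] ubar_pos[of x] ubar_pos[of "mirror e l x"] by (auto simp: cap_def w_def)

lemma w_cap: "x \<in> cap e l \<Longrightarrow> w e l x = u (mirror e l x) - u x"
  using mirror_cap[of x] by (simp add: w_def ubar_in cap_def)

text \<open>The Laplacian of \<open>w\<close> is f (u x) - f (u (mirror e l x)). Since
  \<open>u\<close> at \<open>x\<close> does not exceed its value at the mirror image, the
  contribution of \<open>h\<close> is at most 0, and that of \<open>g\<close> is at most
  \<open>L\<close> times \<open>w\<close>.\<close>

lemma w_supersol: "\<exists>L\<ge>0. supersol (cap e l) L (w e l)"
proof -
  obtain L where L: "0 \<le> L" "\<And>x y. x \<in> closure \<Omega> \<Longrightarrow> y \<in> closure \<Omega> \<Longrightarrow> g (u x) - g (u y) \<le> L * \<bar>u x - u y\<bar>"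
    using one_sided_lipschitz by metis
  have "supersol (cap e l) L (\<lambda>x. u (mirror e l x) - u x)"
    unfolding supersol_def
  proof (intro ballI conjI)
    fix x assume x: "x \<in> cap e l"
    have xO: "x \<in> \<Omega>" and rO: "mirror e l x \<in> \<Omega>" using x mirror_cap by (auto simp: cap_def)
    have "(mirror e l has_derivative mirror0 e) (at x)"
      unfolding mirror_def[abs_def] by (auto intro!: derivative_eq_intros)
    from has_derivative_compose[OF this u_at[OF rO]]
    have "((\<lambda>x. u (mirror e l x)) has_derivative (\<lambda>h. G (mirror e l x) \<bullet> mirror0 e h)) (at x)" .
    then show "(\<lambda>x. u (mirror e l x) - u x) differentiable (at x)"
      using u_at[OF xO] by (auto simp: differentiable_def intro!: derivative_intros)
    show nn: "0 \<le> u (mirror e l x) - u x" using w_cap[OF x] w_nonneg[of x] x by (simp add: cap_def)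
    have s: "second_dir (\<lambda>x. u (mirror e l x) - u x) x b
        (mirror0 e b \<bullet> H (mirror e l x) (mirror0 e b) - b \<bullet> H x b)" for b
    proof (rule second_dir_diff[OF _ second_dir_u[OF xO]])
      \<comment> \<open>\<open>second_dir\<close> depends only on the restriction to a line, and
        reflection carries the line in direction \<open>b\<close> to a line in direction
        \<open>mirror0 e b\<close>.\<close>
      show "second_dir (\<lambda>x. u (mirror e l x)) x b (mirror0 e b \<bullet> H (mirror e l x) (mirror0 e b))"
        using second_dir_u[OF rO, of "mirror0 e b"] unfolding second_dir_def mirror_line .
    qed
    have tr: "(\<Sum>b\<in>Basis. mirror0 e b \<bullet> H (mirror e l x) (mirror0 e b)) = (\<Sum>b\<in>Basis. b \<bullet> H (mirror e l x) b)"
      by (rule trace_mirror[OF e1 H_linear[OF in_closure[OF rO]]])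
    have "(\<Sum>b\<in>Basis. mirror0 e b \<bullet> H (mirror e l x) (mirror0 e b) - b \<bullet> H x b) = f (u x) - f (u (mirror e l x))"
      unfolding sum_subtractf tr pde[OF xO] pde[OF rO] by simp
    also have "\<dots> \<le> L * (u (mirror e l x) - u x)"
    proof -
      have "h (u x) \<le> h (u (mirror e l x))" using nn by (intro monoD[OF h_mono]) simp
      moreover have "g (u x) - g (u (mirror e l x)) \<le> L * \<bar>u x - u (mirror e l x)\<bar>"
        using L(2) xO rO in_closure by blast
      ultimately show ?thesis using nn by (simp add: split)
    qed
    finally show "\<exists>D2. (\<forall>b\<in>Basis. second_dir (\<lambda>x. u (mirror e l x) - u x) x b (D2 b)) \<and>
        sum D2 Basis \<le> L * (u (mirror e l x) - u x)"
      using s by (intro exI[of _ "\<lambda>b. mirror0 e b \<bullet> H (mirror e l x) (mirror0 e b) - b \<bullet> H x b"]) auto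
  qed
  then have "supersol (cap e l) L (w e l)"
    by (rule supersol_cong[OF cap_open]) (simp add: w_cap)
  with L(1) show ?thesis by blast
qed

text \<open>The set of points with a symmetric neighbourhood is clopen in the domain; on the hyperplane
  the strong maximum principle is applied in a half ball.\<close>

lemma symmetric_of_touching:
  assumes x0: "x0 \<in> cap e l" "w e l x0 = 0" and x: "x \<in> \<Omega>"
  shows "mirror e l x \<in> \<Omega>"
proof -
  obtain L where L: "0 \<le> L" "supersol (cap e l) L (w e l)" using w_supersol by blast
  define S where "S = {z. ubar (mirror e l z) = ubar z}"
  have Sw: "z \<in> S \<longleftrightarrow> w e l z = 0" for z by (auto simp: S_def w_def)
  have Srefl: "mirror e l z \<in> S \<longleftrightarrow> z \<in> S" for z by (auto simp: S_def mirror_mirror[OF e1])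
  have "closed ({z \<in> UNIV. w e l z = 0})" by (rule continuous_closed_preimage_constant[OF w_cont]) simp
  moreover have "{z \<in> UNIV. w e l z = 0} = S" using Sw by blast
  ultimately have closedS: "closed S" by simp
  define W where "W = \<Omega> \<inter> interior S"
  have pos: "p \<in> interior S" if a: "p \<in> \<Omega>" "l < p \<bullet> e" "p \<in> S" for p
  proof -
    have "p \<in> cap e l" using a by (simp add: cap_def)
    then obtain r where "r > 0" "\<forall>x\<in>ball p r. w e l x = 0"
      using strong_max_local[OF cap_open L] a(3) Sw by blast
    then show ?thesis unfolding mem_interior using Sw by blast
  qed
  have int_refl: "p \<in> interior S" if rp: "mirror e l p \<in> interior S" for p
  proof -
    obtain r where r: "r > 0" "ball (mirror e l p) r \<subseteq> S" using rp unfolding mem_interior by blast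
    have "ball p r \<subseteq> S"
    proof
      fix y assume "y \<in> ball p r"
      then have "mirror e l y \<in> S" using r(2) dist_mirror[OF e1, of l p y] by auto
      then show "y \<in> S" using Srefl by simp
    qed
    then show ?thesis unfolding mem_interior using r(1) by blast
  qed
  have step: "p \<in> interior S" if p: "p \<in> \<Omega>" "p \<in> closure W" for p
  proof -
    have pS: "p \<in> S"
      using p(2) closure_minimal[OF _ closedS, of W] interior_subset[of S] by (auto simp: W_def)
    consider "l < p \<bullet> e" | "p \<bullet> e < l" | "p \<bullet> e = l" by linarith
    then show ?thesis
    proof cases
      case 1
      then show ?thesis using pos p pS by blast
    next
      case 2
      have "ubar (mirror e l p) > 0" using pS p(1) ubar_pos[of p] by (simp add: S_def)
      then have "mirror e l p \<in> \<Omega>" by (simp add: ubar_pos)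
      moreover have "l < mirror e l p \<bullet> e" using 2 by (simp add: mirror_inner[OF e1])
      ultimately have "mirror e l p \<in> interior S" using pos Srefl pS by blast
      then show ?thesis by (rule int_refl)
    next
      case 3
      obtain r where r: "r > 0" "ball p r \<subseteq> \<Omega>" using open_dom p(1) by (auto simp: open_contains_ball)
      have rball: "mirror e l y \<in> ball p r" if "y \<in> ball p r" for y
        using dist_mirror[OF e1, of l p y] mirror_fix[OF 3] that by simp
      obtain y where y: "y \<in> W" "y \<in> ball p r"
        using p(2) r(1) unfolding closure_approachable by (auto simp: dist_commute)
      have "open (ball p r \<inter> interior S)" by auto
      then obtain s where s: "s > 0" "ball y s \<subseteq> ball p r \<inter> interior S"
        using y unfolding open_contains_ball W_def by blast
      \<comment> \<open>On the hyperplane membership in \<open>S\<close> is trivial and carries no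
        information, so the point is pushed off it within the ball where it is genuine, and then
        reflected if necessary to the side of the cap.\<close>
      define y1 where "y1 = (if y \<bullet> e = l then y + (s/2) *\<^sub>R e else y)"
      have y1: "y1 \<in> ball p r" "y1 \<in> S" "y1 \<bullet> e \<noteq> l"
      proof -
        have "y1 \<in> ball y s" using s(1) e1 by (simp add: y1_def dist_norm)
        then show "y1 \<in> ball p r" "y1 \<in> S" using s(2) interior_subset[of S] by auto
        show "y1 \<bullet> e \<noteq> l" using s(1) by (simp add: y1_def inner_add_left unit_inner[OF e1])
      qed
      define y2 where "y2 = (if y1 \<bullet> e < l then mirror e l y1 else y1)"
      have y2: "y2 \<in> ball p r" "y2 \<in> S" "l < y2 \<bullet> e"
        using y1 rball[OF y1(1)] Srefl by (auto simp: y2_def mirror_inner[OF e1])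
      \<comment> \<open>The cap may be disconnected, but a half ball is convex, so the strong
        maximum principle spreads the zero at \<open>y2\<close> over all of it.\<close>
      define D where "D = ball p r \<inter> {x. l < e \<bullet> x}"
      have D: "open D" "convex D" unfolding D_def
        by (intro open_Int open_ball open_halfspace_gt) (intro convex_Int convex_ball convex_halfspace_gt)
      have Dcap: "D \<subseteq> cap e l" using r(2) by (auto simp: D_def cap_def inner_commute)
      have wD: "w e l z = 0" if "z \<in> D" for z
        by (rule strong_max[OF D(1) convex_connected[OF D(2)] L(1) supersol_subset[OF L(2) Dcap] _ _ that])
           (use y2 Sw in \<open>auto simp: D_def inner_commute\<close>)
      have "ball p r \<subseteq> S"
      proof
        fix z assume z: "z \<in> ball p r"
        consider "l < z \<bullet> e" | "z \<bullet> e < l" | "z \<bullet> e = l" by linarith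
        then show "z \<in> S"
        proof cases
          case 1
          then show ?thesis using wD[of z] z Sw by (simp add: D_def inner_commute)
        next
          case 2
          then have "mirror e l z \<in> D" using rball[OF z] mirror_inner[OF e1, of l z] by (simp add: D_def inner_commute)
          then show ?thesis using wD Sw Srefl by blast
        next
          case 3
          then show ?thesis by (simp add: S_def mirror_fix)
        qed
      qed
      then show ?thesis unfolding mem_interior using r(1) by blast
    qed
  qed
  have "openin (top_of_set \<Omega>) W" unfolding W_def by (rule openin_open_Int) simp
  moreover have "closedin (top_of_set \<Omega>) W"
  proof -
    have "W = \<Omega> \<inter> closure W" using step closure_subset[of W] by (auto simp: W_def)
    then show ?thesis by (metis closed_closure closedin_closed_Int)
  qed
  ultimately have "W = {} \<or> W = \<Omega>" using conn unfolding connected_clopen by blast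
  moreover have "x0 \<in> W" using x0 pos[of x0] Sw by (simp add: W_def cap_def)
  ultimately have "x \<in> S" using x interior_subset[of S] by (auto simp: W_def)
  then have "ubar (mirror e l x) > 0" using x ubar_pos[of x] by (simp add: S_def)
  then show ?thesis by (simp add: ubar_pos)
qed

context
  assumes wpos: "\<And>x. x \<in> cap e l \<Longrightarrow> w e l x \<noteq> 0"
begin

lemma w_pos: "x \<in> cap e l \<Longrightarrow> 0 < w e l x"
  using wpos[of x] w_nonneg[of x] by (simp add: cap_def)

text \<open>\<open>w\<close> vanishes at \<open>x\<close> and its derivative in direction
  \<open>e\<close> there is -2 (G x \<bullet> e). Hopf's lemma applies in a small ball touching the
  hyperplane at \<open>x\<close> from the side of the cap.\<close>

lemma hopf_plane:
  assumes x: "x \<in> \<Omega>" "x \<bullet> e = l"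
  shows "G x \<bullet> e < 0"
proof -
  obtain L where L: "0 \<le> L" "supersol (cap e l) L (w e l)" using w_supersol by blast
  obtain r where r: "r > 0" "ball x r \<subseteq> \<Omega>" using open_dom x(1) by (auto simp: open_contains_ball)
  define R where "R = r / 4"
  have R: "0 < R" using r by (simp add: R_def)
  have low: "l + (R - norm (y - (x + R *\<^sub>R e))) \<le> y \<bullet> e" for y
  proof -
    have "- norm (y - (x + R *\<^sub>R e)) \<le> (y - (x + R *\<^sub>R e)) \<bullet> e"
      using Cauchy_Schwarz_ineq2[of "y - (x + R *\<^sub>R e)" e] e1 by simp
    then show ?thesis using x(2) unit_inner[OF e1] by (simp add: inner_diff_left inner_add_left)
  qed
  have inr: "y \<in> \<Omega>" if "dist (x + R *\<^sub>R e) y \<le> R" for y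
  proof -
    have "dist x y \<le> dist x (x + R *\<^sub>R e) + dist (x + R *\<^sub>R e) y" by (rule dist_triangle)
    also have "\<dots> \<le> R + R" using that e1 R by (simp add: dist_norm)
    finally show ?thesis using r R by (auto simp: R_def)
  qed
  have sub: "ball (x + R *\<^sub>R e) R \<subseteq> cap e l"
  proof
    fix y assume "y \<in> ball (x + R *\<^sub>R e) R"
    then have "dist (x + R *\<^sub>R e) y < R" by simp
    then show "y \<in> cap e l"
      using low[of y] inr[of y] by (simp add: cap_def dist_norm norm_minus_commute)
  qed
  have "\<exists>k>0. \<forall>t. 0 < t \<and> t < R / 2 \<longrightarrow> k * t \<le> w e l (x + t *\<^sub>R e)"
  proof (rule hopf_ball[OF e1 R L(1) supersol_subset[OF L(2) sub] _ _ w_cont])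
    show "0 < w e l y" if "y \<in> ball (x + R *\<^sub>R e) R" for y using that sub w_pos by blast
    show "0 \<le> w e l y" if "y \<in> cball (x + R *\<^sub>R e) R" for y
      by (rule w_nonneg) (use that low[of y] in \<open>simp add: dist_norm norm_minus_commute\<close>)
  qed
  then obtain k where k: "k > 0" "\<And>t. 0 < t \<Longrightarrow> t < R / 2 \<Longrightarrow> k * t \<le> w e l (x + t *\<^sub>R e)" by blast
  have d1: "((\<lambda>t. u (x + t *\<^sub>R e)) has_real_derivative G x \<bullet> e) (at 0)"
    using u_line[of x 0 e] x by simp
  have d2: "((\<lambda>t. u (x + t *\<^sub>R (- e))) has_real_derivative G x \<bullet> (- e)) (at 0)"
    using u_line[of x 0 "- e"] x by simp
  have "k \<le> G x \<bullet> (- e) - G x \<bullet> e"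
  proof (rule one_sided_deriv_ge[where \<delta> = "R/2"])
    show "((\<lambda>t. u (x + t *\<^sub>R (- e)) - u (x + t *\<^sub>R e)) has_real_derivative G x \<bullet> (- e) - G x \<bullet> e) (at 0 within {0..})"
      by (rule has_field_derivative_at_within[OF DERIV_diff[OF d2 d1]])
    fix t assume t: "0 < t" "t < R / 2"
    have "x + t *\<^sub>R e \<in> ball (x + R *\<^sub>R e) R"
    proof -
      have "x + R *\<^sub>R e - (x + t *\<^sub>R e) = (R - t) *\<^sub>R e" by (simp add: algebra_simps)
      then show ?thesis using t e1 by (simp add: dist_norm)
    qed
    then have "x + t *\<^sub>R e \<in> cap e l" using sub by blast
    moreover have "mirror e l (x + t *\<^sub>R e) = x + t *\<^sub>R (- e)"
      unfolding mirror_line mirror_fix[OF x(2)] by (simp add: mirror_def unit_inner[OF e1] scaleR_2)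
    ultimately show "k * t \<le> u (x + t *\<^sub>R (- e)) - u (x + t *\<^sub>R e)"
      using k(2)[OF t] w_cap[of "x + t *\<^sub>R e"] by simp
  qed (use R in auto)
  then show ?thesis using k(1) by simp
qed

end

end

end

section \<open>Strict comparison at the frontier and at corners\<close>

context dirichlet_solution
begin

context
  fixes e :: 'a and l :: real
  assumes e1: "norm e = 1" and mp: "mp e l" and wpos: "\<And>x. x \<in> cap e l \<Longrightarrow> w e l x \<noteq> 0"
begin

text \<open>The reflected cap lies in \<Omega> and touches the frontier from inside. If the unit
  vectors \<open>a\<close> and \<open>b\<close> differed, \<open>a - b\<close> would point out of
  \<Omega> at the mirror image while its reflection enters the cap at \<open>x\<close>, against
  \<open>mirror_cap\<close>.\<close>

lemma normal_mirror:
  assumes x: "x \<in> frontier \<Omega>" "l < x \<bullet> e" and y: "mirror e l x \<in> frontier \<Omega>"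
  shows "\<nu> (mirror e l x) = mirror0 e (\<nu> x)"
proof (rule ccontr)
  define a where "a = mirror0 e (\<nu> x)"
  define b where "b = \<nu> (mirror e l x)"
  assume "\<nu> (mirror e l x) \<noteq> mirror0 e (\<nu> x)"
  then have ab: "a - b \<noteq> 0" by (simp add: a_def b_def)
  have "norm a = 1" "norm b = 1"
    unfolding a_def b_def norm_mirror0[OF e1] using normal_unit[OF x(1)] normal_unit[OF y] .
  then have unit: "a \<bullet> a = 1" "b \<bullet> b = 1" by (simp_all add: norm_eq_1)
  have "(a - b) \<bullet> (a - b) > 0" using ab by simp
  then have lt: "a \<bullet> b < 1" using unit by (simp add: inner_diff_left inner_diff_right inner_commute)
  define v where "v = a - b"
  have "0 < (- v) \<bullet> \<nu> (mirror e l x)" using lt unit by (simp add: v_def b_def[symmetric] inner_diff_left)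
  from normal_enter[OF y this] obtain d1 where d1: "d1 > 0"
      "\<And>t. 0 < t \<Longrightarrow> t < d1 \<Longrightarrow> mirror e l x + t *\<^sub>R v \<notin> closure \<Omega>"
    unfolding minus_minus by blast
  have "0 < mirror0 e v \<bullet> \<nu> x" using lt unit unfolding mirror0_adjoint a_def[symmetric] by (simp add: v_def inner_diff_left inner_diff_right inner_commute)
  then obtain d2 where d2: "d2 > 0" "\<And>t. 0 < t \<Longrightarrow> t < d2 \<Longrightarrow> x + t *\<^sub>R mirror0 e v \<in> \<Omega>"
    using normal_enter[OF x(1)] by blast
  have "((\<lambda>t::real. (x + t *\<^sub>R mirror0 e v) \<bullet> e) \<longlongrightarrow> (x + 0 *\<^sub>R mirror0 e v) \<bullet> e) (at_right 0)"
    by (intro tendsto_intros)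
  then have "\<forall>\<^sub>F t in at_right 0. l < (x + t *\<^sub>R mirror0 e v) \<bullet> e"
    by (rule order_tendstoD) (use x(2) in simp)
  then obtain d3 where d3: "d3 > 0" "\<And>t. 0 < t \<Longrightarrow> t < d3 \<Longrightarrow> l < (x + t *\<^sub>R mirror0 e v) \<bullet> e"
    unfolding eventually_at_right_field by auto
  define t where "t = min d1 (min d2 d3) / 2"
  have t: "0 < t" "t < d1" "t < d2" "t < d3" using d1(1) d2(1) d3(1) by (auto simp: t_def)
  have "x + t *\<^sub>R mirror0 e v \<in> cap e l" using d2(2)[OF t(1,3)] d3(2)[OF t(1,4)] by (simp add: cap_def)
  from mirror_cap[OF e1 mp this] have "mirror e l x + t *\<^sub>R v \<in> \<Omega>"
    unfolding mirror_line mirror_mirror[OF e1] .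
  then show False using d1(2)[OF t(1,2)] in_closure by blast
qed

text \<open>\<open>w\<close> is zero at \<open>x\<close>, as both points lie on the frontier, and
  positive in a ball of the cap tangent there; a quarter of the distance to the hyperplane as radius
  keeps that ball beyond it. As the normals are mirror images, the slope of \<open>w\<close> is the
  difference of the normal derivatives.\<close>

lemma hopf_boundary:
  assumes x: "x \<in> frontier \<Omega>" "l < x \<bullet> e" and y: "mirror e l x \<in> frontier \<Omega>"
  shows "G x \<bullet> \<nu> x < G (mirror e l x) \<bullet> \<nu> (mirror e l x)"
proof -
  define y where "y = mirror e l x"
  obtain L where L: "0 \<le> L" "supersol (cap e l) L (w e l)" using w_supersol[OF e1 mp] by blast
  obtain R0 where R0: "R0 > 0" "\<And>R. 0 < R \<Longrightarrow> R \<le> R0 \<Longrightarrow> cball (x + R *\<^sub>R \<nu> x) R - {x} \<subseteq> \<Omega>"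
    using normal_ball[OF x(1)] by blast
  define R where "R = min R0 ((x \<bullet> e - l) / 4)"
  have "R \<le> (x \<bullet> e - l) / 4" unfolding R_def by (rule min.cobounded2)
  then have R: "0 < R" "R \<le> R0" "4 * R \<le> x \<bullet> e - l" using R0(1) x(2) by (auto simp: R_def)
  have n1: "norm (\<nu> x) = 1" by (rule normal_unit[OF x(1)])
  have low: "l < z \<bullet> e" if z: "z \<in> cball (x + R *\<^sub>R \<nu> x) R" for z
  proof -
    have "norm (z - x) \<le> norm (z - (x + R *\<^sub>R \<nu> x)) + norm (R *\<^sub>R \<nu> x)"
      using norm_triangle_ineq[of "z - (x + R *\<^sub>R \<nu> x)" "R *\<^sub>R \<nu> x"] by simp
    then have "norm (z - x) \<le> 2 * R" using z n1 R by (simp add: dist_norm norm_minus_commute)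
    moreover have "\<bar>(z - x) \<bullet> e\<bar> \<le> norm (z - x)" using Cauchy_Schwarz_ineq2[of "z - x" e] e1 by simp
    ultimately show ?thesis using R by (simp add: inner_diff_left)
  qed
  have sub: "ball (x + R *\<^sub>R \<nu> x) R \<subseteq> cap e l"
  proof
    fix z assume z: "z \<in> ball (x + R *\<^sub>R \<nu> x) R"
    then have zc: "z \<in> cball (x + R *\<^sub>R \<nu> x) R" using ball_subset_cball by blast
    have "x \<notin> ball (x + R *\<^sub>R \<nu> x) R" using n1 R by (simp add: dist_norm)
    then have "z \<in> \<Omega>" using R0(2)[OF R(1,2)] zc z by blast
    then show "z \<in> cap e l" using low[OF zc] by (simp add: cap_def)
  qed
  have "\<exists>k>0. \<forall>t. 0 < t \<and> t < R / 2 \<longrightarrow> k * t \<le> w e l (x + t *\<^sub>R \<nu> x)"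
  proof (rule hopf_ball[OF n1 R(1) L(1) supersol_subset[OF L(2) sub] _ _ w_cont])
    show "0 < w e l z" if "z \<in> ball (x + R *\<^sub>R \<nu> x) R" for z using that sub w_pos[OF e1 mp wpos] by blast
    show "0 \<le> w e l z" if "z \<in> cball (x + R *\<^sub>R \<nu> x) R" for z
      by (rule w_nonneg[OF e1 mp]) (use low[OF that] in simp)
  qed
  then obtain k where k: "k > 0" "\<And>t. 0 < t \<Longrightarrow> t < R / 2 \<Longrightarrow> k * t \<le> w e l (x + t *\<^sub>R \<nu> x)" by blast
  have yf: "y \<in> frontier \<Omega>" using y by (simp add: y_def)
  have ny: "\<nu> y = mirror0 e (\<nu> x)" unfolding y_def by (rule normal_mirror[OF x y])
  have "0 < \<nu> p \<bullet> \<nu> p" if "p \<in> frontier \<Omega>" for p using normal_unit[OF that] by (simp add: norm_eq_1)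
  note n0 = this
  obtain d1 where d1: "0 < d1" "\<And>t. 0 < t \<Longrightarrow> t < d1 \<Longrightarrow> x + t *\<^sub>R \<nu> x \<in> \<Omega>"
      "\<And>t. 0 \<le> t \<Longrightarrow> t < d1 \<Longrightarrow> x + t *\<^sub>R \<nu> x \<in> closure \<Omega>"
    using normal_ray[OF x(1) n0[OF x(1)]] by metis
  obtain d2 where d2: "0 < d2" "\<And>t. 0 < t \<Longrightarrow> t < d2 \<Longrightarrow> y + t *\<^sub>R \<nu> y \<in> \<Omega>"
      "\<And>t. 0 \<le> t \<Longrightarrow> t < d2 \<Longrightarrow> y + t *\<^sub>R \<nu> y \<in> closure \<Omega>"
    using normal_ray[OF yf n0[OF yf]] by metis
  have "k \<le> G y \<bullet> \<nu> y - G x \<bullet> \<nu> x"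
  proof (rule one_sided_deriv_ge[where \<delta> = "min (R/2) (min d1 d2)"])
    show "((\<lambda>t. u (y + t *\<^sub>R \<nu> y) - u (x + t *\<^sub>R \<nu> x)) has_real_derivative G y \<bullet> \<nu> y - G x \<bullet> \<nu> x) (at 0 within {0..})"
      by (rule DERIV_diff[OF ray_deriv[OF d2(1,3)] ray_deriv[OF d1(1,3)]])
    show "u (y + 0 *\<^sub>R \<nu> y) - u (x + 0 *\<^sub>R \<nu> x) = 0" using u_zero[OF x(1)] u_zero[OF yf] by simp
    show "0 < min (R/2) (min d1 d2)" using R d1 d2 by simp
    fix t assume t: "0 < t" "t < min (R/2) (min d1 d2)"
    have "mirror e l (x + t *\<^sub>R \<nu> x) = y + t *\<^sub>R \<nu> y" unfolding mirror_line ny unfolding y_def ..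
    then have "w e l (x + t *\<^sub>R \<nu> x) = u (y + t *\<^sub>R \<nu> y) - u (x + t *\<^sub>R \<nu> x)"
      using d1(2)[of t] d2(2)[of t] t by (simp add: w_def ubar_in)
    then show "k * t \<le> u (y + t *\<^sub>R \<nu> y) - u (x + t *\<^sub>R \<nu> x)" using k(2)[of t] t by simp
  qed
  then show ?thesis using k(1) by (simp add: y_def)
qed

text \<open>Supplies the hypothesis \<open>low\<close> of the corner lemma. \<open>K\<close> may
  reach the hyperplane, where \<open>w\<close> is zero, so positivity and compactness alone do not
  suffice; there the slope from \<open>hopf_plane\<close> gives the linear bound.\<close>

lemma w_linear_lower_bound:
  assumes K: "compact K" "K \<subseteq> \<Omega>" and Kl: "\<And>x. x \<in> K \<Longrightarrow> l \<le> x \<bullet> e"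
  shows "\<exists>m>0. \<forall>x\<in>K. m * (x \<bullet> e - l) \<le> w e l x"
proof (rule ccontr)
  assume no: "\<not> (\<exists>m>0. \<forall>x\<in>K. m * (x \<bullet> e - l) \<le> w e l x)"
  have "\<exists>x\<in>K. w e l x < 1 / real (Suc n) * (x \<bullet> e - l)" for n
  proof (rule ccontr)
    assume "\<not> ?thesis"
    then have "\<forall>x\<in>K. 1 / real (Suc n) * (x \<bullet> e - l) \<le> w e l x" by (simp add: not_less)
    moreover have "1 / real (Suc n) > 0" by simp
    ultimately show False using no by blast
  qed
  then obtain X where X: "\<And>n. X n \<in> K" "\<And>n. w e l (X n) < 1 / real (Suc n) * (X n \<bullet> e - l)" by metis
  obtain x r where x: "x \<in> K" "strict_mono (r :: nat \<Rightarrow> nat)" "(X \<circ> r) \<longlonglongrightarrow> x"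
    using K(1) X(1) unfolding compact_def by metis
  have lim: "(\<lambda>n. X (r n)) \<longlonglongrightarrow> x" using x(3) by (simp add: o_def)
  have inv: "(\<lambda>n. 1 / real (Suc (r n))) \<longlonglongrightarrow> 0"
    using LIMSEQ_subseq_LIMSEQ[OF lim_1_over_n x(2)] LIMSEQ_Suc[OF lim_1_over_n]
      LIMSEQ_subseq_LIMSEQ[OF LIMSEQ_Suc[OF lim_1_over_n] x(2)] by (simp add: o_def)
  have an: "(\<lambda>n. X (r n) \<bullet> e - l) \<longlonglongrightarrow> x \<bullet> e - l" by (intro tendsto_intros lim)
  have A: "(\<lambda>n. 1 / real (Suc (r n)) * (X (r n) \<bullet> e - l)) \<longlonglongrightarrow> 0 * (x \<bullet> e - l)"
    by (rule tendsto_mult[OF inv an])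
  have B: "(\<lambda>n. w e l (X (r n))) \<longlonglongrightarrow> w e l x"
    by (rule continuous_on_tendsto_compose[OF w_cont[of UNIV] lim]) auto
  have "w e l x \<le> 0 * (x \<bullet> e - l)"
    by (rule LIMSEQ_le[OF B A]) (use X(2) less_imp_le in blast)
  then have wx: "w e l x \<le> 0" by simp
  have xO: "x \<in> \<Omega>" using x(1) K(2) by blast
  have xe: "x \<bullet> e = l"
  proof (rule ccontr)
    assume "x \<bullet> e \<noteq> l"
    then have "x \<in> cap e l" using Kl[OF x(1)] xO by (simp add: cap_def)
    then show False using w_pos[OF e1 mp wpos] wx by force
  qed
  \<comment> \<open>Half the slope at the limit point, so that the estimate persists in a
    neighbourhood.\<close>
  define k where "k = - (G x \<bullet> e) / 2"
  have k: "k > 0" using hopf_plane[OF e1 mp wpos xO xe] by (simp add: k_def)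
  have "isCont (\<lambda>y. G y \<bullet> e) x"
    using has_derivative_continuous[OF G_at[OF xO]] by (intro continuous_intros)
  then have "\<forall>\<^sub>F y in nhds x. G y \<bullet> e < - k"
    by (rule order_tendstoD(2)[OF isCont_tendsto_nhds]) (use hopf_plane[OF e1 mp wpos xO xe] in \<open>simp add: k_def\<close>)
  moreover have "\<forall>\<^sub>F y in nhds x. y \<in> \<Omega>" by (rule eventually_nhds_in_open[OF open_dom xO])
  ultimately have "\<forall>\<^sub>F y in nhds x. G y \<bullet> e < - k \<and> y \<in> \<Omega>" by (rule eventually_conj)
  then obtain \<delta> where \<delta>: "\<delta> > 0" "\<And>y. dist y x < \<delta> \<Longrightarrow> G y \<bullet> e < - k \<and> y \<in> \<Omega>"
    unfolding eventually_nhds_metric by blast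
  have "\<forall>\<^sub>F n in sequentially. dist (X (r n)) x < \<delta>" using lim \<delta>(1) by (rule tendstoD)
  moreover have "\<forall>\<^sub>F n in sequentially. 1 / real (Suc (r n)) < 2 * k"
    using inv k by (intro order_tendstoD(2)[OF inv]) simp
  ultimately have "\<forall>\<^sub>F n in sequentially. dist (X (r n)) x < \<delta> \<and> 1 / real (Suc (r n)) < 2 * k"
    by (rule eventually_conj)
  then obtain n where n: "dist (X (r n)) x < \<delta>" "1 / real (Suc (r n)) < 2 * k"
    unfolding eventually_sequentially by blast
  define z where "z = X (r n)"
  have zl: "l \<le> z \<bullet> e" using Kl X(1) by (simp add: z_def)
  have wz: "w e l z < 1 / real (Suc (r n)) * (z \<bullet> e - l)" using X(2) by (simp add: z_def)
  have z0: "0 < z \<bullet> e - l" using wz w_nonneg[OF e1 mp zl] zl by (cases "z \<bullet> e = l") auto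
  \<comment> \<open>The distance from \<open>z\<close> to its mirror image. Both ends lie in the
    ball about \<open>x\<close>, which is fixed by the reflection, hence so does the segment; along
    it \<open>u\<close> gains more than k s = 2 k (z \<bullet> e - l).\<close>
  define s where "s = 2 * (z \<bullet> e - l)"
  have s: "0 < s" using z0 by (simp add: s_def)
  have zs: "z - s *\<^sub>R e = mirror e l z" by (simp add: s_def mirror_def algebra_simps)
  have near: "dist (z - t *\<^sub>R e) x < \<delta>" if t: "0 \<le> t" "t \<le> s" for t
  proof -
    have "z \<in> ball x \<delta>" using n(1) by (simp add: z_def dist_commute)
    moreover have "z - s *\<^sub>R e \<in> ball x \<delta>"
      unfolding zs using dist_mirror[OF e1, of l z x] mirror_fix[OF xe] n(1) by (simp add: z_def dist_commute)
    ultimately have "(1 - t / s) *\<^sub>R z + (t / s) *\<^sub>R (z - s *\<^sub>R e) \<in> ball x \<delta>"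
      using t s by (intro convexD_alt[OF convex_ball]) auto
    moreover have "(1 - t / s) *\<^sub>R z + (t / s) *\<^sub>R (z - s *\<^sub>R e) = z - t *\<^sub>R e"
      using s by (simp add: algebra_simps)
    ultimately show ?thesis by (simp add: dist_commute)
  qed
  have "u z + k * s < u (z - s *\<^sub>R e)"
    by (rule decrease_along[OF s]) (use \<delta>(2) near in blast)+
  moreover have "z \<in> \<Omega>" "mirror e l z \<in> \<Omega>" using \<delta>(2) near[of 0] near[of s] s zs by auto
  ultimately have "k * s < w e l z" by (simp add: w_def ubar_in zs)
  moreover have "1 / real (Suc (r n)) * (z \<bullet> e - l) \<le> 2 * k * (z \<bullet> e - l)"
    using n(2) z0 by (intro mult_right_mono) auto
  moreover have "k * s = 2 * k * (z \<bullet> e - l)" by (simp add: s_def)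
  ultimately show False using wz by linarith
qed

text \<open>Serrin's corner lemma: the gradient of \<^term>\<open>w e l\<close> vanishes at such a point, so the
  quadratic lower bound along \<open>\<nu> q + e\<close> determines the sign of the mixed second derivative.\<close>

lemma corner_hessian:
  assumes q: "q \<in> frontier \<Omega>" "q \<bullet> e = l" and en: "e \<bullet> \<nu> q = 0"
  shows "\<nu> q \<bullet> H q e < 0"
proof -
  define n where "n = \<nu> q"
  have n1: "norm n = 1" using normal_unit[OF q(1)] by (simp add: n_def)
  have ne: "n \<bullet> e = 0" using en by (simp add: n_def inner_commute)
  have nn: "n \<bullet> n = 1" "e \<bullet> e = 1" using n1 e1 by (simp_all add: norm_eq_1)
  obtain L where L: "0 \<le> L" "supersol (cap e l) L (w e l)" using w_supersol[OF e1 mp] by blast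
  obtain R where R: "R > 0" "cball (q + R *\<^sub>R n) R - {q} \<subseteq> \<Omega>"
    using normal_ball[OF q(1)] unfolding n_def by blast
  have qe: "(x - q) \<bullet> e = x \<bullet> e - l" for x using q(2) by (simp add: inner_diff_left)
  \<comment> \<open>The closed ball meets the complement of \<Omega> at most in \<open>q\<close>,
    and the sphere about \<open>q\<close> avoids \<open>q\<close>; so \<open>K\<close> is a compact
    subset of \<Omega>, although it reaches the hyperplane.\<close>
  define K where "K = cball (q + R *\<^sub>R n) R \<inter> {x. l \<le> e \<bullet> x} \<inter> sphere q (R/2)"
  have cK: "compact K" unfolding K_def
    by (intro compact_Int_closed closed_halfspace_ge closed_sphere) auto
  have KO: "K \<subseteq> \<Omega>" using R by (auto simp: K_def)
  have Kl: "l \<le> x \<bullet> e" if "x \<in> K" for x using that by (simp add: K_def inner_commute)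
  obtain m where m: "m > 0" "\<And>x. x \<in> K \<Longrightarrow> m * (x \<bullet> e - l) \<le> w e l x"
    using w_linear_lower_bound[OF cK KO Kl] by blast
  have "\<exists>k>0. \<exists>\<delta>>0. \<forall>t. 0 < t \<and> t < \<delta> \<longrightarrow> k * t\<^sup>2 \<le> w e l (q + t *\<^sub>R (n + e))"
  proof (rule corner[OF n1 e1 ne R(1) L(1), of "R/2", OF _ _ _ _ w_cont m(1)])
    have "q \<notin> ball (q + R *\<^sub>R n) R" using n1 R by (simp add: dist_norm)
    then have "ball (q + R *\<^sub>R n) R \<subseteq> \<Omega>" using R(2) ball_subset_cball by blast
    then show "supersol {x \<in> ball (q + R *\<^sub>R n) R. 0 < (x - q) \<bullet> e} L (w e l)"
      by (intro supersol_subset[OF L(2)]) (auto simp: cap_def qe)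
    show "0 \<le> w e l x" if "0 \<le> (x - q) \<bullet> e" for x using that by (intro w_nonneg[OF e1 mp]) (simp add: qe)
    show "m * ((x - q) \<bullet> e) \<le> w e l x"
      if "x \<in> cball (q + R *\<^sub>R n) R" "0 \<le> (x - q) \<bullet> e" "dist q x = R / 2" for x
      unfolding qe using that by (intro m(2)) (simp add: K_def qe inner_commute[of e])
  qed (use R in auto)
  then obtain k \<delta>0 where k: "k > 0" "\<delta>0 > 0" "\<And>t. 0 < t \<Longrightarrow> t < \<delta>0 \<Longrightarrow> k * t\<^sup>2 \<le> w e l (q + t *\<^sub>R (n + e))"
    by blast
  have vp: "0 < (n + e) \<bullet> \<nu> q" "0 < (n - e) \<bullet> \<nu> q"
    using nn en by (simp_all add: n_def[symmetric] inner_add_left inner_diff_left)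
  obtain d1 where d1: "0 < d1" "\<And>t. 0 < t \<Longrightarrow> t < d1 \<Longrightarrow> q + t *\<^sub>R (n + e) \<in> \<Omega>" using normal_ray[OF q(1) vp(1)] by metis
  obtain d2 where d2: "0 < d2" "\<And>t. 0 < t \<Longrightarrow> t < d2 \<Longrightarrow> q + t *\<^sub>R (n - e) \<in> \<Omega>" using normal_ray[OF q(1) vp(2)] by metis
  \<comment> \<open>The expansions along \<open>n + e\<close> and along its mirror image
    \<open>n - e\<close> each cost k/4, which leaves half of the lower bound \<open>k\<close>. Their
    first order terms agree, and the quadratic ones differ only in the mixed term.\<close>
  have k4: "k / 4 > 0" using k by simp
  obtain d3 where d3: "0 < d3" "\<And>t. 0 < t \<Longrightarrow> t < d3 \<Longrightarrow>
      \<bar>u (q + t *\<^sub>R (n + e)) - u q - t * (G q \<bullet> (n + e)) - t\<^sup>2 / 2 * ((n + e) \<bullet> H q (n + e))\<bar> \<le> k / 4 * t\<^sup>2"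
    using boundary_taylor[OF q(1) vp(1) k4] by blast
  obtain d4 where d4: "0 < d4" "\<And>t. 0 < t \<Longrightarrow> t < d4 \<Longrightarrow>
      \<bar>u (q + t *\<^sub>R (n - e)) - u q - t * (G q \<bullet> (n - e)) - t\<^sup>2 / 2 * ((n - e) \<bullet> H q (n - e))\<bar> \<le> k / 4 * t\<^sup>2"
    using boundary_taylor[OF q(1) vp(2) k4] by blast
  define t where "t = min \<delta>0 (min (min d1 d2) (min d3 d4)) / 2"
  have t: "0 < t" "t < \<delta>0" "t < d1" "t < d2" "t < d3" "t < d4"
    using k(2) d1(1) d2(1) d3(1) d4(1) by (auto simp: t_def)
  have Ge: "G q \<bullet> e = 0" using G_tangent[OF q(1) en] .
  have alg: "a / 2 * A - a / 2 * B + 2 * (k / 4 * a) = a * ((A - B) / 2 + k / 2)" for a A B :: real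
    by (simp add: field_simps)
  have g: "G q \<bullet> (n + e) = G q \<bullet> n" "G q \<bullet> (n - e) = G q \<bullet> n"
    using Ge by (simp_all add: inner_add_right inner_diff_right)
  have rl: "mirror e l (q + t *\<^sub>R (n + e)) = q + t *\<^sub>R (n - e)"
    unfolding mirror_line mirror_fix[OF q(2)] by (simp add: mirror_def inner_add_left ne nn scaleR_2)
  have "k * t\<^sup>2 \<le> u (q + t *\<^sub>R (n - e)) - u (q + t *\<^sub>R (n + e))"
    using k(3)[OF t(1,2)] d1(2)[OF t(1,3)] d2(2)[OF t(1,4)] by (simp add: w_def rl ubar_in)
  then have "k * t\<^sup>2 \<le> t\<^sup>2 / 2 * ((n - e) \<bullet> H q (n - e)) - t\<^sup>2 / 2 * ((n + e) \<bullet> H q (n + e)) + 2 * (k / 4 * t\<^sup>2)"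
    using d3(2)[OF t(1,5)] d4(2)[OF t(1,6)] unfolding g abs_le_iff by linarith
  also have "\<dots> = t\<^sup>2 * (((n - e) \<bullet> H q (n - e) - (n + e) \<bullet> H q (n + e)) / 2 + k / 2)"
    by (rule alg)
  finally have "t\<^sup>2 * k \<le> t\<^sup>2 * (((n - e) \<bullet> H q (n - e) - (n + e) \<bullet> H q (n + e)) / 2 + k / 2)"
    by (simp add: mult.commute)
  then have "k \<le> ((n - e) \<bullet> H q (n - e) - (n + e) \<bullet> H q (n + e)) / 2 + k / 2" using t(1) by simp
  moreover have "(n - e) \<bullet> H q (n - e) - (n + e) \<bullet> H q (n + e) = - 4 * (n \<bullet> H q e)"
  proof -
    interpret Hq: linear "H q" by (rule H_linear[OF frontier_closure[OF q(1)]])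
    have "e \<bullet> H q n = n \<bullet> H q e" by (rule H_sym[OF frontier_closure[OF q(1)]])
    then show ?thesis
      by (simp add: Hq.add Hq.diff inner_add_left inner_add_right inner_diff_left inner_diff_right)
  qed
  ultimately show ?thesis using k(1) by (simp add: n_def)
qed

end

text \<open>When \<open>f (0+) < 0\<close> the normal derivative may vanish at the boundary. There the Hessian is a
  positive multiple of the projection onto the normal.\<close>

lemma degenerate_hessian:
  assumes q: "q \<in> frontier \<Omega>" and Gq: "G q = 0" and tr: "0 < (\<Sum>b\<in>Basis. b \<bullet> H q b)"
    and e: "e \<bullet> \<nu> q < 0"
  shows "0 < e \<bullet> H q e"
proof -
  define n where "n = \<nu> q"
  define a where "a = H q n"
  have nn: "n \<bullet> n = 1" using normal_unit[OF q] by (simp add: n_def norm_eq_1)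
  interpret Hq: linear "H q" by (rule H_linear[OF frontier_closure[OF q]])
  \<comment> \<open>Along a frontier curve with velocity \<tau>, \<open>G\<close> paired with
    \<open>v\<close> is the normal derivative times \<nu> \<bullet> v. Near 0 this is nonnegative
    and it is zero at 0, so its derivative there vanishes.\<close>
  have orth: "H q \<tau> \<bullet> v = 0" if \<tau>: "\<tau> \<bullet> n = 0" and v: "0 < v \<bullet> n" for \<tau> v
  proof -
    obtain c where c: "\<And>t. c t \<in> frontier \<Omega>" "c (0::real) = q" "(c has_vector_derivative \<tau>) (at 0)"
        "(\<lambda>t. \<nu> (c t)) differentiable (at 0)"
      using normal_curve[OF q] \<tau> unfolding n_def by metis
    have dG: "((\<lambda>t. G (c t)) has_vector_derivative H (c 0) \<tau>) (at 0)"
      by (rule G_curve(1)[OF _ c(3)]) (use c(1) frontier_closure in blast)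
    then have d: "((\<lambda>t. G (c t) \<bullet> v) has_real_derivative H q \<tau> \<bullet> v) (at 0)"
      unfolding has_real_derivative_iff_has_vector_derivative c(2)
      by (rule bounded_linear.has_vector_derivative[OF bounded_linear_inner_left])
    have "isCont (\<lambda>t. \<nu> (c t) \<bullet> v) 0"
      using differentiable_imp_continuous_within[OF c(4)] by (intro continuous_intros)
    then have "\<forall>\<^sub>F t in nhds 0. 0 < \<nu> (c t) \<bullet> v"
      by (rule order_tendstoD(1)[OF isCont_tendsto_nhds]) (use v c(2) in \<open>simp add: n_def inner_commute\<close>)
    then obtain \<delta> where \<delta>: "\<delta> > 0" "\<And>t. \<bar>t\<bar> < \<delta> \<Longrightarrow> 0 < \<nu> (c t) \<bullet> v"
      unfolding eventually_nhds_metric by (auto simp: dist_real_def)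
    have "G (c 0) \<bullet> v \<le> G (c t) \<bullet> v" if "\<bar>0 - t\<bar> < \<delta>" for t
    proof -
      have "0 \<le> (G (c t) \<bullet> \<nu> (c t)) * (v \<bullet> \<nu> (c t))"
        using normal_deriv_nonneg[OF c(1)] \<delta>(2)[of t] that by (simp add: inner_commute)
      then show ?thesis using G_normal[OF c(1), of t v] c(2) Gq by simp
    qed
    then show ?thesis using DERIV_local_min[OF d \<delta>(1)] by blast
  qed
  \<comment> \<open>Both \<open>n\<close> and \<open>n + H q \<tau>\<close> are admissible choices
    of \<open>v\<close>; comparing them gives H q \<tau> \<bullet> H q \<tau> = 0.\<close>
  have Htan: "H q \<tau> = 0" if \<tau>: "\<tau> \<bullet> n = 0" for \<tau>
  proof -
    have 1: "H q \<tau> \<bullet> n = 0" by (rule orth[OF \<tau>]) (simp add: nn)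
    have "H q \<tau> \<bullet> (n + H q \<tau>) = 0" by (rule orth[OF \<tau>]) (simp add: nn 1 inner_add_left)
    then show ?thesis using 1 by (simp add: inner_add_right)
  qed
  have Hv: "H q v = (v \<bullet> n) *\<^sub>R a" for v
  proof -
    have "H q (v - (v \<bullet> n) *\<^sub>R n) = 0" by (rule Htan) (simp add: inner_diff_left nn)
    then show ?thesis by (simp add: a_def Hq.diff Hq.scale)
  qed
  \<comment> \<open>Otherwise the quadratic term, the only one left in the expansion at
    \<open>q\<close>, would be negative and \<open>u\<close> would be negative along an entering
    ray.\<close>
  have av: "0 \<le> a \<bullet> v" if v: "0 < v \<bullet> n" for v
  proof (rule ccontr)
    assume neg: "\<not> 0 \<le> a \<bullet> v"
    define K where "K = - (v \<bullet> H q v)"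
    have K: "K > 0" using neg v by (simp add: K_def Hv inner_commute mult_pos_neg)
    obtain d1 where d1: "0 < d1" "\<And>t. 0 < t \<Longrightarrow> t < d1 \<Longrightarrow>
      \<bar>u (q + t *\<^sub>R v) - u q - t * (G q \<bullet> v) - t\<^sup>2 / 2 * (v \<bullet> H q v)\<bar> \<le> K / 4 * t\<^sup>2"
      using boundary_taylor[OF q, of v "K/4"] K v unfolding n_def by auto
    obtain d2 where d2: "0 < d2" "\<And>t. 0 < t \<Longrightarrow> t < d2 \<Longrightarrow> q + t *\<^sub>R v \<in> \<Omega>"
      using normal_ray[OF q, of v] v unfolding n_def by metis
    define t where "t = min d1 d2 / 2"
    have t: "0 < t" "t < d1" "t < d2" using d1(1) d2(1) by (auto simp: t_def)
    have "u (q + t *\<^sub>R v) + t\<^sup>2 / 2 * K \<le> K / 4 * t\<^sup>2"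
      using d1(2)[OF t(1,2)] Gq u_zero[OF q] by (simp add: K_def)
    moreover have "K * t\<^sup>2 > 0" using K t by simp
    ultimately show False using u_pos[OF d2(2)[OF t(1,3)]] by (simp add: algebra_simps)
  qed
  have "(\<Sum>b\<in>Basis. b \<bullet> H q b) = (\<Sum>b\<in>Basis. (n \<bullet> b) * (a \<bullet> b))"
    by (simp add: Hv inner_commute)
  also have "\<dots> = n \<bullet> a" by (rule euclidean_inner[symmetric])
  finally have an: "0 < n \<bullet> a" using tr by simp
  have ae: "a \<bullet> e < 0"
  proof -
    define s where "s = - (e \<bullet> n) / (2 * (n \<bullet> a))"
    \<comment> \<open>With this \<open>s\<close> the vector -e - s a still points inwards, its
      product with \<open>n\<close> being -(e \<bullet> n)/2. The previous inequality then bounds a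
      \<bullet> (-e) below by s (a \<bullet> a).\<close>
    have s: "s > 0" unfolding s_def using e an by (intro divide_pos_pos) (auto simp: n_def)
    have "s * (n \<bullet> a) = - (e \<bullet> n) / 2" using an by (simp add: s_def)
    then have "0 < (- e - s *\<^sub>R a) \<bullet> n" using e by (simp add: inner_diff_left n_def inner_commute[of a])
    then have "0 \<le> a \<bullet> (- e - s *\<^sub>R a)" by (rule av)
    moreover have "a \<noteq> 0" using an by auto
    then have "s * (a \<bullet> a) > 0" using s by simp
    ultimately show ?thesis by (simp add: inner_diff_right)
  qed
  show ?thesis using ae e by (simp add: Hv n_def inner_commute mult_neg_neg)
qed

text \<open>Minus the trace at \<open>q\<close> is the limit of f (u z) as z tends to
  \<open>q\<close> inside \<Omega>, in place of the value f 0, which the equation does not give. If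
  this limit is nonnegative, \<open>u\<close> itself is a supersolution and Hopf's lemma applies to
  it.\<close>

lemma normal_deriv_pos:
  assumes q: "q \<in> frontier \<Omega>" and tr: "(\<Sum>b\<in>Basis. b \<bullet> H q b) \<le> 0"
  shows "0 < G q \<bullet> \<nu> q"
proof -
  define D where "D = (\<Sum>b\<in>Basis. b \<bullet> H q b)"
  obtain L where L: "0 \<le> L" "\<And>x y. x \<in> closure \<Omega> \<Longrightarrow> y \<in> closure \<Omega> \<Longrightarrow> g (u x) - g (u y) \<le> L * \<bar>u x - u y\<bar>"
    using one_sided_lipschitz by metis
  have qc: "q \<in> closure \<Omega>" and qn: "q \<notin> \<Omega>" using q frontier_closure frontier_notin by auto
  have nb: "at q within \<Omega> \<noteq> bot"
    using qc qn by (simp add: trivial_limit_within closure_def islimpt_def)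
  have lower: "- L * u x \<le> f (u x)" if x: "x \<in> \<Omega>" for x
  proof -
    \<comment> \<open>For z near \<open>q\<close> one has u z < u x, so h (u x) >= h (u z) = -(trace
      at z) - g (u z). In the limit h (u x) >= -D - g 0, and the Lipschitz bound for
      \<open>g\<close> finishes the estimate.\<close>
    have ut: "(u \<longlongrightarrow> 0) (at q within \<Omega>)"
      using u_cont qc u_zero[OF q] closure_subset unfolding continuous_on_def by (metis tendsto_within_subset)
    have tt: "((\<lambda>z. \<Sum>b\<in>Basis. b \<bullet> H z b) \<longlongrightarrow> D) (at q within \<Omega>)"
    proof -
      have "continuous_on (closure \<Omega>) (\<lambda>z. \<Sum>b\<in>Basis. b \<bullet> H z b)" by (intro continuous_intros H_cont)
      then show ?thesis unfolding D_def
        using qc closure_subset unfolding continuous_on_def by (metis (no_types, lifting) tendsto_within_subset)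
    qed
    have "((\<lambda>z. - (\<Sum>b\<in>Basis. b \<bullet> H z b) - g 0 - L * \<bar>u z\<bar>) \<longlongrightarrow> - D - g 0 - L * \<bar>0\<bar>) (at q within \<Omega>)"
      by (intro tendsto_intros tt ut)
    moreover have "\<forall>\<^sub>F z in at q within \<Omega>. - (\<Sum>b\<in>Basis. b \<bullet> H z b) - g 0 - L * \<bar>u z\<bar> \<le> h (u x)"
    proof -
      have "\<forall>\<^sub>F z in at q within \<Omega>. u z < u x" by (rule order_tendstoD(2)[OF ut u_pos[OF x]])
      moreover have "\<forall>\<^sub>F z in at q within \<Omega>. z \<in> \<Omega>" by (simp add: eventually_at_filter)
      ultimately show ?thesis
      proof eventually_elim
        case (elim z)
        have "h (u z) \<le> h (u x)" using elim by (intro monoD[OF h_mono]) simp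
        moreover have "g (u z) - g (u q) \<le> L * \<bar>u z - u q\<bar>" using L(2) elim qc in_closure by blast
        moreover have "- (\<Sum>b\<in>Basis. b \<bullet> H z b) = g (u z) + h (u z)" using pde[OF elim(2)] split by simp
        ultimately show ?case using u_zero[OF q] by simp
      qed
    qed
    ultimately have "- D - g 0 - L * \<bar>0\<bar> \<le> h (u x)" by (rule tendsto_upperbound[OF _ _ nb])
    moreover have "g (u q) - g (u x) \<le> L * \<bar>u q - u x\<bar>" using L(2) qc in_closure[OF x] by blast
    ultimately show ?thesis using u_zero[OF q] u_pos[OF x] tr by (simp add: split D_def)
  qed
  have sup: "supersol \<Omega> L u"
    unfolding supersol_def
  proof (intro ballI conjI)
    fix x assume x: "x \<in> \<Omega>"
    show "u differentiable (at x)" using u_at[OF x] differentiable_def by blast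
    show "0 \<le> u x" using u_pos[OF x] by simp
    show "\<exists>D2. (\<forall>b\<in>Basis. second_dir u x b (D2 b)) \<and> sum D2 Basis \<le> L * u x"
      using second_dir_u[OF x] pde[OF x] lower[OF x] by (intro exI[of _ "\<lambda>b. b \<bullet> H x b"]) auto
  qed
  obtain R where R: "R > 0" "cball (q + R *\<^sub>R \<nu> q) R - {q} \<subseteq> \<Omega>" using normal_ball[OF q] by blast
  have n1: "norm (\<nu> q) = 1" by (rule normal_unit[OF q])
  have "q \<notin> ball (q + R *\<^sub>R \<nu> q) R" using n1 R by (simp add: dist_norm)
  then have bO: "ball (q + R *\<^sub>R \<nu> q) R \<subseteq> \<Omega>" using R(2) ball_subset_cball by blast
  have cO: "cball (q + R *\<^sub>R \<nu> q) R \<subseteq> closure \<Omega>" using R(2) qc in_closure by blast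
  have "\<exists>k>0. \<forall>t. 0 < t \<and> t < R / 2 \<longrightarrow> k * t \<le> u (q + t *\<^sub>R \<nu> q)"
    by (rule hopf_ball[OF n1 R(1) L(1) supersol_subset[OF sup bO] _ _ continuous_on_subset[OF u_cont cO]])
       (use bO cO u_pos u_nonneg in blast)+
  then obtain k where k: "k > 0" "\<And>t. 0 < t \<Longrightarrow> t < R / 2 \<Longrightarrow> k * t \<le> u (q + t *\<^sub>R \<nu> q)" by blast
  have "0 < \<nu> q \<bullet> \<nu> q" using n1 by (simp add: norm_eq_1)
  then obtain \<delta> where \<delta>: "0 < \<delta>" "\<And>t. 0 \<le> t \<Longrightarrow> t < \<delta> \<Longrightarrow> q + t *\<^sub>R \<nu> q \<in> closure \<Omega>"
    using normal_ray[OF q] by metis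
  have "k \<le> G q \<bullet> \<nu> q"
    by (rule one_sided_deriv_ge[OF ray_deriv[OF \<delta>], where \<delta> = "R/2"]) (use k R u_zero[OF q] in auto)
  then show ?thesis using k by simp
qed

text \<open>If the gradient at \<open>q\<close> is nonzero, continuity suffices. Otherwise the
  second derivative in direction \<open>e\<close> is positive near \<open>q\<close>: G \<bullet> e
  increases strictly from \<open>x\<close> to the exit point on the frontier, where it is at most 0
  because the domain is entered along -e.\<close>

lemma transversal_decrease:
  assumes q: "q \<in> frontier \<Omega>" and e: "e \<bullet> \<nu> q < 0" and e1: "norm e = 1"
  shows "\<exists>\<delta>>0. \<forall>x\<in>\<Omega> \<inter> ball q \<delta>. G x \<bullet> e < 0"
proof -
  have qc: "q \<in> closure \<Omega>" using q frontier_closure by blast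
  show ?thesis
  proof (cases "0 < G q \<bullet> \<nu> q")
    case True
    then have "G q \<bullet> e < 0" using G_normal[OF q, of e] e by (simp add: mult_pos_neg)
    moreover have "((\<lambda>x. G x \<bullet> e) \<longlongrightarrow> G q \<bullet> e) (at q within closure \<Omega>)"
      using G_cont qc unfolding continuous_on_def by (intro tendsto_intros) auto
    ultimately have "\<forall>\<^sub>F x in at q within closure \<Omega>. G x \<bullet> e < 0" by (intro order_tendstoD(2))
    then obtain \<delta> where \<delta>: "\<delta> > 0" "\<And>x. x \<in> closure \<Omega> \<Longrightarrow> x \<noteq> q \<Longrightarrow> dist x q < \<delta> \<Longrightarrow> G x \<bullet> e < 0"
      unfolding eventually_at by blast
    have "G x \<bullet> e < 0" if x: "x \<in> \<Omega> \<inter> ball q \<delta>" for x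
    proof (rule \<delta>(2))
      show "x \<noteq> q" using x frontier_notin[OF q] by auto
    qed (use x in_closure in \<open>auto simp: dist_commute\<close>)
    then show ?thesis using \<delta>(1) by blast
  next
    case False
    then have Gn: "G q \<bullet> \<nu> q = 0" using normal_deriv_nonneg[OF q] by simp
    then have Gq: "G q = 0" using G_normal_eq[OF q] by simp
    have tr: "0 < (\<Sum>b\<in>Basis. b \<bullet> H q b)" using normal_deriv_pos[OF q] Gn by force
    have He: "0 < e \<bullet> H q e" by (rule degenerate_hessian[OF q Gq tr e])
    have "((\<lambda>x. e \<bullet> H x e) \<longlongrightarrow> e \<bullet> H q e) (at q within closure \<Omega>)"
      using H_cont[of e] qc unfolding continuous_on_def by (intro tendsto_intros) auto
    then have "\<forall>\<^sub>F x in at q within closure \<Omega>. 0 < e \<bullet> H x e" using He by (rule order_tendstoD(1))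
    then obtain \<eta> where \<eta>: "\<eta> > 0" "\<And>x. x \<in> closure \<Omega> \<Longrightarrow> x \<noteq> q \<Longrightarrow> dist x q < \<eta> \<Longrightarrow> 0 < e \<bullet> H x e"
      unfolding eventually_at by blast
    obtain \<delta> where \<delta>: "\<delta> > 0" "\<And>x. x \<in> \<Omega> \<inter> ball q \<delta> \<Longrightarrow>
        \<exists>t>0. x + t *\<^sub>R e \<in> frontier \<Omega> \<and> (\<forall>s. 0 \<le> s \<and> s < t \<longrightarrow> x + s *\<^sub>R e \<in> \<Omega>) \<and>
        (\<forall>s. 0 \<le> s \<and> s \<le> t \<longrightarrow> x + s *\<^sub>R e \<in> ball q \<eta>)"
      using normal_transversal[OF q e e1 \<eta>(1)] by blast
    have "G x \<bullet> e < 0" if x: "x \<in> \<Omega> \<inter> ball q \<delta>" for x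
    proof -
      obtain t where t: "t > 0" "x + t *\<^sub>R e \<in> frontier \<Omega>" "\<And>s. 0 \<le> s \<Longrightarrow> s < t \<Longrightarrow> x + s *\<^sub>R e \<in> \<Omega>"
          "\<And>s. 0 \<le> s \<Longrightarrow> s \<le> t \<Longrightarrow> x + s *\<^sub>R e \<in> ball q \<eta>"
        using \<delta>(2)[OF x] by blast
      have cl: "x + s *\<^sub>R e \<in> closure \<Omega>" if "0 \<le> s" "s \<le> t" for s
        using t(2) t(3)[of s] that frontier_closure in_closure by (cases "s = t") auto
      have "continuous_on {0..t} (\<lambda>s. G (x + s *\<^sub>R e) \<bullet> e)"
        by (intro continuous_intros continuous_on_compose2[OF G_cont]) (use cl in auto)
      moreover have "((\<lambda>s. G (x + s *\<^sub>R e) \<bullet> e) has_derivative (\<lambda>h. (H (x + s *\<^sub>R e) e \<bullet> e) * h)) (at s)"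
        if "0 < s" "s < t" for s
        using G_line[of x s e e] t(3)[of s] that by (simp add: has_field_derivative_def)
      ultimately obtain s where s: "0 < s" "s < t"
          "G (x + t *\<^sub>R e) \<bullet> e - G (x + 0 *\<^sub>R e) \<bullet> e = (H (x + s *\<^sub>R e) e \<bullet> e) * (t - 0)"
        using mvt[of 0 t "\<lambda>s. G (x + s *\<^sub>R e) \<bullet> e" "\<lambda>s h. (H (x + s *\<^sub>R e) e \<bullet> e) * h"] t(1) by blast
      have sO: "x + s *\<^sub>R e \<in> \<Omega>" using t(3) s by simp
      have "0 < e \<bullet> H (x + s *\<^sub>R e) e"
        by (rule \<eta>(2)) (use sO in_closure frontier_notin[OF q] t(4)[of s] s in \<open>auto simp: dist_commute\<close>)
      then have "0 < (H (x + s *\<^sub>R e) e \<bullet> e) * (t - 0)" using t(1) by (simp add: inner_commute)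
      moreover have "0 \<le> G (x + t *\<^sub>R e) \<bullet> (- e)"
      proof (rule ray_nonneg[OF t(2) t(1)])
        fix r assume r: "0 \<le> r" "r < t"
        have eq: "x + t *\<^sub>R e + r *\<^sub>R (- e) = x + (t - r) *\<^sub>R e" by (simp add: algebra_simps)
        show "x + t *\<^sub>R e + r *\<^sub>R (- e) \<in> closure \<Omega>" unfolding eq by (rule cl) (use r in auto)
      qed
      ultimately show ?thesis using s(3) by simp
    qed
    then show ?thesis using \<delta>(1) by blast
  qed
qed

end

section \<open>Moving planes\<close>

lemma open_orthant: "open {x :: real^'m. \<forall>k. 0 < x $ k}"
proof -
  have "open (\<Inter>k. {x :: real^'m. 0 < x $ k})"
    by (intro open_INT ballI open_Collect_less continuous_intros) auto
  moreover have "(\<Inter>k. {x :: real^'m. 0 < x $ k}) = {x. \<forall>k. 0 < x $ k}" by auto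
  ultimately show ?thesis by simp
qed

section \<open>Monotonicity of the boundary condition\<close>

locale boundary_function =
  fixes F :: "real^'m \<Rightarrow> real"
  assumes F_C1: "C1_on {x. \<forall>k. 0 < x $ k} F"
    and F_mono: "\<forall>i x d. (\<forall>k. 0 \<le> x $ k) \<and> 0 < d \<longrightarrow> F x \<le> F (x + d *\<^sub>R axis i 1)"
    and F_strict: "\<exists>j. \<forall>x. (\<forall>k. 0 < x $ k) \<longrightarrow> partial_deriv F j x > 0"
begin

lemma F_deriv:
  assumes "\<And>k. 0 < x $ k"
  shows "(F has_derivative (\<lambda>h. (\<chi> i. partial_deriv F i x) \<bullet> h)) (at x)"
  by (rule C1_on_gradient[OF F_C1 open_orthant]) (use assms in simp)

lemma F_step: "(\<And>k. 0 \<le> x $ k) \<Longrightarrow> 0 < d \<Longrightarrow> F x \<le> F (x + d *\<^sub>R axis i 1)"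
  using F_mono by blast

lemma F_le:
  assumes x: "\<And>k. 0 \<le> x $ k" and y: "\<And>k. x $ k \<le> y $ k"
  shows "F x \<le> F y"
proof -
  have "F x \<le> F (\<chi> k. if k \<in> S then y $ k else x $ k)" if "finite S" for S
    using that
  proof (induction S)
    case empty
    have "(\<chi> k. if k \<in> {} then y $ k else x $ k) = x" by (simp add: vec_eq_iff)
    then show ?case by simp
  next
    case (insert j S)
    define z where "z = (\<chi> k. if k \<in> S then y $ k else x $ k)"
    have z0: "0 \<le> z $ k" for k using x[of k] order_trans[OF x[of k] y[of k]] by (simp add: z_def)
    have e: "(\<chi> k. if k \<in> insert j S then y $ k else x $ k) = z + (y $ j - x $ j) *\<^sub>R axis j 1"
      using insert(2) by (auto simp: vec_eq_iff z_def axis_def)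
    have "F z \<le> F (z + (y $ j - x $ j) *\<^sub>R axis j 1)"
    proof (cases "y $ j = x $ j")
      case False
      then have "0 < y $ j - x $ j" using y[of j] by simp
      then show ?thesis by (rule F_step[OF z0])
    qed simp
    then show ?case using insert(3) unfolding e z_def by simp
  qed
  from this[of UNIV] show ?thesis by simp
qed

text \<open>The partial derivative in \<open>F_strict\<close> is known to be positive only in the
  open orthant, and \<open>b\<close> may lie on its boundary. So half the increase of coordinate
  \<open>j\<close> is saved for a last step, which starts at the interior point
  \<open>a'\<close>.\<close>

lemma F_less:
  assumes b: "\<And>k. 0 \<le> b $ k" and a: "\<And>k. b $ k < a $ k"
  shows "F b < F a"
proof -
  obtain j where j: "\<And>x. (\<And>k. 0 < x $ k) \<Longrightarrow> partial_deriv F j x > 0" using F_strict by blast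
  define d where "d = (a $ j - b $ j) / 2"
  define a' where "a' = a - d *\<^sub>R axis j 1"
  have d: "d > 0" using a[of j] by (simp add: d_def)
  have a'k: "b $ k \<le> a' $ k" "0 < a' $ k" for k
    using a[of k] b[of k] by (auto simp: a'_def d_def axis_def field_simps)
  have "F b \<le> F a'" by (rule F_le[OF b a'k(1)])
  moreover have "F (a' + 0 *\<^sub>R axis j 1) < F (a' + d *\<^sub>R axis j 1)"
  proof (rule DERIV_pos_imp_increasing[OF d])
    fix t assume t: "0 \<le> t" "t \<le> d"
    have p: "0 < (a' + t *\<^sub>R axis j 1) $ k" for k using a'k(2)[of k] t by (simp add: axis_def add_pos_nonneg)
    have "((\<lambda>t. F (a' + t *\<^sub>R axis j 1)) has_real_derivative
        (\<chi> i. partial_deriv F i (a' + t *\<^sub>R axis j 1)) \<bullet> axis j 1) (at t)"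
      by (rule has_derivative_line[OF F_deriv[OF p]])
    then show "\<exists>y. ((\<lambda>t. F (a' + t *\<^sub>R axis j 1)) has_real_derivative y) (at t) \<and> 0 < y"
      using j[OF p] by (intro exI[of _ "(\<chi> i. partial_deriv F i (a' + t *\<^sub>R axis j 1)) \<bullet> axis j 1"]) (simp add: inner_axis)
  qed
  moreover have "a' + d *\<^sub>R axis j 1 = a" by (simp add: a'_def)
  ultimately show ?thesis by simp
qed

text \<open>The constant value of \<open>F\<close> forces \<Sum> p i * a $ i to be 0, but every p i
  is nonnegative, one is positive and all components of \<open>a\<close> are negative.\<close>

lemma F_curve:
  assumes b: "\<And>k. 0 < \<kappa> (0::real) $ k" and d: "(\<kappa> has_vector_derivative a) (at 0)" and a: "\<And>k. a $ k < 0"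
    and c: "\<And>t. F (\<kappa> t) = c"
  shows False
proof -
  define p where "p i = partial_deriv F i (\<kappa> 0)" for i
  have "((F \<circ> \<kappa>) has_vector_derivative (\<chi> i. p i) \<bullet> a) (at 0)"
    unfolding p_def using has_derivative_at_withinI[OF F_deriv[OF b]] by (intro vector_derivative_diff_chain_within[OF d])
  moreover have "F \<circ> \<kappa> = (\<lambda>t. c)" using c by auto
  ultimately have "((\<lambda>t::real. c) has_real_derivative (\<chi> i. p i) \<bullet> a) (at 0)"
    by (simp add: has_real_derivative_iff_has_vector_derivative)
  then have zero: "(\<chi> i. p i) \<bullet> a = 0" using DERIV_unique DERIV_const by metis
  have p0: "0 \<le> p i" for i
  proof (rule one_sided_deriv_ge[where \<delta> = 1 and k = 0])
    have "((\<lambda>t. F (\<kappa> 0 + t *\<^sub>R axis i 1)) has_real_derivative (\<chi> i. p i) \<bullet> axis i 1) (at 0)"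
      unfolding p_def by (rule has_derivative_line) (use F_deriv[OF b] in simp)
    then have "((\<lambda>t. F (\<kappa> 0 + t *\<^sub>R axis i 1) - F (\<kappa> 0)) has_real_derivative p i - 0) (at 0)"
      by (intro DERIV_diff DERIV_const) (simp add: inner_axis)
    then show "((\<lambda>t. F (\<kappa> 0 + t *\<^sub>R axis i 1) - F (\<kappa> 0)) has_real_derivative p i) (at 0 within {0..})"
      by (simp add: has_field_derivative_at_within)
    show "0 * t \<le> F (\<kappa> 0 + t *\<^sub>R axis i 1) - F (\<kappa> 0)" if "0 < t" for t
      using F_step[of "\<kappa> 0" t i, OF less_imp_le[OF b] that] by simp
  qed auto
  obtain j where j: "p j > 0" using F_strict b unfolding p_def by blast
  have "(\<Sum>i\<in>UNIV. p i * a $ i) < (\<Sum>i\<in>(UNIV::'m set). 0)"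
  proof (rule sum_strict_mono_ex1)
    show "\<forall>i\<in>UNIV. p i * a $ i \<le> 0" using p0 a less_imp_le by (intro ballI mult_nonneg_nonpos) auto
    show "\<exists>i\<in>UNIV. p i * a $ i < 0" using j a[of j] by (intro bexI[of _ j] mult_pos_neg) auto
  qed simp
  then show False using zero by (simp add: inner_vec_def)
qed

end

text \<open>The two reflections compose to the translation by 2 (m - l), whose iterates would leave
  a bounded set.\<close>

lemma real_reflections_unique:
  fixes l m :: real
  assumes a0: "a0 \<in> A" and B: "\<And>a. a \<in> A \<Longrightarrow> \<bar>a\<bar> \<le> B"
    and l: "\<And>a. a \<in> A \<Longrightarrow> 2 * l - a \<in> A" and m: "\<And>a. a \<in> A \<Longrightarrow> 2 * m - a \<in> A"
  shows "l = m"
proof (rule ccontr)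
  assume "l \<noteq> m"
  then have pos: "0 < \<bar>2 * (m - l)\<bar>" by simp
  have it: "a0 + real k * (2 * (m - l)) \<in> A" for k
  proof (induction k)
    case (Suc k)
    then have "2 * m - (2 * l - (a0 + real k * (2 * (m - l)))) \<in> A" using l m by blast
    moreover have "2 * m - (2 * l - (a0 + real k * (2 * (m - l)))) = a0 + real (Suc k) * (2 * (m - l))"
      by (simp add: algebra_simps)
    ultimately show ?case by (simp only:)
  qed (simp add: a0)
  obtain k where k: "2 * B < real k * \<bar>2 * (m - l)\<bar>" using reals_Archimedean3[OF pos] by blast
  have "\<bar>real k * (2 * (m - l))\<bar> \<le> \<bar>a0 + real k * (2 * (m - l))\<bar> + \<bar>a0\<bar>" by linarith
  also have "\<dots> \<le> B + B" using B[OF it] B[OF a0] by (rule add_mono)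
  finally show False using k by (simp add: abs_mult)
qed

section \<open>The full system and its critical hyperplane\<close>

locale overdetermined = smooth_domain \<Omega> \<nu> + boundary_function F
  for \<Omega> :: "'a::euclidean_space set" and \<nu> and F :: "real^'m \<Rightarrow> real" +
  fixes u :: "'m \<Rightarrow> 'a \<Rightarrow> real" and G :: "'m \<Rightarrow> 'a \<Rightarrow> 'a" and H :: "'m \<Rightarrow> 'a \<Rightarrow> 'a \<Rightarrow> 'a"
    and f g h :: "'m \<Rightarrow> real \<Rightarrow> real" and c :: real
  assumes sol: "\<And>i. dirichlet_solution \<Omega> \<nu> (u i) (G i) (H i) (f i) (g i) (h i)"
    and over: "x \<in> frontier \<Omega> \<Longrightarrow> F (\<chi> i. G i x \<bullet> \<nu> x) = c"
    and nonempty: "\<Omega> \<noteq> {}"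
begin

abbreviation ub :: "'m \<Rightarrow> 'a \<Rightarrow> real" where
  "ub i \<equiv> dirichlet_solution.ubar \<Omega> (u i)"

abbreviation mpi :: "'m \<Rightarrow> 'a \<Rightarrow> real \<Rightarrow> bool" where
  "mpi i \<equiv> dirichlet_solution.mp \<Omega> (u i)"

abbreviation cp :: "'a \<Rightarrow> real \<Rightarrow> 'a set" where
  "cp \<equiv> dirichlet_solution.cap \<Omega>"

abbreviation wi :: "'m \<Rightarrow> 'a \<Rightarrow> real \<Rightarrow> 'a \<Rightarrow> real" where
  "wi i \<equiv> dirichlet_solution.w \<Omega> (u i)"

lemmas mp_def' = dirichlet_solution.mp_def[OF sol]
lemmas cap_def' = dirichlet_solution.cap_def[OF sol]
lemmas w_def' = dirichlet_solution.w_def[OF sol]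
lemmas ub_pos = dirichlet_solution.ubar_pos[OF sol]
lemmas ub_nonneg = dirichlet_solution.ubar_nonneg[OF sol]
lemmas ub_in = dirichlet_solution.ubar_in[OF sol]
lemmas ub_out = dirichlet_solution.ubar_out[OF sol]
lemmas ub_cont = dirichlet_solution.ubar_cont[OF sol]
lemmas sol_C2 = dirichlet_solution.axioms(1)[OF sol]

lemma mpi_mono: "mpi i e l \<Longrightarrow> l \<le> l' \<Longrightarrow> mpi i e l'"
  unfolding mp_def' by (meson order_trans)

lemma bounded_inner:
  obtains B where "\<And>x e. x \<in> \<Omega> \<Longrightarrow> norm e = 1 \<Longrightarrow> \<bar>x \<bullet> e\<bar> \<le> B"
proof -
  obtain B where B: "\<And>x. x \<in> \<Omega> \<Longrightarrow> norm x \<le> B" using bounded_dom unfolding bounded_iff by blast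
  have "\<bar>x \<bullet> e\<bar> \<le> B" if "x \<in> \<Omega>" "norm e = 1" for x e
    using Cauchy_Schwarz_ineq2[of x e] B[OF that(1)] that(2) by simp
  then show ?thesis using that by blast
qed

lemma mpi_large:
  assumes B: "\<And>x. x \<in> \<Omega> \<Longrightarrow> \<bar>x \<bullet> e\<bar> \<le> B"
  shows "mpi i e B"
  unfolding mp_def'
proof (intro allI impI)
  fix x s assume s: "0 \<le> s" "B \<le> x \<bullet> e - s / 2"
  show "ub i x \<le> ub i (x - s *\<^sub>R e)"
  proof (cases "x \<in> \<Omega>")
    case True
    then have "s = 0" using B[OF True] s by linarith
    then show ?thesis by simp
  qed (simp add: ub_out ub_nonneg)
qed

text \<open>For a lower position the whole domain is a cap, and its reflection falls below
  -B.\<close>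

lemma mpi_bounded_below:
  assumes B: "\<And>x. x \<in> \<Omega> \<Longrightarrow> \<bar>x \<bullet> e\<bar> \<le> B" and e: "norm e = 1" and mp: "mpi i e l"
  shows "- B \<le> l"
proof (rule ccontr)
  assume l: "\<not> - B \<le> l"
  obtain x where x: "x \<in> \<Omega>" using nonempty by blast
  have "x \<in> cp e l" using B[OF x] l x by (simp add: cap_def')
  then have "mirror e l x \<in> \<Omega>" by (rule dirichlet_solution.mirror_cap[OF sol e mp])
  from B[OF this] B[OF x] l show False unfolding mirror_inner[OF e] by linarith
qed

text \<open>Shifting both points of a pair by \<epsilon> along \<open>e\<close> raises their
  midpoint by \<epsilon>, where the inequality is known; then \<epsilon> tends to 0.\<close>

lemma mpi_closed:
  assumes "\<And>\<epsilon>. 0 < \<epsilon> \<Longrightarrow> mpi i e (l + \<epsilon>)" and e: "norm e = 1"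
  shows "mpi i e l"
  unfolding mp_def'
proof (intro allI impI)
  fix x s assume s: "0 \<le> s" "l \<le> x \<bullet> e - s / 2"
  have cont: "((\<lambda>\<epsilon>. ub i (y + \<epsilon> *\<^sub>R e)) \<longlongrightarrow> ub i y) (at_right 0)" for y
  proof -
    have "((\<lambda>\<epsilon>::real. y + \<epsilon> *\<^sub>R e) \<longlongrightarrow> y + 0 *\<^sub>R e) (at_right 0)" by (intro tendsto_intros)
    then have "((\<lambda>\<epsilon>::real. y + \<epsilon> *\<^sub>R e) \<longlongrightarrow> y) (at_right 0)" by simp
    from continuous_on_tendsto_compose[OF ub_cont[of UNIV] this] show ?thesis by simp
  qed
  have "\<forall>\<^sub>F \<epsilon> in at_right 0. ub i (x + \<epsilon> *\<^sub>R e) \<le> ub i ((x - s *\<^sub>R e) + \<epsilon> *\<^sub>R e)"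
    using eventually_at_right_less[of "0::real"]
  proof eventually_elim
    case (elim \<epsilon>)
    have "l + \<epsilon> \<le> (x + \<epsilon> *\<^sub>R e) \<bullet> e - s / 2" using s by (simp add: inner_add_left unit_inner[OF e])
    then have "ub i (x + \<epsilon> *\<^sub>R e) \<le> ub i ((x + \<epsilon> *\<^sub>R e) - s *\<^sub>R e)"
      using assms(1)[OF elim] s(1) unfolding mp_def' by blast
    then show ?case by (simp add: algebra_simps)
  qed
  then show "ub i x \<le> ub i (x - s *\<^sub>R e)" by (rule tendsto_le[OF trivial_limit_at_right_real cont cont])
qed

text \<open>The index type is finite: if every component could be pushed further by its own amount,
  the least of these would contradict the infimum. So one index \<open>j\<close> blocks every
  smaller position.\<close>

lemma critical_position:
  assumes e: "norm e = 1"
  obtains l j where "\<And>i. mpi i e l" "\<And>\<epsilon>. 0 < \<epsilon> \<Longrightarrow> \<not> mpi j e (l - \<epsilon>)"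
proof -
  obtain B where "\<And>x e. x \<in> \<Omega> \<Longrightarrow> norm e = 1 \<Longrightarrow> \<bar>x \<bullet> e\<bar> \<le> B" using bounded_inner by metis
  then have B: "\<And>x. x \<in> \<Omega> \<Longrightarrow> \<bar>x \<bullet> e\<bar> \<le> B" using e by blast
  define P where "P = {l. \<forall>i. mpi i e l}"
  have BP: "B \<in> P" using mpi_large[OF B] by (simp add: P_def)
  have bdd: "bdd_below P" using mpi_bounded_below[OF B e] by (intro bdd_belowI[of _ "- B"]) (auto simp: P_def)
  define l where "l = Inf P"
  have mp: "mpi i e l" for i
  proof (rule mpi_closed[OF _ e])
    fix \<epsilon> :: real assume "0 < \<epsilon>"
    then have "Inf P < l + \<epsilon>" by (simp add: l_def)
    then obtain l' where "l' \<in> P" "l' < l + \<epsilon>" using cInf_lessD[of P] BP by blast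
    then show "mpi i e (l + \<epsilon>)" using mpi_mono[of i e l' "l + \<epsilon>"] by (simp add: P_def)
  qed
  have "\<exists>j. \<forall>\<epsilon>>0. \<not> mpi j e (l - \<epsilon>)"
  proof (rule ccontr)
    assume "\<not> ?thesis"
    then have "\<forall>j. \<exists>\<epsilon>>0. mpi j e (l - \<epsilon>)" by blast
    then obtain E where E: "\<And>j. E j > 0" "\<And>j. mpi j e (l - E j)" by metis
    define \<epsilon> where "\<epsilon> = Min (range E)"
    have \<epsilon>: "\<epsilon> > 0" "\<And>j. \<epsilon> \<le> E j" using E(1) by (auto simp: \<epsilon>_def)
    have "mpi j e (l - \<epsilon>)" for j by (rule mpi_mono[OF E(2)]) (use \<epsilon>(2)[of j] in simp)
    then have "l - \<epsilon> \<in> P" by (simp add: P_def)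
    then have "l \<le> l - \<epsilon>" unfolding l_def by (rule cInf_lower[OF _ bdd])
    then show False using \<epsilon> by simp
  qed
  then show ?thesis using that mp by blast
qed

text \<open>Disposes of failing pairs that collapse to one point: where \<open>u i\<close> decreases
  strictly along \<open>e\<close>, short pairs satisfy the inequality.\<close>

lemma no_decreasing_neighbourhood:
  assumes \<delta>: "0 < \<delta>" "\<And>z s. z \<in> \<Omega> \<Longrightarrow> dist z x < \<delta> \<Longrightarrow> 0 \<le> s \<Longrightarrow> s < \<delta> \<Longrightarrow> z - s *\<^sub>R e \<in> \<Omega> \<and> G i (z - s *\<^sub>R e) \<bullet> e < 0"
    and X: "\<And>n. X n \<in> \<Omega>" "X \<longlonglongrightarrow> x" and S: "\<And>n. 0 < S n" "S \<longlonglongrightarrow> 0"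
    and fail: "\<And>n. ub i (X n - S n *\<^sub>R e) < ub i (X n)"
  shows False
proof -
  have "\<forall>\<^sub>F n in sequentially. dist (X n) x < \<delta>" using X(2) \<delta>(1) by (rule tendstoD)
  moreover have "\<forall>\<^sub>F n in sequentially. S n < \<delta>" using S(2) \<delta>(1) by (rule order_tendstoD(2))
  ultimately have "\<forall>\<^sub>F n in sequentially. dist (X n) x < \<delta> \<and> S n < \<delta>" by (rule eventually_conj)
  then obtain n where n: "dist (X n) x < \<delta>" "S n < \<delta>" unfolding eventually_sequentially by blast
  have in\<Omega>: "X n - r *\<^sub>R e \<in> \<Omega> \<and> G i (X n - r *\<^sub>R e) \<bullet> e < - 0" if "0 \<le> r" "r \<le> S n" for r
    using \<delta>(2)[OF X(1) n(1) that(1)] that(2) n(2) by simp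
  have "u i (X n) + 0 * S n < u i (X n - S n *\<^sub>R e)"
    by (rule C2_function.decrease_along[OF sol_C2 S(1)]) (use in\<Omega> in blast)+
  then show False using fail[of n] in\<Omega>[of "S n"] S(1)[of n] X(1) by (simp add: ub_in)
qed

lemma critical_symmetric:
  assumes e: "norm e = 1" and mp: "\<And>i. mpi i e l" and crit: "\<And>\<epsilon>. 0 < \<epsilon> \<Longrightarrow> \<not> mpi j e (l - \<epsilon>)"
    and y: "y \<in> \<Omega>"
  shows "mirror e l y \<in> \<Omega>"
proof (rule ccontr)
  assume ny: "mirror e l y \<notin> \<Omega>"
  have wpos: "wi i e l x \<noteq> 0" if "x \<in> cp e l" for i x
    using dirichlet_solution.symmetric_of_touching[OF sol e mp that _ y] ny by blast
  obtain B where "\<And>x e. x \<in> \<Omega> \<Longrightarrow> norm e = 1 \<Longrightarrow> \<bar>x \<bullet> e\<bar> \<le> B" using bounded_inner by metis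
  then have B: "\<And>x. x \<in> \<Omega> \<Longrightarrow> \<bar>x \<bullet> e\<bar> \<le> B" using e by blast
  \<comment> \<open>Pairs that violate the inequality for \<open>j\<close> at positions tending to
    \<open>l\<close>.\<close>
  have "\<exists>x s. 0 \<le> s \<and> l - 1 / real (Suc n) \<le> x \<bullet> e - s / 2 \<and> ub j (x - s *\<^sub>R e) < ub j x" for n
    using crit[of "1 / real (Suc n)"] unfolding mp_def' by (auto simp: not_le)
  then obtain X S where XS: "\<And>n. 0 \<le> S n" "\<And>n. l - 1 / real (Suc n) \<le> X n \<bullet> e - S n / 2"
      "\<And>n. ub j (X n - S n *\<^sub>R e) < ub j (X n)" by metis
  have XO: "X n \<in> \<Omega>" for n using XS(3)[of n] ub_nonneg ub_pos le_less_trans by metis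
  have Spos: "0 < S n" for n using XS(1)[of n] XS(3)[of n] by (cases "S n = 0") auto
  \<comment> \<open>A violating pair cannot satisfy the condition at \<open>l\<close>, so the
    midpoints are squeezed between l - 1/(n+1) and \<open>l\<close>.\<close>
  have upper: "X n \<bullet> e - S n / 2 < l" for n
    using mp[of j] XS(1,3)[of n] unfolding mp_def' by (meson not_le)
  have Sb: "S n \<le> 2 * (B + \<bar>l\<bar> + 1)" for n
  proof -
    have aux: "S n \<le> 2 * (B + \<bar>l\<bar> + 1)" if "q \<le> 1" "l - q \<le> X n \<bullet> e - S n / 2" for q
      using that abs_le_D1[OF B[OF XO[of n]]] abs_ge_minus_self[of l] by (simp add: field_simps)
    have "1 / real (Suc n) \<le> 1" by simp
    then show ?thesis using XS(2)[of n] by (rule aux)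
  qed
  have cpt: "compact (closure \<Omega> \<times> {0..2 * (B + \<bar>l\<bar> + 1)})"
    using bounded_dom by (intro compact_Times) (auto simp: compact_closure)
  have mem: "(X n, S n) \<in> closure \<Omega> \<times> {0..2 * (B + \<bar>l\<bar> + 1)}" for n
    using XO[of n] XS(1)[of n] Sb[of n] closure_subset[of \<Omega>] by auto
  have "\<exists>p\<in>closure \<Omega> \<times> {0..2 * (B + \<bar>l\<bar> + 1)}. \<exists>r. strict_mono (r :: nat \<Rightarrow> nat) \<and> ((\<lambda>n. (X n, S n)) \<circ> r) \<longlonglongrightarrow> p"
    using cpt[unfolded compact_def, rule_format, of "\<lambda>n. (X n, S n)"] mem by simp
  then obtain p r where p: "p \<in> closure \<Omega> \<times> {0..2 * (B + \<bar>l\<bar> + 1)}" "strict_mono (r :: nat \<Rightarrow> nat)"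
      "((\<lambda>n. (X n, S n)) \<circ> r) \<longlonglongrightarrow> p"
    by blast
  define x s where "x = fst p" and "s = snd p"
  have xc: "x \<in> closure \<Omega>" and s0: "0 \<le> s" using p(1) by (auto simp: x_def s_def)
  have Xl: "(\<lambda>n. X (r n)) \<longlonglongrightarrow> x" using tendsto_fst[OF p(3)] by (simp add: o_def x_def)
  have Sl: "(\<lambda>n. S (r n)) \<longlonglongrightarrow> s" using tendsto_snd[OF p(3)] by (simp add: o_def s_def)
  have lim: "(\<lambda>n. X (r n) \<bullet> e - S (r n) / 2) \<longlonglongrightarrow> x \<bullet> e - s / 2" by (intro tendsto_intros Xl Sl) simp
  have inv: "(\<lambda>n. l - 1 / real (Suc (r n))) \<longlonglongrightarrow> l - 0"
    using LIMSEQ_subseq_LIMSEQ[OF LIMSEQ_Suc[OF lim_1_over_n] p(2)] by (intro tendsto_diff) (auto simp: o_def)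
  have "l - 0 \<le> x \<bullet> e - s / 2" by (rule LIMSEQ_le[OF inv lim]) (use XS(2) in blast)
  moreover have "x \<bullet> e - s / 2 \<le> l" by (rule LIMSEQ_le_const2[OF lim]) (use upper less_imp_le in blast)
  ultimately have xs: "x \<bullet> e - s / 2 = l" by simp
  have "(\<lambda>n. ub j (X (r n) - S (r n) *\<^sub>R e)) \<longlonglongrightarrow> ub j (x - s *\<^sub>R e)"
    by (rule continuous_on_tendsto_compose[OF ub_cont[of UNIV]]) (auto intro!: tendsto_intros Xl Sl)
  moreover have "(\<lambda>n. ub j (X (r n))) \<longlonglongrightarrow> ub j x"
    by (rule continuous_on_tendsto_compose[OF ub_cont[of UNIV] Xl]) auto
  ultimately have "ub j (x - s *\<^sub>R e) \<le> ub j x" by (rule LIMSEQ_le) (use XS(3) less_imp_le in blast)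
  moreover have "ub j x \<le> ub j (x - s *\<^sub>R e)" using mp[of j] s0 xs unfolding mp_def' by simp
  ultimately have eq: "ub j (x - s *\<^sub>R e) = ub j x" by simp
  show False
  \<comment> \<open>The midpoint of the limit pair lies on the critical hyperplane. For s > 0 its
    points are distinct mirror images; for s = 0 the pairs collapse to a point of the
    hyperplane.\<close>
  proof (cases "s = 0")
    case False
    then have sp: "0 < s" using s0 by simp
    have xs': "x - s *\<^sub>R e = mirror e l x" using xs by (simp add: mirror_def algebra_simps)
    have xl: "l < x \<bullet> e" using xs sp by simp
    have xf: "x \<in> frontier \<Omega>"
    proof (rule ccontr)
      assume "x \<notin> frontier \<Omega>"
      then have "x \<in> cp e l" using closure_cases[OF xc] xl by (simp add: cap_def')
      then show False using wpos[of x j] eq by (simp add: w_def' xs')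
    qed
    have "mirror e l x \<notin> \<Omega>" using eq ub_pos[of j "mirror e l x"] ub_out[of x j] frontier_notin[OF xf] by (simp add: xs')
    moreover have "mirror e l x \<in> closure \<Omega>"
    proof (rule Lim_in_closed_set[OF closed_closure])
      show "(\<lambda>n. mirror e l (X (r n))) \<longlonglongrightarrow> mirror e l x"
        by (rule continuous_on_tendsto_compose[OF continuous_mirror[of UNIV] Xl]) auto
      have "(\<lambda>n. X (r n) \<bullet> e) \<longlonglongrightarrow> x \<bullet> e" by (intro tendsto_intros Xl)
      then have "\<forall>\<^sub>F n in sequentially. l < X (r n) \<bullet> e" using xl by (rule order_tendstoD(1))
      then show "\<forall>\<^sub>F n in sequentially. mirror e l (X (r n)) \<in> closure \<Omega>"
      proof eventually_elim
        case (elim n)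
        then have "X (r n) \<in> cp e l" using XO by (simp add: cap_def')
        then have "mirror e l (X (r n)) \<in> \<Omega>" by (rule dirichlet_solution.mirror_cap[OF sol e mp])
        then show ?case using closure_subset by blast
      qed
    qed simp
    ultimately have yf: "mirror e l x \<in> frontier \<Omega>" using closure_cases by blast
    have "F (\<chi> i. G i x \<bullet> \<nu> x) < F (\<chi> i. G i (mirror e l x) \<bullet> \<nu> (mirror e l x))"
    proof (rule F_less)
      show "0 \<le> (\<chi> i. G i x \<bullet> \<nu> x) $ k" for k
        using dirichlet_solution.normal_deriv_nonneg[OF sol xf] by simp
      show "(\<chi> i. G i x \<bullet> \<nu> x) $ k < (\<chi> i. G i (mirror e l x) \<bullet> \<nu> (mirror e l x)) $ k" for k
        using dirichlet_solution.hopf_boundary[OF sol e mp wpos xf xl yf] by simp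
    qed
    then show False using over[OF xf] over[OF yf] by simp
  next
    case True
    then have xl: "x \<bullet> e = l" using xs by simp
    have Sl0: "(\<lambda>n. S (r n)) \<longlonglongrightarrow> 0" using Sl True by simp
    note contra = no_decreasing_neighbourhood[where i = j and x = x and e = e and X = "\<lambda>n. X (r n)" and S = "\<lambda>n. S (r n)",
        OF _ _ XO Xl Spos Sl0 XS(3)]
    consider "x \<in> \<Omega>" | "x \<in> frontier \<Omega>" using closure_cases[OF xc] by blast
    then show False
    proof cases
      case 1
      have neg: "G j x \<bullet> e < 0" by (rule dirichlet_solution.hopf_plane[OF sol e mp wpos 1 xl])
      have "isCont (\<lambda>y. G j y \<bullet> e) x"
        using has_derivative_continuous[OF C2_function.G_at[OF sol_C2 1]] by (intro continuous_intros)
      then have "\<forall>\<^sub>F y in nhds x. G j y \<bullet> e < 0"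
        by (rule order_tendstoD(2)[OF isCont_tendsto_nhds]) (rule neg)
      moreover have "\<forall>\<^sub>F y in nhds x. y \<in> \<Omega>" by (rule eventually_nhds_in_open[OF open_dom 1])
      ultimately have "\<forall>\<^sub>F y in nhds x. G j y \<bullet> e < 0 \<and> y \<in> \<Omega>" by (rule eventually_conj)
      then obtain d where d: "d > 0" "\<And>y. dist y x < d \<Longrightarrow> G j y \<bullet> e < 0 \<and> y \<in> \<Omega>"
        unfolding eventually_nhds_metric by blast
      show False
      proof (rule contra)
        show "0 < d / 2" using d by simp
        fix z s assume z: "dist z x < d / 2" "0 \<le> s" "s < d / 2"
        have "dist (z - s *\<^sub>R e) x \<le> dist (z - s *\<^sub>R e) z + dist z x" by (rule dist_triangle)
        also have "\<dots> < d" using z e by (simp add: dist_norm)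
        finally show "z - s *\<^sub>R e \<in> \<Omega> \<and> G j (z - s *\<^sub>R e) \<bullet> e < 0" using d(2) by blast
      qed
    next
      case 2
      consider "0 < e \<bullet> \<nu> x" | "e \<bullet> \<nu> x < 0" | "e \<bullet> \<nu> x = 0" by linarith
      then show False
      proof cases
        case 1
        \<comment> \<open>Here \<open>mp\<close> fails outright: x + t e is in \<Omega> while its
          mirror image x - t e is outside the closure.\<close>
        obtain d where d: "d > 0" "\<And>t. 0 < t \<Longrightarrow> t < d \<Longrightarrow> x + t *\<^sub>R e \<in> \<Omega> \<and> x + t *\<^sub>R (- e) \<notin> closure \<Omega>"
          using normal_enter[OF 2 1] by blast
        define t where "t = d / 2"
        have t: "0 < t" "t < d" using d(1) by (auto simp: t_def)
        have "l \<le> (x + t *\<^sub>R e) \<bullet> e - (2 * t) / 2" using xl by (simp add: inner_add_left unit_inner[OF e])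
        then have "ub j (x + t *\<^sub>R e) \<le> ub j (x + t *\<^sub>R e - (2 * t) *\<^sub>R e)"
          using mp[of j] t(1) unfolding mp_def' by (metis mult_nonneg_nonneg less_imp_le zero_le_numeral)
        moreover have "x + t *\<^sub>R e - (2 * t) *\<^sub>R e = x + t *\<^sub>R (- e)"
          unfolding mult_2 scaleR_add_left by simp
        ultimately have "0 < ub j (x + t *\<^sub>R (- e))"
          using d(2)[OF t] ub_pos[of j "x + t *\<^sub>R e"] by simp
        then show False using d(2)[OF t] ub_pos closure_subset by blast
      next
        case neg: 2
        obtain d1 where d1: "d1 > 0" "\<And>z. z \<in> \<Omega> \<inter> ball x d1 \<Longrightarrow> G j z \<bullet> e < 0"
          using dirichlet_solution.transversal_decrease[OF sol 2 neg e] by blast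
        obtain d2 where d2: "d2 > 0" "\<And>z s. z \<in> \<Omega> \<inter> ball x d2 \<Longrightarrow> 0 \<le> s \<Longrightarrow> s \<le> d2 \<Longrightarrow> z - s *\<^sub>R e \<in> \<Omega> \<inter> ball x d1"
          using normal_transversal[OF 2 neg e d1(1)] by blast
        show False
        proof (rule contra[OF d2(1)])
          fix z s assume z: "z \<in> \<Omega>" "dist z x < d2" "0 \<le> s" "s < d2"
          have "z - s *\<^sub>R e \<in> \<Omega> \<inter> ball x d1" by (rule d2(2)) (use z in \<open>auto simp: dist_commute\<close>)
          then show "z - s *\<^sub>R e \<in> \<Omega> \<and> G j (z - s *\<^sub>R e) \<bullet> e < 0" using d1(2) by blast
        qed
      next
        case 3
        have neg: "\<nu> x \<bullet> H i x e < 0" for i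
          by (rule dirichlet_solution.corner_hessian[OF sol e mp wpos 2 xl 3])
        obtain k where k: "\<And>t. k t \<in> frontier \<Omega>" "k (0::real) = x" "(k has_vector_derivative e) (at 0)"
            "(\<lambda>t. \<nu> (k t)) differentiable (at 0)"
          using normal_curve[OF 2 3] by metis
        obtain n' where n': "((\<lambda>t. \<nu> (k t)) has_vector_derivative n') (at 0)"
          using k(4) by (auto simp: differentiable_iff_scaleR has_vector_derivative_def)
        \<comment> \<open>Differentiating |\<nu>|^2 = 1 shows that the derivative of \<nu> is
          tangential. As \<open>G i x\<close> is normal, only the Hessian term survives in the
          derivative of the normal derivative.\<close>
        have nn: "\<nu> (k t) \<bullet> \<nu> (k t) = 1" for t using normal_unit[OF k(1)] by (simp add: norm_eq_1)
        have "((\<lambda>t. \<nu> (k t) \<bullet> \<nu> (k t)) has_vector_derivative (\<nu> (k 0) \<bullet> n' + n' \<bullet> \<nu> (k 0))) (at 0)"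
          by (rule bounded_bilinear.has_vector_derivative[OF bounded_bilinear_inner n' n'])
        then have "((\<lambda>t::real. 1::real) has_real_derivative (\<nu> (k 0) \<bullet> n' + n' \<bullet> \<nu> (k 0))) (at 0)"
          unfolding nn has_real_derivative_iff_has_vector_derivative .
        then have "\<nu> (k 0) \<bullet> n' + n' \<bullet> \<nu> (k 0) = 0" using DERIV_unique DERIV_const by metis
        then have n'0: "n' \<bullet> \<nu> x = 0" by (simp add: inner_commute k(2))
        define \<kappa> where "\<kappa> i t = G i (k t) \<bullet> \<nu> (k t)" for i t
        have d\<kappa>: "(\<kappa> i has_vector_derivative (\<nu> x \<bullet> H i x e)) (at 0)" for i
        proof -
          have dG: "((\<lambda>t. G i (k t)) has_vector_derivative H i (k 0) e) (at 0)"
            by (rule C2_function.G_curve(1)[OF sol_C2 _ k(3)]) (use k(1) frontier_closure in blast)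
          have "((\<lambda>t. G i (k t) \<bullet> \<nu> (k t)) has_vector_derivative (G i (k 0) \<bullet> n' + H i (k 0) e \<bullet> \<nu> (k 0))) (at 0)"
            by (rule bounded_bilinear.has_vector_derivative[OF bounded_bilinear_inner dG n'])
          moreover have "G i x \<bullet> n' = 0" using dirichlet_solution.G_normal[OF sol 2, of i n'] n'0 by simp
          ultimately show ?thesis unfolding \<kappa>_def[abs_def] k(2) by (simp add: inner_commute)
        qed
        have \<kappa>nn: "0 \<le> \<kappa> i t" for i t unfolding \<kappa>_def by (rule dirichlet_solution.normal_deriv_nonneg[OF sol k(1)])
        \<comment> \<open>Puts the curve at time 0 into the open orthant, where \<open>F\<close> is
          differentiable: a zero there would be a minimum of the nonnegative function \<kappa> i,
          against its nonzero derivative.\<close>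
        have \<kappa>pos: "0 < \<kappa> i 0" for i
        proof (rule ccontr)
          assume "\<not> 0 < \<kappa> i 0"
          then have z: "\<kappa> i 0 = 0" using \<kappa>nn[of i 0] by simp
          have "\<nu> x \<bullet> H i x e = 0"
            by (rule DERIV_local_min[of "\<kappa> i" _ 0 1])
               (use d\<kappa>[of i] z \<kappa>nn in \<open>auto simp: has_real_derivative_iff_has_vector_derivative\<close>)
          then show False using neg[of i] by simp
        qed
        show False
        proof (rule F_curve)
          show "((\<lambda>t. \<chi> i. \<kappa> i t) has_vector_derivative (\<chi> i. \<nu> x \<bullet> H i x e)) (at 0)"
            unfolding has_vector_derivative_def
            by (rule vec_has_derivative) (use d\<kappa> in \<open>simp add: has_vector_derivative_def\<close>)
          show "F (\<chi> i. \<kappa> i t) = c" for t unfolding \<kappa>_def by (rule over[OF k(1)])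
        qed (use \<kappa>pos neg in auto)
      qed
    qed
  qed
qed

end

section \<open>From symmetry in all directions to balls and radial functions\<close>

context overdetermined
begin

text \<open>Only the effect on the coordinate along \<open>e\<close> matters, so a hyperplane
  reflection can also be compared with a point reflection.\<close>

lemma reflections_unique:
  assumes e: "norm e = 1"
    and \<sigma>: "\<And>x. x \<in> \<Omega> \<Longrightarrow> \<sigma> x \<in> \<Omega>" "\<And>x. \<sigma> x \<bullet> e = 2 * l - x \<bullet> e"
    and \<tau>: "\<And>x. x \<in> \<Omega> \<Longrightarrow> \<tau> x \<in> \<Omega>" "\<And>x. \<tau> x \<bullet> e = 2 * m - x \<bullet> e"
  shows "l = m"
proof -
  obtain B where B: "\<And>x e. x \<in> \<Omega> \<Longrightarrow> norm e = 1 \<Longrightarrow> \<bar>x \<bullet> e\<bar> \<le> B" using bounded_inner by metis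
  obtain x0 where x0: "x0 \<in> \<Omega>" using nonempty by blast
  show ?thesis
  proof (rule real_reflections_unique)
    show "x0 \<bullet> e \<in> (\<lambda>x. x \<bullet> e) ` \<Omega>" using x0 by blast
    show "\<bar>a\<bar> \<le> B" if "a \<in> (\<lambda>x. x \<bullet> e) ` \<Omega>" for a using that B[OF _ e] by auto
    show "2 * l - a \<in> (\<lambda>x. x \<bullet> e) ` \<Omega>" if a: "a \<in> (\<lambda>x. x \<bullet> e) ` \<Omega>" for a
    proof -
      obtain x where x: "x \<in> \<Omega>" "a = x \<bullet> e" using a by blast
      then show ?thesis by (intro image_eqI[where x = "\<sigma> x"]) (simp_all add: \<sigma>)
    qed
    show "2 * m - a \<in> (\<lambda>x. x \<bullet> e) ` \<Omega>" if a: "a \<in> (\<lambda>x. x \<bullet> e) ` \<Omega>" for a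
    proof -
      obtain x where x: "x \<in> \<Omega>" "a = x \<bullet> e" using a by blast
      then show ?thesis by (intro image_eqI[where x = "\<tau> x"]) (simp_all add: \<tau>)
    qed
  qed
qed

text \<open>The critical positions for the basis directions define \<open>a\<close>, and the
  composition of the basis reflections is the point reflection in \<open>a\<close>. In any direction
  \<open>e\<close> this and the mirror at \<Lambda> e both reflect the coordinate along
  \<open>e\<close>, so uniqueness gives \<Lambda> e = a \<bullet> e.\<close>

lemma symmetry_centre:
  obtains a where "\<And>e i. norm e = 1 \<Longrightarrow> mpi i e (a \<bullet> e)"
    "\<And>e x. norm e = 1 \<Longrightarrow> x \<in> \<Omega> \<Longrightarrow> mirror e (a \<bullet> e) x \<in> \<Omega>"
proof -
  have "\<exists>l. (\<forall>i. mpi i e l) \<and> (\<forall>x\<in>\<Omega>. mirror e l x \<in> \<Omega>)" if e: "norm e = 1" for e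
  proof -
    obtain l j where "\<And>i. mpi i e l" "\<And>\<epsilon>. 0 < \<epsilon> \<Longrightarrow> \<not> mpi j e (l - \<epsilon>)" using critical_position[OF e] by metis
    then show ?thesis using critical_symmetric[OF e] by blast
  qed
  then obtain \<Lambda> where \<Lambda>: "\<And>e i. norm e = 1 \<Longrightarrow> mpi i e (\<Lambda> e)"
      "\<And>e x. norm e = 1 \<Longrightarrow> x \<in> \<Omega> \<Longrightarrow> mirror e (\<Lambda> e) x \<in> \<Omega>" by metis
  define a where "a = (\<Sum>b\<in>Basis. \<Lambda> b *\<^sub>R b)"
  have central: "2 *\<^sub>R a - x \<in> \<Omega>" if x: "x \<in> \<Omega>" for x
  proof -
    \<comment> \<open>Reflections in orthogonal directions change separate coordinates, so composing
      those in \<open>S\<close> adds up their displacements.\<close>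
    have "S \<subseteq> Basis \<Longrightarrow> x + (\<Sum>b\<in>S. (2 * (\<Lambda> b - x \<bullet> b)) *\<^sub>R b) \<in> \<Omega>" if "finite S" for S
      using that
    proof (induction S)
      case empty
      then show ?case using x by simp
    next
      case (insert b S)
      define y where "y = x + (\<Sum>b\<in>S. (2 * (\<Lambda> b - x \<bullet> b)) *\<^sub>R b)"
      have b: "b \<in> Basis" "norm b = 1" using insert.prems by auto
      have "(\<Sum>b'\<in>S. (2 * (\<Lambda> b' - x \<bullet> b')) *\<^sub>R b') \<bullet> b = 0"
        unfolding inner_sum_left
        by (rule sum.neutral) (use insert.hyps(2) insert.prems b in \<open>auto simp: inner_Basis subset_iff\<close>)
      then have "y \<bullet> b = x \<bullet> b" by (simp add: y_def inner_add_left)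
      moreover have "y \<in> \<Omega>" using insert unfolding y_def by auto
      ultimately have "y + (2 * (\<Lambda> b - x \<bullet> b)) *\<^sub>R b \<in> \<Omega>" using \<Lambda>(2)[OF b(2), of y] by (simp add: mirror_def)
      then show ?case using insert.hyps by (simp add: y_def algebra_simps)
    qed
    from this[of Basis] have "x + (\<Sum>b\<in>Basis. (2 * (\<Lambda> b - x \<bullet> b)) *\<^sub>R b) \<in> \<Omega>" by simp
    moreover have "(\<Sum>b\<in>Basis. (2 * (\<Lambda> b - x \<bullet> b)) *\<^sub>R b) = 2 *\<^sub>R a - 2 *\<^sub>R x"
    proof -
      have "(\<Sum>b\<in>Basis. (2 * (\<Lambda> b - x \<bullet> b)) *\<^sub>R b) = (\<Sum>b\<in>Basis. 2 *\<^sub>R (\<Lambda> b *\<^sub>R b) - 2 *\<^sub>R ((x \<bullet> b) *\<^sub>R b))"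
        by (intro sum.cong refl) (simp add: algebra_simps)
      then show ?thesis
        unfolding sum_subtractf scaleR_sum_right[symmetric] a_def euclidean_representation .
    qed
    ultimately show ?thesis by (simp add: scaleR_2)
  qed
  have "\<Lambda> e = a \<bullet> e" if e: "norm e = 1" for e
    by (rule reflections_unique[OF e, where \<sigma> = "mirror e (\<Lambda> e)" and \<tau> = "\<lambda>x. 2 *\<^sub>R a - x"])
       (use \<Lambda>(2)[OF e] central mirror_inner[OF e] in \<open>auto simp: inner_diff_left\<close>)
  then show ?thesis using that[of a] \<Lambda> by metis
qed

context
  fixes a
  assumes mp: "\<And>e i. norm e = 1 \<Longrightarrow> mpi i e (a \<bullet> e)"
    and sym: "\<And>e x. norm e = 1 \<Longrightarrow> x \<in> \<Omega> \<Longrightarrow> mirror e (a \<bullet> e) x \<in> \<Omega>"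
begin

text \<open>The hypothesis holds for \<open>e\<close> and for \<open>- e\<close> with the same
  hyperplane, and the two inequalities are opposite.\<close>

lemma ub_mirror:
  assumes e: "norm e = 1"
  shows "ub i (mirror e (a \<bullet> e) x) = ub i x"
proof -
  have *: "ub i (mirror e (a \<bullet> e) x) = ub i x" if x: "a \<bullet> e \<le> x \<bullet> e" for x
  proof (rule antisym)
    show "ub i x \<le> ub i (mirror e (a \<bullet> e) x)"
      using dirichlet_solution.w_nonneg[OF sol e mp[OF e] x, of i] by (simp add: w_def')
    have e': "norm (- e) = 1" using e by simp
    have "a \<bullet> (- e) \<le> mirror e (a \<bullet> e) x \<bullet> (- e)" using x mirror_inner[OF e, of "a \<bullet> e" x] by simp
    from dirichlet_solution.w_nonneg[OF sol e' mp[OF e'] this, of i]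
    have "ub i (mirror e (a \<bullet> e) x) \<le> ub i (mirror (- e) (a \<bullet> (- e)) (mirror e (a \<bullet> e) x))" by (simp add: w_def')
    also have "mirror (- e) (a \<bullet> (- e)) z = mirror e (a \<bullet> e) z" for z by (simp add: mirror_def algebra_simps)
    finally show "ub i (mirror e (a \<bullet> e) x) \<le> ub i x" unfolding mirror_mirror[OF e] .
  qed
  show ?thesis
  proof (cases "a \<bullet> e \<le> x \<bullet> e")
    case False
    then have "a \<bullet> e \<le> mirror e (a \<bullet> e) x \<bullet> e" by (simp add: mirror_inner[OF e])
    from *[OF this] show ?thesis unfolding mirror_mirror[OF e] by simp
  qed (rule *)
qed

text \<open>Points equidistant from \<open>a\<close> are mirror images in their perpendicular
  bisector, a hyperplane through \<open>a\<close>.\<close>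

lemma ub_radial:
  assumes d: "dist a x = dist a y"
  shows "ub i x = ub i y"
proof (cases "x = y")
  case False
  define e where "e = (1 / norm (x - y)) *\<^sub>R (x - y)"
  have n: "norm (x - y) > 0" using False by simp
  have e: "norm e = 1" using n by (simp add: e_def)
  have "(x - a) \<bullet> (x - a) = (y - a) \<bullet> (y - a)"
    using d by (simp add: dist_norm norm_minus_commute[of a] power2_norm_eq_inner[symmetric])
  then have "2 * ((x - a) \<bullet> (x - y)) = (x - y) \<bullet> (x - y)"
    by (simp add: inner_diff_left inner_diff_right inner_commute)
  also have "\<dots> = norm (x - y) * norm (x - y)" by (simp add: power2_norm_eq_inner[symmetric] power2_eq_square)
  finally have "2 * ((x - a) \<bullet> (x - y)) = norm (x - y) * norm (x - y)" .
  moreover have "(x - a) \<bullet> e = (x - a) \<bullet> (x - y) / norm (x - y)" unfolding e_def inner_scaleR_right by simp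
  ultimately have "2 * ((x - a) \<bullet> e) = norm (x - y)" using n by simp
  then have "2 * (a \<bullet> e - x \<bullet> e) = - norm (x - y)" by (simp add: inner_diff_left)
  then have "mirror e (a \<bullet> e) x = y" using n by (simp add: mirror_def e_def)
  then show ?thesis using ub_mirror[OF e, of i x] by simp
qed simp

lemma unit_direction:
  obtains e where "norm e = 1" "x = a + dist a x *\<^sub>R e"
proof (cases "x = a")
  case True
  obtain b :: 'a where "b \<in> Basis" using nonempty_Basis by blast
  then show ?thesis using that[of b] True by simp
next
  case False
  then show ?thesis using that[of "(1 / dist a x) *\<^sub>R (x - a)"] by (simp add: dist_norm norm_minus_commute)
qed

text \<open>By \<open>mp\<close> at the hyperplane through \<open>a\<close>, \<open>ub i\<close>
  does not increase along rays from \<open>a\<close>: the point at distance \<open>dist a y\<close>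
  on the ray through \<open>x\<close> is paired with \<open>x\<close>, and their midpoint is beyond
  \<open>a\<close>. Since \<open>ub i\<close> is radial and positive exactly on \<Omega>, membership
  depends on the distance to \<open>a\<close> and passes to smaller distances.\<close>

lemma domain_ball: "\<exists>R>0. \<Omega> = ball a R"
proof -
  obtain i :: 'm where True by simp
  have down: "y \<in> \<Omega>" if x: "x \<in> \<Omega>" and y: "dist a y \<le> dist a x" for x y
  proof -
    obtain e where e: "norm e = 1" "x = a + dist a x *\<^sub>R e" by (rule unit_direction)
    define s where "s = dist a x - dist a y"
    have s: "0 \<le> s" using y by (simp add: s_def)
    have "x \<bullet> e = (a + dist a x *\<^sub>R e) \<bullet> e" using e(2) by simp
    then have xe: "x \<bullet> e = a \<bullet> e + dist a x" by (simp add: inner_add_left unit_inner[OF e(1)])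
    have "dist a y \<ge> 0" by simp
    then have "a \<bullet> e \<le> x \<bullet> e - s / 2" using y xe by (simp add: s_def field_simps)
    then have "ub i x \<le> ub i (x - s *\<^sub>R e)" using mp[OF e(1), of i] s unfolding mp_def' by blast
    also have "x - s *\<^sub>R e = (a + dist a x *\<^sub>R e) - s *\<^sub>R e" using e(2) by simp
    also have "\<dots> = a + dist a y *\<^sub>R e" by (simp add: s_def scaleR_diff_left)
    also have "ub i (a + dist a y *\<^sub>R e) = ub i y" by (rule ub_radial) (simp add: dist_norm e(1))
    finally show ?thesis using x ub_pos[of i x] ub_pos[of i y] by simp
  qed
  define R where "R = Sup (dist a ` \<Omega>)"
  have bdd: "bdd_above (dist a ` \<Omega>)"
  proof -
    obtain M where "\<forall>y\<in>\<Omega>. dist a y \<le> M" using bounded_dom unfolding bounded_any_center[of \<Omega> a] by blast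
    then show ?thesis by (intro bdd_aboveI[of _ M]) auto
  qed
  have ne: "dist a ` \<Omega> \<noteq> {}" using nonempty by simp
  have "\<Omega> = ball a R"
  proof
    show "\<Omega> \<subseteq> ball a R"
    proof
      fix x assume x: "x \<in> \<Omega>"
      obtain \<delta> where \<delta>: "\<delta> > 0" "ball x \<delta> \<subseteq> \<Omega>" using open_dom x by (auto simp: open_contains_ball)
      obtain e where e: "norm e = 1" "x = a + dist a x *\<^sub>R e" by (rule unit_direction)
      have "x + (\<delta> / 2) *\<^sub>R e \<in> ball x \<delta>" using e(1) \<delta>(1) by (simp add: dist_norm)
      then have "x + (\<delta> / 2) *\<^sub>R e \<in> \<Omega>" using \<delta>(2) by blast
      then have "dist a (x + (\<delta> / 2) *\<^sub>R e) \<le> R" unfolding R_def by (intro cSup_upper[OF _ bdd]) auto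
      moreover have "x + (\<delta> / 2) *\<^sub>R e = a + (dist a x + \<delta> / 2) *\<^sub>R e"
      proof -
        have "x + (\<delta> / 2) *\<^sub>R e = (a + dist a x *\<^sub>R e) + (\<delta> / 2) *\<^sub>R e" using e(2) by simp
        then show ?thesis by (simp add: scaleR_add_left)
      qed
      moreover have "dist a (a + (dist a x + \<delta> / 2) *\<^sub>R e) = dist a x + \<delta> / 2"
        using e(1) \<delta>(1) by (simp add: dist_norm)
      ultimately show "x \<in> ball a R" using \<delta>(1) by simp
    qed
    show "ball a R \<subseteq> \<Omega>"
    proof
      fix y assume "y \<in> ball a R"
      then have "dist a y < Sup (dist a ` \<Omega>)" by (simp add: R_def)
      then obtain x where "x \<in> \<Omega>" "dist a y < dist a x" using less_cSup_iff[OF ne bdd] by auto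
      then show "y \<in> \<Omega>" using down by simp
    qed
  qed
  moreover have "R > 0" using calculation nonempty by (metis ball_eq_empty not_less)
  ultimately show ?thesis by blast
qed

text \<open>\<open>hopf_plane\<close> is applied to the hyperplane through the point itself,
  strictly beyond the centre. Touching there would make \<Omega> symmetric in a second parallel
  hyperplane, which \<open>reflections_unique\<close> excludes.\<close>

lemma radial_derivative_neg:
  assumes e: "norm e = 1" and r: "0 < r" and x: "a + r *\<^sub>R e \<in> \<Omega>"
  shows "\<exists>D<0. ((\<lambda>r. ub i (a + r *\<^sub>R e)) has_real_derivative D) (at r)"
proof -
  define x where "x = a + r *\<^sub>R e"
  have xO: "x \<in> \<Omega>" using x by (simp add: x_def)
  have xe: "x \<bullet> e = a \<bullet> e + r" by (simp add: x_def inner_add_left unit_inner[OF e])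
  have mp': "mpi i e (x \<bullet> e)" by (rule mpi_mono[OF mp[OF e]]) (use xe r in simp)
  have "wi i e (x \<bullet> e) z \<noteq> 0" if z: "z \<in> cp e (x \<bullet> e)" for z
  proof
    assume w0: "wi i e (x \<bullet> e) z = 0"
    have "x \<bullet> e = a \<bullet> e"
    proof (rule reflections_unique[OF e, where \<sigma> = "mirror e (x \<bullet> e)" and \<tau> = "mirror e (a \<bullet> e)"])
      show "mirror e (x \<bullet> e) y \<in> \<Omega>" if "y \<in> \<Omega>" for y
        by (rule dirichlet_solution.symmetric_of_touching[OF sol e mp' z w0 that])
    qed (use sym[OF e] mirror_inner[OF e] in auto)
    then show False using xe r by simp
  qed
  then have neg: "G i x \<bullet> e < 0" by (rule dirichlet_solution.hopf_plane[OF sol e mp' _ xO refl])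
  have "((\<lambda>r. u i (a + r *\<^sub>R e)) has_real_derivative G i (a + r *\<^sub>R e) \<bullet> e) (at r)"
    by (rule C2_function.u_line[OF sol_C2 x])
  moreover have "\<forall>\<^sub>F t in nhds r. u i (a + t *\<^sub>R e) = ub i (a + t *\<^sub>R e)"
  proof -
    have "((\<lambda>t::real. a + t *\<^sub>R e) \<longlongrightarrow> a + r *\<^sub>R e) (nhds r)" by (intro tendsto_intros filterlim_ident)
    then have "\<forall>\<^sub>F t in nhds r. a + t *\<^sub>R e \<in> \<Omega>" by (rule topological_tendstoD[OF _ open_dom x])
    then show ?thesis by eventually_elim (simp add: ub_in)
  qed
  ultimately have "((\<lambda>r. ub i (a + r *\<^sub>R e)) has_real_derivative G i x \<bullet> e) (at r)"
    using DERIV_cong_ev[OF refl _ refl, of "\<lambda>r. u i (a + r *\<^sub>R e)" "\<lambda>r. ub i (a + r *\<^sub>R e)" r] by (simp add: x_def)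
  with neg show ?thesis by blast
qed

end

lemma ball_and_radial:
  "\<exists>a R. R > 0 \<and> \<Omega> = ball a R \<and>
     (\<forall>i. \<exists>\<phi>. (\<forall>x\<in>closure \<Omega>. u i x = \<phi> (dist a x)) \<and>
        (\<forall>r. 0 < r \<and> r < R \<longrightarrow> (\<exists>D<0. (\<phi> has_real_derivative D) (at r))))"
proof -
  obtain a where a: "\<And>e i. norm e = 1 \<Longrightarrow> mpi i e (a \<bullet> e)"
    "\<And>e x. norm e = 1 \<Longrightarrow> x \<in> \<Omega> \<Longrightarrow> mirror e (a \<bullet> e) x \<in> \<Omega>"
    using symmetry_centre by metis
  obtain R where R: "R > 0" "\<Omega> = ball a R" using domain_ball[OF a] by blast
  obtain e :: 'a where "e \<in> Basis" using nonempty_Basis by blast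
  then have e: "norm e = 1" by simp
  \<comment> \<open>The profile is the extension by zero along one fixed ray, so a single formula
    also covers the frontier.\<close>
  have "u i x = ub i (a + dist a x *\<^sub>R e)" if "x \<in> closure \<Omega>" for i x
  proof -
    have "u i x = ub i x" using dirichlet_solution.ubar_closure[OF sol that] by simp
    also have "\<dots> = ub i (a + dist a x *\<^sub>R e)" by (rule ub_radial[OF a]) (simp_all add: dist_norm e)
    finally show ?thesis .
  qed
  moreover have "\<exists>D<0. ((\<lambda>r. ub i (a + r *\<^sub>R e)) has_real_derivative D) (at r)" if "0 < r" "r < R" for i r
    by (rule radial_derivative_neg[OF a e that(1)]) (use that R e in \<open>simp_all add: dist_norm\<close>)
  ultimately show ?thesis
    using R by (intro exI[of _ a] exI[of _ R] conjI allI exI[of _ "\<lambda>r. ub _ (a + r *\<^sub>R e)"]) auto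
qed

end

theorem theorem1p2:
  fixes \<Omega> :: "(real^'n) set"
    and \<nu> :: "real^'n \<Rightarrow> real^'n"
    and u :: "'m::finite \<Rightarrow> real^'n \<Rightarrow> real"
    and f g h :: "'m \<Rightarrow> real \<Rightarrow> real"
    and F :: "real^'m \<Rightarrow> real"
    and c :: real
  assumes "open \<Omega>" and "connected \<Omega>" and "bounded \<Omega>" and "\<Omega> \<noteq> {}" and "C2_domain \<Omega>"
    and normal: "\<forall>x\<in>frontier \<Omega>. inner_unit_normal \<Omega> x (\<nu> x)"
    and regular: "\<forall>i. C2_closure \<Omega> (u i)"
    and positive: "\<forall>i. \<forall>x\<in>\<Omega>. u i x > 0"
    and equation: "\<forall>i. \<forall>x\<in>\<Omega>. - laplacian (u i) x = f i (u i x)"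
    and dirichlet: "\<forall>i. \<forall>x\<in>frontier \<Omega>. u i x = 0"
    and overdetermined: "\<forall>x\<in>frontier \<Omega>. F (\<chi> i. inward_deriv (u i) (\<nu> x) x) = c"
    and f_split: "\<forall>i s. f i s = g i s + h i s"
    and g_lipschitz: "\<forall>i. locally_lipschitz (g i)"
    and h_mono: "\<forall>i. mono (h i)"
    and F_C1: "C1_on {x. \<forall>k. 0 < x $ k} F"
    and F_mono: "\<forall>i x d. (\<forall>k. 0 \<le> x $ k) \<and> 0 < d \<longrightarrow> F x \<le> F (x + d *\<^sub>R axis i 1)"
    and F_strict: "\<exists>j. \<forall>x. (\<forall>k. 0 < x $ k) \<longrightarrow> partial_deriv F j x > 0"
  shows "\<exists>a R. R > 0 \<and> \<Omega> = ball a R \<and>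
           (\<forall>i. \<exists>\<phi>. (\<forall>x\<in>closure \<Omega>. u i x = \<phi> (dist a x)) \<and>
                (\<forall>r. 0 < r \<and> r < R \<longrightarrow> (\<exists>D<0. (\<phi> has_real_derivative D) (at r))))"
proof -
  have dom: "smooth_domain \<Omega> \<nu>" using assms(1,3,5) normal by (intro smooth_domainI)
  \<comment> \<open>Pairing gradient and Hessian lets a single choice over the indices produce
    both.\<close>
  have "\<exists>GH. C2_function \<Omega> \<nu> (u i) (fst GH) (snd GH) \<and> (\<forall>x\<in>\<Omega>. (\<Sum>b\<in>Basis. b \<bullet> snd GH x b) = laplacian (u i) x)" for i
  proof -
    show ?thesis
    proof (rule C2_closure_C2_function[OF dom regular[rule_format, of i]])
      fix G H
      assume "C2_function \<Omega> \<nu> (u i) G H" "\<And>x. x \<in> \<Omega> \<Longrightarrow> (\<Sum>b\<in>Basis. b \<bullet> H x b) = laplacian (u i) x"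
      then show ?thesis by (intro exI[of _ "(G, H)"]) simp
    qed
  qed
  then obtain GH where GH: "\<And>i. C2_function \<Omega> \<nu> (u i) (fst (GH i)) (snd (GH i))"
      "\<And>i x. x \<in> \<Omega> \<Longrightarrow> (\<Sum>b\<in>Basis. b \<bullet> snd (GH i) x b) = laplacian (u i) x" by metis
  have sol: "dirichlet_solution \<Omega> \<nu> (u i) (fst (GH i)) (snd (GH i)) (f i) (g i) (h i)" for i
  proof (intro dirichlet_solution.intro dirichlet_solution_axioms.intro)
    fix x assume x: "x \<in> \<Omega>"
    show "(\<Sum>b\<in>Basis. b \<bullet> snd (GH i) x b) = - f i (u i x)"
      unfolding GH(2)[OF x] using equation x by (metis minus_minus)
  qed (use GH(1) assms in auto)
  interpret overdetermined \<Omega> \<nu> F u "\<lambda>i. fst (GH i)" "\<lambda>i. snd (GH i)" f g h c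
  proof (intro overdetermined.intro overdetermined_axioms.intro dom boundary_function.intro F_C1 F_mono F_strict sol assms(4))
    fix x assume x: "x \<in> frontier \<Omega>"
    have "inward_deriv (u i) (\<nu> x) x = fst (GH i) x \<bullet> \<nu> x" for i
      unfolding inward_deriv_def by (rule C2_function.inward_deriv_eq[OF GH(1) x])
    then show "F (\<chi> i. fst (GH i) x \<bullet> \<nu> x) = c" using overdetermined[rule_format, OF x] by simp
  qed
  show ?thesis by (rule ball_and_radial)
qed

end
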